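(* Let $\mathbb{M}$ be the multi operator-stable ISRM on $\mathcal{S}=\{A\in\mathcal{B}(\mathbb{R}^d):|A|<\infty\}$ described in the context. Fix $u\in\mathbb{R}^d$ and assume that $\mathbb{R}^d\ni s\mapsto B(s)$ is continuous at $u$ and such that $$\lim_{r\downarrow0}r^{dB(u+rs)}r^{-dB(u)}=\mathbb{E}_m$$ uniformly in $s$ on compact subsets of $\mathbb{R}^d$. Let $f_1,\ldots,f_n\in\mathcal{F}_{a,b}$ have compact support and satisfy $f_j(s_1)B(s_2)=B(s_2)f_j(s_1)$ for all $j=1,\ldots,n$ and $s_1,s_2\in\mathbb{R}^d$. Then, as $r\downarrow0$, the following convergence in distribution holds: $$\Big(r^{-dB(u)}\int_{\mathbb{R}^d}f_j(s)\,(T_{u,r}\mathbb{M})(ds):j=1,\ldots,n\Big)\Rightarrow\Big(\int_{\mathbb{R}^d}f_j(s)\,\mathbb{M}_u(ds):j=1,\ldots,n\Big),$$ where $\mathbb{M}_u$ is the operator-stable ISRM with constant exponent $B(u)$, spectral measure $\sigma$ and Lebesgue measure as underlying measure. Especially, $$\big(r^{-dB(u)}M(u+rA_1),\ldots,r^{-dB(u)}M(u+rA_n)\big)\Rightarrow\big(M_u(A_1),\ldots,M_u(A_n)\big)$$ for any bounded sets $A_1,\ldots,A_n\in\mathcal{B}(\mathbb{R}^d)$.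
   Context: Notation: $m,d\ge 1$; $\mathrm{L}(\mathbb{R}^m)$ is the set of linear operators on $\mathbb{R}^m$ ($m\times m$ matrices), $\mathbb{E}_m$ the identity matrix; $\|\cdot\|$ is the Euclidean norm and the operator norm; $r^D=\exp((\ln r)D)$ for $r>0$; $|\cdot|$ is Lebesgue measure on $\mathbb{R}^d$. For $D\in \mathrm{L}(\mathbb{R}^m)$, $\lambda_D$ and $\Lambda_D$ are the minimum and maximum of the real parts of the eigenvalues of $D$; $Q(\mathbb{R}^m):=\{D:\lambda_D>0\}$. Setting: for each $s\in \mathbb{R}^d$, $B(s)\in Q(\mathbb{R}^m)$ is symmetric, $s\mapsto B(s)$ is measurable, and with $\lambda(s):=\lambda_{B(s)}$, $\Lambda(s):=\Lambda_{B(s)}$ one has $1/2<\inf_{s}\lambda(s)\le\sup_{s}\Lambda(s)<\infty$. Put $a:=\inf_s\Lambda(s)^{-1}$, $b:=\sup_s\lambda(s)^{-1}$, so $0<a\le b<2$. $\sigma$ is a finite symmetric Borel measure on the Euclidean unit sphere $S^{m-1}$ whose support spans $\mathbb{R}^m$. For $s\in \mathbb{R}^d$, Borel $C\subset\mathbb{R}^m$, $$\varphi(s,C):=\int_0^\infty\int_{S^{m-1}}\mathbf 1_C(r^{B(s)}\theta)\,r^{-2}\,\sigma(d\theta)\,dr,\qquad \psi_s(v):=\int_{\mathbb{R}^m}(\cos\langle x,v\rangle-1)\,\varphi(s,dx).$$ Random measure: $\mathbb{M}=\{M(A):A\in\mathcal{S}\}$ is the multi operator-stable independently scattered random measure (ISRM):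 the $M(A)$ are $\mathbb{R}^m$-valued random vectors on one probability space, independent for pairwise disjoint sets, a.s. $\sigma$-additive over disjoint unions lying in $\mathcal{S}$, and $M(A)$ has characteristic function $v\mapsto\exp(\int_A\psi_s(v)\,ds)$. $\mathbb{M}_u=\{M_u(A):A\in\mathcal{S}\}$ is the ISRM obtained in the same way with $B(\cdot)$ replaced by the constant $B(u)$, i.e. $M_u(A)$ has characteristic function $v\mapsto\exp(|A|\psi_u(v))$. Integral (same for $\mathbb{M}_u$): for simple $f=\sum_jR_j\mathbf 1_{A_j}$ (finite sum, $R_j\in \mathrm{L}(\mathbb{R}^m)$, $A_j\in\mathcal{S}$ disjoint), $\int f\,d\mathbb{M}:=\sum_jR_jM(A_j)$. A measurable $f:\mathbb{R}^d\to \mathrm{L}(\mathbb{R}^m)$ is integrable, $f\in\mathcal{I}(\mathbb{M})$, if there are simple $f_n\to f$ a.e. such that $\int f_n\mathbf 1_A\,d\mathbb{M}$ converges in probability for every Borel $A$; then $\int f\,d\mathbb{M}$ is the limit in probability of $\int f_n\,d\mathbb{M}$. $\mathcal{F}_{a,b}$ is the set of measurable $f:\mathbb{R}^d\to \mathrm{L}(\mathbb{R}^m)$ with $\int_{\mathbb{R}^d}(\|f(s)\|^a+\|f(s)\|^b)\,ds<\infty$; one has $\mathcal{F}_{a,b}\subset\mathcal{I}(\mathbb{M})$. The scaling map is $T_{u,r}(s):=(s-u)/r$ ($u\in\mathbb{R}^d$, $r>0$), and $\int_{\mathbb{R}^d}f(s)\,(T_{u,r}\mathbb{M})(ds):=\int_{\mathbb{R}^d}f(T_{u,r}(s))\,\mathbb{M}(ds)$.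 *)

theory Defs
  imports "HOL-Probability.Probability"
begin

text \<open>Multiplication and powers from the type class hierarchy act componentwise on
  \<^typ>\<open>real^'m^'m\<close>, so the powers of a matrix are iterates of \<^term>\<open>(**)\<close>.\<close>

definition mat_pow :: "real^'m^'m \<Rightarrow> nat \<Rightarrow> real^'m^'m" where
  "mat_pow D k = ((\<lambda>X. D ** X) ^^ k) (mat 1)"

definition mat_exp :: "real^'m^'m \<Rightarrow> real^'m^'m" where
  "mat_exp D = (\<Sum>k. (1 / fact k) *\<^sub>R mat_pow D k)"

definition mat_powr :: "real \<Rightarrow> real^'m^'m \<Rightarrow> real^'m^'m" where
  "mat_powr r D = mat_exp (ln r *\<^sub>R D)"

definition eigenvalues :: "real^'m^'m \<Rightarrow> complex set" where
  "eigenvalues D = {z. \<exists>v. v \<noteq> 0 \<and> map_matrix complex_of_real D *v v = z *s v}"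

definition eig_min :: "real^'m^'m \<Rightarrow> real" where
  "eig_min D = Min (Re ` eigenvalues D)"

definition eig_max :: "real^'m^'m \<Rightarrow> real" where
  "eig_max D = Max (Re ` eigenvalues D)"

definition Q_matrices :: "(real^'m^'m) set" where
  "Q_matrices = {D. eig_min D > 0}"

definition op_norm :: "real^'m^'m \<Rightarrow> real" where
  "op_norm D = onorm ((*v) D)"

text \<open>Boundedness below of \<^term>\<open>\<lambda>s. eig_min (B s)\<close> is implied by
  \<^term>\<open>\<forall>s. B s \<in> Q_matrices\<close>, so the infimum is genuine; finiteness of the supremum of
  \<^term>\<open>\<lambda>s. eig_max (B s)\<close> is stated as boundedness above.\<close>

definition exponent_function :: "(real^'d \<Rightarrow> real^'m^'m) \<Rightarrow> bool" where
  "exponent_function B \<longleftrightarrow>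
     B \<in> borel_measurable borel \<and>
     (\<forall>s. B s \<in> Q_matrices \<and> transpose (B s) = B s) \<and>
     1/2 < (INF s. eig_min (B s)) \<and>
     bdd_above (range (\<lambda>s. eig_max (B s)))"

definition index_low :: "(real^'d \<Rightarrow> real^'m^'m) \<Rightarrow> real" where
  "index_low B = (INF s. inverse (eig_max (B s)))"

definition index_high :: "(real^'d \<Rightarrow> real^'m^'m) \<Rightarrow> real" where
  "index_high B = (SUP s. inverse (eig_min (B s)))"

text \<open>The underlying space of \<^term>\<open>\<sigma>\<close> is the sphere itself.\<close>

definition measure_support :: "(real^'m) measure \<Rightarrow> (real^'m) set" where
  "measure_support \<sigma> =
     {\<theta>\<in>space \<sigma>. \<forall>U. open U \<and> \<theta> \<in> U \<longrightarrow> emeasure \<sigma> (U \<inter> space \<sigma>) > 0}"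

definition spectral_measure :: "(real^'m) measure \<Rightarrow> bool" where
  "spectral_measure \<sigma> \<longleftrightarrow>
     sets \<sigma> = sets (restrict_space borel (sphere 0 1)) \<and>
     finite_measure \<sigma> \<and>
     (\<forall>C\<in>sets \<sigma>. emeasure \<sigma> (uminus ` C) = emeasure \<sigma> C) \<and>
     span (measure_support \<sigma>) = UNIV"

definition phi_measure :: "(real^'m) measure \<Rightarrow> real^'m^'m \<Rightarrow> (real^'m) measure" where
  "phi_measure \<sigma> D = measure_of UNIV (sets borel)
     (\<lambda>C. \<integral>\<^sup>+r\<in>{0<..}. (\<integral>\<^sup>+\<theta>. indicator C (mat_powr r D *v \<theta>) * ennreal (inverse (r^2)) \<partial>\<sigma>) \<partial>lborel)"

text \<open>\<^term>\<open>psi \<sigma> (B s)\<close> is the log-characteristic function attached to the point \<^term>\<open>s\<close>.\<close>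

definition psi :: "(real^'m) measure \<Rightarrow> real^'m^'m \<Rightarrow> real^'m \<Rightarrow> real" where
  "psi \<sigma> D v = (\<integral>x. (cos (x \<bullet> v) - 1) \<partial>(phi_measure \<sigma> D))"

definition finite_borel_sets :: "(real^'d) set set" where
  "finite_borel_sets = {A \<in> sets borel. emeasure lborel A < \<infinity>}"

definition mos_ISRM ::
  "'w measure \<Rightarrow> (real^'d \<Rightarrow> real^'m^'m) \<Rightarrow> (real^'m) measure
    \<Rightarrow> ((real^'d) set \<Rightarrow> 'w \<Rightarrow> real^'m) \<Rightarrow> bool" where
  "mos_ISRM P B \<sigma> M \<longleftrightarrow>
     prob_space P \<and>
     (\<forall>A\<in>finite_borel_sets. M A \<in> borel_measurable P) \<and>
     (\<forall>\<A>. \<A> \<subseteq> finite_borel_sets \<and> disjoint \<A>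
        \<longrightarrow> prob_space.indep_vars P (\<lambda>_. borel) M \<A>) \<and>
     (\<forall>A::nat \<Rightarrow> (real^'d) set.
        range A \<subseteq> finite_borel_sets \<and> disjoint_family A \<and> (\<Union>i. A i) \<in> finite_borel_sets
        \<longrightarrow> (AE \<omega> in P. (\<lambda>i. M (A i) \<omega>) sums M (\<Union>i. A i) \<omega>)) \<and>
     (\<forall>A\<in>finite_borel_sets. \<forall>v.
        (CLINT \<omega>|P. iexp (v \<bullet> M A \<omega>)) =
          exp (complex_of_real (LINT s:A|lborel. psi \<sigma> (B s) v)))"

definition tendsto_prob ::
  "'w measure \<Rightarrow> (nat \<Rightarrow> 'w \<Rightarrow> 'b::{metric_space, second_countable_topology}) \<Rightarrow> ('w \<Rightarrow> 'b) \<Rightarrow> bool" where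
  "tendsto_prob P X Y \<longleftrightarrow>
     (\<forall>k. X k \<in> borel_measurable P) \<and> Y \<in> borel_measurable P \<and>
     (\<forall>\<epsilon>>0. (\<lambda>k. measure P {\<omega>\<in>space P. dist (X k \<omega>) (Y \<omega>) > \<epsilon>}) \<longlonglongrightarrow> 0)"

definition simple_rep ::
  "(real^'d \<Rightarrow> real^'m^'m) \<Rightarrow> nat \<Rightarrow> (nat \<Rightarrow> real^'m^'m) \<Rightarrow> (nat \<Rightarrow> (real^'d) set) \<Rightarrow> bool" where
  "simple_rep f k R A \<longleftrightarrow>
     disjoint_family_on A {..<k} \<and> (\<forall>j<k. A j \<in> finite_borel_sets) \<and>
     f = (\<lambda>s. \<Sum>j<k. indicat_real (A j) s *\<^sub>R R j)"

definition is_simple :: "(real^'d \<Rightarrow> real^'m^'m) \<Rightarrow> bool" where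
  "is_simple f \<longleftrightarrow> (\<exists>k R A. simple_rep f k R A)"

text \<open>Both integrals are determined only up to null sets: different representations of the same
  simple function, and different approximating sequences, give almost surely equal random
  vectors. The choice operator picks one version.\<close>

definition simple_integral ::
  "((real^'d) set \<Rightarrow> 'w \<Rightarrow> real^'m) \<Rightarrow> (real^'d \<Rightarrow> real^'m^'m) \<Rightarrow> 'w \<Rightarrow> real^'m" where
  "simple_integral M f =
     (SOME X. \<exists>k R A. simple_rep f k R A \<and> X = (\<lambda>\<omega>. \<Sum>j<k. R j *v M (A j) \<omega>))"

definition has_isrm_integral ::
  "'w measure \<Rightarrow> ((real^'d) set \<Rightarrow> 'w \<Rightarrow> real^'m) \<Rightarrow> (real^'d \<Rightarrow> real^'m^'m)
    \<Rightarrow> ('w \<Rightarrow> real^'m) \<Rightarrow> bool" where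
  "has_isrm_integral P M f X \<longleftrightarrow>
     f \<in> borel_measurable borel \<and>
     (\<exists>F. (\<forall>k. is_simple (F k)) \<and>
        (AE s in lborel. (\<lambda>k. F k s) \<longlonglongrightarrow> f s) \<and>
        (\<forall>A\<in>sets borel. \<exists>Y.
           tendsto_prob P (\<lambda>k. simple_integral M (\<lambda>s. indicat_real A s *\<^sub>R F k s)) Y) \<and>
        tendsto_prob P (\<lambda>k. simple_integral M (F k)) X)"

definition isrm_integral ::
  "'w measure \<Rightarrow> ((real^'d) set \<Rightarrow> 'w \<Rightarrow> real^'m) \<Rightarrow> (real^'d \<Rightarrow> real^'m^'m)
    \<Rightarrow> 'w \<Rightarrow> real^'m" where
  "isrm_integral P M f = (SOME X. has_isrm_integral P M f X)"

definition F_class :: "real \<Rightarrow> real \<Rightarrow> (real^'d \<Rightarrow> real^'m^'m) set" where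
  "F_class a b = {f \<in> borel_measurable borel.
     (\<integral>\<^sup>+s. ennreal (op_norm (f s) powr a + op_norm (f s) powr b) \<partial>lborel) < \<infinity>}"

definition compact_support :: "(real^'d \<Rightarrow> real^'m^'m) \<Rightarrow> bool" where
  "compact_support f \<longleftrightarrow> compact (closure {s. f s \<noteq> 0})"

definition scaling :: "real^'d \<Rightarrow> real \<Rightarrow> real^'d \<Rightarrow> real^'d" where
  "scaling u r s = (s - u) /\<^sub>R r"

definition scaled_integral ::
  "'w measure \<Rightarrow> real^'d \<Rightarrow> real \<Rightarrow> ((real^'d) set \<Rightarrow> 'w \<Rightarrow> real^'m)
    \<Rightarrow> (real^'d \<Rightarrow> real^'m^'m) \<Rightarrow> 'w \<Rightarrow> real^'m" where
  "scaled_integral P u r M f = isrm_integral P M (\<lambda>s. f (scaling u r s))"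

text \<open>The distribution-level notion \<^const>\<open>weak_conv_m\<close> covers only real random variables and
  sequences; here the values are vectors and the parameter runs along an arbitrary filter.\<close>

definition conv_in_distr ::
  "'w measure \<Rightarrow> ('i \<Rightarrow> 'w \<Rightarrow> 'b::{metric_space, second_countable_topology})
    \<Rightarrow> 'v measure \<Rightarrow> ('v \<Rightarrow> 'b) \<Rightarrow> 'i filter \<Rightarrow> bool" where
  "conv_in_distr P X Q Y F \<longleftrightarrow>
     (\<forall>\<^sub>F r in F. X r \<in> borel_measurable P) \<and> Y \<in> borel_measurable Q \<and>
     (\<forall>g::'b \<Rightarrow> real. continuous_on UNIV g \<and> bounded (range g) \<longrightarrow>
        ((\<lambda>r. \<integral>\<omega>. g (X r \<omega>) \<partial>P) \<longlongrightarrow> (\<integral>\<omega>. g (Y \<omega>) \<partial>Q)) F)"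

text \<open>\<^const>\<open>measure_of\<close> yields the null measure on set functions that are not countably
  additive; the next lemmas show that this does not happen for \<^const>\<open>phi_measure\<close>.\<close>

lemma mat_pow_scaleR: "mat_pow (c *\<^sub>R D) k = c ^ k *\<^sub>R mat_pow D k"
proof (induction k)
  case (Suc k)
  then show ?case
    by (simp add: mat_pow_def matrix_scalar_ac scalar_matrix_assoc mult.commute
        scaleR_matrix_vector_assoc flip: scalar_mult_eq_scaleR)
qed (simp add: mat_pow_def)

lemma borel_measurable_mat_powr [measurable]: "(\<lambda>r. mat_powr r D) \<in> borel_measurable borel"
  unfolding mat_powr_def mat_exp_def mat_pow_scaleR by measurable

lemma borel_measurable_mat_powr_mult:
  assumes "sets \<sigma> = sets (restrict_space borel (sphere 0 1))"
  shows "(\<lambda>(r, \<theta>). mat_powr r D *v \<theta>) \<in> borel_measurable (lborel \<Otimes>\<^sub>M \<sigma>)"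
proof -
  have "(\<lambda>x::real^'m. x) \<in> borel_measurable (restrict_space borel (sphere 0 1))"
    by (rule measurable_restrict_space1) simp
  then have id: "(\<lambda>x. x) \<in> borel_measurable \<sigma>"
    by (simp cong: measurable_cong_sets add: assms)
  have cont: "continuous_on UNIV (\<lambda>x::(real^'m^'m) \<times> (real^'m). fst x *v snd x)"
    unfolding matrix_vector_mult_def by (intro continuous_intros)
  have [measurable]: "(\<lambda>x. snd x) \<in> borel_measurable (lborel \<Otimes>\<^sub>M \<sigma>)"
    using measurable_compose[OF measurable_snd id] .
  have [measurable]: "(\<lambda>x. mat_powr (fst x) D) \<in> borel_measurable (lborel \<Otimes>\<^sub>M \<sigma>)"
    using measurable_compose[OF measurable_fst, of "\<lambda>r. mat_powr r D" lborel borel \<sigma>] by simp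
  show ?thesis
    using borel_measurable_continuous_Pair[of "\<lambda>x. mat_powr (fst x) D" "lborel \<Otimes>\<^sub>M \<sigma>" "\<lambda>x. snd x" "\<lambda>A v. A *v v"]
      cont by (simp add: case_prod_unfold)
qed

lemma emeasure_phi_measure:
  assumes \<sigma>: "spectral_measure \<sigma>" and C: "C \<in> sets borel"
  shows "emeasure (phi_measure \<sigma> D) C =
    (\<integral>\<^sup>+r\<in>{0<..}. (\<integral>\<^sup>+\<theta>. indicator C (mat_powr r D *v \<theta>) * ennreal (inverse (r^2)) \<partial>\<sigma>) \<partial>lborel)"
proof -
  interpret finite_measure \<sigma> using \<sigma> by (simp add: spectral_measure_def)
  have [measurable]: "(\<lambda>(r, \<theta>). mat_powr r D *v \<theta>) \<in> borel_measurable (lborel \<Otimes>\<^sub>M \<sigma>)"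
    using \<sigma> by (intro borel_measurable_mat_powr_mult) (simp add: spectral_measure_def)
  have meas [measurable]: "(\<lambda>(r, \<theta>). indicator C (mat_powr r D *v \<theta>) * ennreal (inverse (r^2)))
      \<in> borel_measurable (lborel \<Otimes>\<^sub>M \<sigma>)" if [measurable]: "C \<in> sets borel" for C
    by measurable
  let ?\<mu> = "\<lambda>C. \<integral>\<^sup>+r\<in>{0<..}. (\<integral>\<^sup>+\<theta>. indicator C (mat_powr r D *v \<theta>) * ennreal (inverse (r^2)) \<partial>\<sigma>) \<partial>lborel"
  have ca: "countably_additive (sets borel) ?\<mu>"
  proof (rule countably_additiveI)
    fix A :: "nat \<Rightarrow> (real^'a) set"
    assume A: "range A \<subseteq> sets borel" "disjoint_family A" "(\<Union>i. A i) \<in> sets borel"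
    then have [measurable]: "A i \<in> sets borel" for i by auto
    have slice: "(\<lambda>\<theta>. indicator (A i) (mat_powr r D *v \<theta>) * ennreal (inverse (r^2))) \<in> borel_measurable \<sigma>"
      for i r using measurable_Pair2[OF meas, of "A i" r] by simp
    have "(\<Sum>i. ?\<mu> (A i)) = (\<integral>\<^sup>+r. (\<Sum>i. (\<integral>\<^sup>+\<theta>. indicator (A i) (mat_powr r D *v \<theta>) * ennreal (inverse (r^2)) \<partial>\<sigma>) * indicator {0<..} r) \<partial>lborel)"
      by (rule nn_integral_suminf[symmetric]) measurable
    also have "\<dots> = ?\<mu> (\<Union>i. A i)"
    proof (rule nn_integral_cong)
      fix r :: real
      have "(\<Sum>i. (\<integral>\<^sup>+\<theta>. indicator (A i) (mat_powr r D *v \<theta>) * ennreal (inverse (r^2)) \<partial>\<sigma>)) =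
        (\<integral>\<^sup>+\<theta>. (\<Sum>i. indicator (A i) (mat_powr r D *v \<theta>) * ennreal (inverse (r^2))) \<partial>\<sigma>)"
        using slice by (intro nn_integral_suminf[symmetric])
      also have "\<dots> = (\<integral>\<^sup>+\<theta>. indicator (\<Union>i. A i) (mat_powr r D *v \<theta>) * ennreal (inverse (r^2)) \<partial>\<sigma>)"
        using A(2) by (simp add: ennreal_suminf_multc suminf_indicator)
      finally show "(\<Sum>i. (\<integral>\<^sup>+\<theta>. indicator (A i) (mat_powr r D *v \<theta>) * ennreal (inverse (r^2)) \<partial>\<sigma>) * indicator {0<..} r)
        = (\<integral>\<^sup>+\<theta>. indicator (\<Union>i. A i) (mat_powr r D *v \<theta>) * ennreal (inverse (r^2)) \<partial>\<sigma>) * indicator {0<..} r"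
        by (simp add: ennreal_suminf_multc)
    qed
    finally show "(\<Sum>i. ?\<mu> (A i)) = ?\<mu> (\<Union>i. A i)" .
  qed
  have "sigma_sets UNIV (sets borel) = (sets borel :: (real^'a) set set)"
    using sets.sigma_sets_eq[of borel] by simp
  then show ?thesis
    unfolding phi_measure_def using ca C
    by (intro emeasure_measure_of_sigma)
      (auto simp: positive_def space_borel[symmetric] simp del: space_borel intro: sets.sigma_algebra_axioms)
qed

end

theory Submission
  imports Defs
begin

text \<open>
  By the Levy continuity theorem it suffices to follow joint characteristic functions. If \<open>f\<close> lies in
  the class of integrands, \<open>\<integral> f dM\<close> has characteristic function
  \<open>v \<mapsto> exp (\<integral> \<psi>\<^sub>s (f(s)\<^sup>T v) ds)\<close>. For the vector of the rescaled integrals, put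
  \<open>z(x) = \<Sum>\<^sub>j f\<^sub>j(x)\<^sup>T w\<^sub>j\<close>. The substitution \<open>s = u + r x\<close> gives a factor \<open>r\<^sup>d\<close>. The exponents are operator
  stable, \<open>t \<psi>\<^sub>D(v) = \<psi>\<^sub>D(t\<^sup>D v)\<close> for symmetric \<open>D\<close>, so this factor turns into \<open>r\<^bsup>dB(u+rx)\<^esup>\<close>
  inside \<open>\<psi>\<close>. As the \<open>f\<^sub>j\<close> commute with \<open>B(u)\<close>, the logarithm of the characteristic function is
  \<open>\<integral> \<psi>\<^bsub>u+rx\<^esub> (r\<^bsup>dB(u+rx)\<^esup> r\<^bsup>-dB(u)\<^esup> z(x)) dx\<close>, see \<open>scaled_exponent\<close>. The product of the two powers tends to
  the identity uniformly on the support of the \<open>f\<^sub>j\<close>, and \<open>\<psi>\<close> is continuous in exponent and argument,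
  with \<open>|\<psi>\<^sub>s(v)| \<le> C (|v|\<^sup>a + |v|\<^sup>b)\<close>. Dominated convergence yields \<open>\<integral> \<psi>\<^sub>u(z(x)) dx\<close>, the
  logarithm for \<open>M\<^sub>u\<close>; this is \<open>scaled_exponent_tendsto\<close>. The statement on sets is the case
  \<open>f\<^sub>j = 1\<^bsub>A j\<^esub> I\<close>.

  Four ingredients carry this argument.

  The Levy measure is the image of \<open>r\<^sup>-\<^sup>2 dr \<sigma>(d\<theta>)\<close> under \<open>(r, \<theta>) \<mapsto> r\<^sup>D \<theta>\<close> (\<open>psi_eq_kernel\<close>). Bounds, continuity
  and scaling of \<open>\<psi>\<close> follow from the growth of \<open>r\<^sup>D\<close>, which a differential inequality derives from the
  extreme values of the quadratic form of \<open>D\<close>; those are the extreme eigenvalues.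

  Convergence of characteristic functions in several dimensions is reduced to trigonometric
  polynomials, by approximating with polynomials in \<open>sin (x\<^sub>b / L)\<close>, and to tightness, which follows
  from the one-dimensional theorem (\<open>levy_continuity_euclidean\<close>).

  All linear relations between integrals of simple functions hold almost surely because they hold on
  the atoms generated by the sets involved (\<open>mos_ISRM_linear_relation\<close>). Existence of the integral
  follows because differences of dominated approximations have characteristic functions tending
  to \<open>1\<close>, and convergence in probability is complete.

  Finally, the characteristic function must not depend on the approximating sequence in the definition
  of the integral, of which nothing is known but almost everywhere convergence and convergence over all
  Borel sets. A gliding hump excludes that mass of the exponents escapes
  (\<open>setwise_convergence_imp_integral_convergence\<close>).
\<close>

section \<open>The matrix exponential\<close>

definition entry_bound :: "real^'m^'m \<Rightarrow> real" where
  "entry_bound D = (\<Sum>i\<in>UNIV. \<Sum>j\<in>UNIV. \<bar>D $ i $ j\<bar>)"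

lemma entry_bound_nonneg: "0 \<le> entry_bound D"
  by (simp add: entry_bound_def sum_nonneg)

lemma mat_pow_0 [simp]: "mat_pow D 0 = mat 1"
  and mat_pow_Suc: "mat_pow D (Suc k) = D ** mat_pow D k"
  by (simp_all add: mat_pow_def)

text \<open>This makes every entry of \<open>exp (t D)\<close> an everywhere convergent power series in \<open>t\<close>, so that real
  power series can be used entry by entry.\<close>

lemma mat_pow_entry_le: "\<bar>mat_pow D k $ i $ j\<bar> \<le> entry_bound D ^ k"
proof (induction k arbitrary: i j)
  case 0
  then show ?case by (simp add: mat_def)
next
  case (Suc k)
  have "\<bar>mat_pow D (Suc k) $ i $ j\<bar> \<le> (\<Sum>l\<in>UNIV. \<bar>D $ i $ l * mat_pow D k $ l $ j\<bar>)"
    by (simp add: mat_pow_Suc matrix_matrix_mult_def)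
  also have "\<dots> \<le> (\<Sum>l\<in>UNIV. \<bar>D $ i $ l\<bar> * entry_bound D ^ k)"
    unfolding abs_mult by (intro sum_mono mult_left_mono Suc) auto
  also have "\<dots> = (\<Sum>l\<in>UNIV. \<bar>D $ i $ l\<bar>) * entry_bound D ^ k"
    by (simp add: sum_distrib_right)
  also have "\<dots> \<le> entry_bound D * entry_bound D ^ k"
    unfolding entry_bound_def
    by (intro mult_right_mono member_le_sum) (auto intro: sum_nonneg simp: sum_nonneg)
  finally show ?case by simp
qed

lemma summable_exp_entries:
  "summable (\<lambda>k. mat_pow D k $ i $ j / fact k * t ^ k)"
proof (rule summable_comparison_test')
  show "summable (\<lambda>k. inverse (fact k) * (entry_bound D * \<bar>t\<bar>) ^ k)"
    by (rule summable_exp)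
  show "norm (mat_pow D k $ i $ j / fact k * t ^ k) \<le> inverse (fact k) * (entry_bound D * \<bar>t\<bar>) ^ k"
    if "k \<ge> 0" for k
    using mult_right_mono[OF mat_pow_entry_le[of D k i j], of "\<bar>t\<bar> ^ k / fact k"]
    by (simp add: abs_mult power_mult_distrib power_abs field_simps)
qed

lemma sums_vec_iff: "f sums l \<longleftrightarrow> (\<forall>i. (\<lambda>k. f k $ i) sums (l $ i))"
  for f :: "nat \<Rightarrow> 'a::{comm_monoid_add,topological_space}^'n"
  unfolding sums_def
  by (auto intro!: vec_tendstoI dest: tendsto_vec_nth)

lemma mat_exp_sums: "(\<lambda>k. (1 / fact k) *\<^sub>R mat_pow D k) sums mat_exp D"
proof -
  have "(\<lambda>k. (1 / fact k) *\<^sub>R mat_pow D k) sums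
        (\<chi> i j. \<Sum>k. mat_pow D k $ i $ j / fact k * 1 ^ k)"
    unfolding sums_vec_iff
  proof (intro allI)
    fix i j
    show "(\<lambda>k. ((1 / fact k) *\<^sub>R mat_pow D k) $ i $ j) sums
        ((\<chi> i j. \<Sum>k. mat_pow D k $ i $ j / fact k * 1 ^ k) $ i $ j)"
      using summable_sums[OF summable_exp_entries[of D i j 1]] by simp
  qed
  then show ?thesis
    by (simp add: mat_exp_def sums_iff)
qed

lemma mat_exp_entry: "mat_exp (t *\<^sub>R D) $ i $ j = (\<Sum>k. mat_pow D k $ i $ j / fact k * t ^ k)"
proof -
  have "(\<lambda>k. ((1 / fact k) *\<^sub>R mat_pow (t *\<^sub>R D) k) $ i $ j) sums (mat_exp (t *\<^sub>R D) $ i $ j)"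
    using mat_exp_sums[of "t *\<^sub>R D"] by (simp only: sums_vec_iff)
  then show ?thesis
    by (simp add: sums_iff mat_pow_scaleR mult_ac)
qed

lemma mat_exp_0 [simp]: "mat_exp 0 = mat 1"
proof -
  have "mat_exp (0 *\<^sub>R 0) = (mat 1 :: real^'m^'m)"
    unfolding vec_eq_iff mat_exp_entry by (intro allI) (subst powser_zero, simp)
  then show ?thesis by simp
qed

lemma has_vector_derivative_matrixI:
  fixes f :: "real \<Rightarrow> real^'n^'m"
  assumes "\<And>i j. ((\<lambda>x. f x $ i $ j) has_field_derivative (f' $ i $ j)) (at x within S)"
  shows "(f has_vector_derivative f') (at x within S)"
  unfolding has_vector_derivative_def
proof (subst has_derivative_componentwise_within, safe)
  fix b :: "real^'n^'m" assume "b \<in> Basis"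
  then obtain i j where b: "b = axis i (axis j 1)" by (auto simp: Basis_vec_def)
  show "((\<lambda>x. f x \<bullet> b) has_derivative (\<lambda>x. (x *\<^sub>R f') \<bullet> b)) (at x within S)"
    using assms[of i j] by (simp add: b inner_axis has_field_derivative_def mult_commute_abs)
qed

text \<open>Termwise differentiation of the entries shifts the powers of \<open>D\<close> by one.\<close>

lemma mat_exp_has_vector_derivative:
  "((\<lambda>t. mat_exp (t *\<^sub>R D)) has_vector_derivative D ** mat_exp (t *\<^sub>R D)) (at t within S)"
proof (rule has_vector_derivative_matrixI)
  fix i j
  let ?c = "\<lambda>i k. mat_pow D k $ i $ j / fact k"
  have eq: "diffs (?c i) k * t ^ k = (\<Sum>l\<in>UNIV. D $ i $ l * (?c l k * t ^ k))" for k
    by (simp add: diffs_def mat_pow_Suc matrix_matrix_mult_def sum_distrib_right sum_divide_distrib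
        divide_simps del: of_nat_Suc) (simp add: sum_distrib_right sum_distrib_left mult_ac)
  have "(\<lambda>k. \<Sum>l\<in>UNIV. D $ i $ l * (?c l k * t ^ k)) sums
      (\<Sum>l\<in>UNIV. D $ i $ l * (\<Sum>k. ?c l k * t ^ k))"
    by (intro sums_sum sums_mult summable_sums summable_exp_entries)
  then have "(\<Sum>k. diffs (?c i) k * t ^ k) = (\<Sum>l\<in>UNIV. D $ i $ l * (\<Sum>k. ?c l k * t ^ k))"
    by (simp only: eq sums_iff)
  then show "((\<lambda>x. mat_exp (x *\<^sub>R D) $ i $ j) has_field_derivative (D ** mat_exp (t *\<^sub>R D)) $ i $ j)
      (at t within S)"
    using termdiffs_strong_converges_everywhere[of "?c i" t] summable_exp_entries[of D i j]
    by (simp add: mat_exp_entry matrix_matrix_mult_def has_field_derivative_at_within)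
qed

lemma bounded_bilinear_matrix_mult: "bounded_bilinear ((**) :: real^'n^'m \<Rightarrow> real^'k^'n \<Rightarrow> real^'k^'m)"
  unfolding bilinear_conv_bounded_bilinear[symmetric] bilinear_def
  by (auto intro!: linearI simp: matrix_add_ldistrib
      scaleR_vec_def matrix_matrix_mult_def vec_eq_iff sum.distrib sum_distrib_left algebra_simps)

lemma bounded_bilinear_matrix_vector_mult:
  "bounded_bilinear ((*v) :: real^'n^'m \<Rightarrow> real^'n \<Rightarrow> real^'m)"
  unfolding bilinear_conv_bounded_bilinear[symmetric] bilinear_def
  by (auto intro!: linearI simp: matrix_vector_mult_add_rdistrib matrix_vector_right_distrib
      scaleR_matrix_vector_assoc matrix_vector_mult_scaleR)

interpretation matrix_mult: bounded_bilinear "(**) :: real^'n^'m \<Rightarrow> real^'k^'n \<Rightarrow> real^'k^'m"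
  by (rule bounded_bilinear_matrix_mult)

interpretation matrix_vector_mult: bounded_bilinear "(*v) :: real^'n^'m \<Rightarrow> real^'n \<Rightarrow> real^'m"
  by (rule bounded_bilinear_matrix_vector_mult)

lemma commute_mat_exp:
  assumes "X ** D = D ** X"
  shows "X ** mat_exp D = mat_exp D ** X"
proof -
  have pow: "X ** mat_pow D k = mat_pow D k ** X" for k
    by (induction k) (simp_all add: mat_pow_Suc matrix_mul_assoc assms, simp add: assms flip: matrix_mul_assoc)
  have "(\<lambda>k. X ** ((1 / fact k) *\<^sub>R mat_pow D k)) sums (X ** mat_exp D)"
    by (rule bounded_linear.sums[OF matrix_mult.bounded_linear_right mat_exp_sums])
  moreover have "(\<lambda>k. ((1 / fact k) *\<^sub>R mat_pow D k) ** X) sums (mat_exp D ** X)"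
    by (rule bounded_linear.sums[OF matrix_mult.bounded_linear_left mat_exp_sums])
  ultimately show ?thesis
    by (simp add: matrix_mult.scaleR_left matrix_mult.scaleR_right pow sums_unique2)
qed

lemma transpose_mat_exp: "transpose (mat_exp D) = mat_exp (transpose D)"
proof -
  have comm: "mat_pow D k ** D = D ** mat_pow D k" for k
    by (induction k) (simp_all add: mat_pow_Suc flip: matrix_mul_assoc)
  have pow: "transpose (mat_pow D k) = mat_pow (transpose D) k" for k
    by (induction k) (simp_all add: mat_pow_Suc transpose_mat matrix_transpose_mul flip: comm)
  have "bounded_linear (transpose :: real^'m^'m \<Rightarrow> real^'m^'m)"
    unfolding linear_conv_bounded_linear[symmetric]
    by (auto intro!: linearI simp: transpose_def vec_eq_iff)
  from bounded_linear.sums[OF this mat_exp_sums[of D]]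
  have "(\<lambda>k. (1 / fact k) *\<^sub>R mat_pow (transpose D) k) sums transpose (mat_exp D)"
    by (simp add: pow[symmetric] transpose_scalar scalar_mult_eq_scaleR)
  then show ?thesis using mat_exp_sums[of "transpose D"] sums_unique2 by blast
qed

text \<open>The left-hand side does not depend on \<open>t\<close>: its derivative vanishes, because \<open>exp (- t D)\<close> commutes
  with \<open>D\<close>. At \<open>t = 0\<close> it is the right-hand side.\<close>

lemma mat_exp_minus_add: "mat_exp (- t *\<^sub>R D) ** mat_exp ((t + s) *\<^sub>R D) = mat_exp (s *\<^sub>R D)"
proof -
  let ?F = "\<lambda>t. mat_exp (- t *\<^sub>R D) ** mat_exp ((t + s) *\<^sub>R D)"
  have 1: "((\<lambda>t. mat_exp (- t *\<^sub>R D)) has_vector_derivative (- 1) *\<^sub>R (D ** mat_exp (- t *\<^sub>R D))) (at t)" for t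
    using vector_diff_chain_at[of uminus "-1" t, OF _ mat_exp_has_vector_derivative[of D "- t" UNIV]]
      has_vector_derivative_minus[OF has_vector_derivative_id, of "at t"]
    by (simp add: o_def)
  have 2: "((\<lambda>t. mat_exp ((t + s) *\<^sub>R D)) has_vector_derivative 1 *\<^sub>R (D ** mat_exp ((t + s) *\<^sub>R D))) (at t)" for t
    using vector_diff_chain_at[of "\<lambda>t. t + s" 1 t, OF _ mat_exp_has_vector_derivative[of D "t + s" UNIV]]
      has_vector_derivative_add_const[of "\<lambda>t. t" s 1 "at t"]
    by (simp add: o_def)
  have comm: "mat_exp (- (t *\<^sub>R D)) ** D = D ** mat_exp (- (t *\<^sub>R D))" for t
    by (rule commute_mat_exp[symmetric])
      (simp add: matrix_mult.minus_left matrix_mult.minus_right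
        matrix_mult.scaleR_left matrix_mult.scaleR_right)
  have "(?F has_vector_derivative 0) (at t)" for t
  proof -
    let ?E = "mat_exp (- t *\<^sub>R D)" and ?X = "mat_exp ((t + s) *\<^sub>R D)"
    have "?E ** (1 *\<^sub>R (D ** ?X)) + ((- 1) *\<^sub>R (D ** ?E)) ** ?X = ?E ** D ** ?X - D ** ?E ** ?X"
      by (simp add: matrix_mul_assoc matrix_mult.minus_left)
    also have "\<dots> = 0" using comm[of t] by simp
    finally show ?thesis
      using matrix_mult.has_vector_derivative[OF 1[of t] 2[of t]]
      by (simp only:)
  qed
  then obtain c where c: "\<And>t. ?F t = c"
    using has_vector_derivative_zero_constant[of UNIV ?F] by auto
  show ?thesis using c[of t] c[of 0] by simp
qed

lemma mat_exp_add: "mat_exp ((t + s) *\<^sub>R D) = mat_exp (t *\<^sub>R D) ** mat_exp (s *\<^sub>R D)"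
proof -
  have "mat_exp (- (- t) *\<^sub>R D) ** mat_exp ((- t + (t + s)) *\<^sub>R D) = mat_exp ((t + s) *\<^sub>R D)"
    by (rule mat_exp_minus_add)
  then show ?thesis by simp
qed

text \<open>Near the limit the entry bounds stay below a constant, whose exponential series dominates the entries;
  Tannery's theorem then allows the limit under the sum.\<close>

lemma tendsto_mat_exp:
  fixes D :: "real^'m^'m"
  assumes "(E \<longlongrightarrow> D) F"
  shows "((\<lambda>x. mat_exp (E x)) \<longlongrightarrow> mat_exp D) F"
proof (cases "F = bot")
  case False
  show ?thesis
  proof (intro vec_tendstoI)
    fix i j
    have ent: "mat_exp D $ i $ j = (\<Sum>k. mat_pow D k $ i $ j / fact k)" for D :: "real^'m^'m"
      using mat_exp_entry[of 1 D i j] by simp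
    have "((\<lambda>x. entry_bound (E x)) \<longlongrightarrow> entry_bound D) F"
      unfolding entry_bound_def by (intro tendsto_intros assms)
    then have ev: "\<forall>\<^sub>F x in F. entry_bound (E x) < entry_bound D + 1"
      by (rule order_tendstoD) simp
    have pow: "((\<lambda>x. mat_pow (E x) k) \<longlongrightarrow> mat_pow D k) F" for k
      by (induction k) (auto simp: mat_pow_Suc intro!: matrix_mult.tendsto assms)
    show "((\<lambda>x. mat_exp (E x) $ i $ j) \<longlongrightarrow> mat_exp D $ i $ j) F"
      unfolding ent
    proof (rule tannerys_theorem[THEN conjunct2, THEN conjunct2])
      show "((\<lambda>x. mat_pow (E x) k $ i $ j / fact k) \<longlongrightarrow> mat_pow D k $ i $ j / fact k) F" for k
        by (intro tendsto_intros pow) simp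
      show "summable (\<lambda>k. inverse (fact k) * (entry_bound D + 1) ^ k)" by (rule summable_exp)
      have "\<forall>\<^sub>F (k, x) in sequentially \<times>\<^sub>F F. entry_bound (E x) < entry_bound D + 1"
        using eventually_prod2[of sequentially "\<lambda>x. entry_bound (E x) < entry_bound D + 1" F] ev by simp
      then show "\<forall>\<^sub>F (k, x) in sequentially \<times>\<^sub>F F. norm (mat_pow (E x) k $ i $ j / fact k)
          \<le> inverse (fact k) * (entry_bound D + 1) ^ k"
      proof (rule eventually_mono, clarify)
        fix k x assume "entry_bound (E x) < entry_bound D + 1"
        then have "\<bar>mat_pow (E x) k $ i $ j\<bar> \<le> (entry_bound D + 1) ^ k"
          using mat_pow_entry_le[of "E x" k i j] power_mono[of "entry_bound (E x)" "entry_bound D + 1" k]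
          by (auto simp: entry_bound_nonneg)
        then show "norm (mat_pow (E x) k $ i $ j / fact k) \<le> inverse (fact k) * (entry_bound D + 1) ^ k"
          by (simp add: field_simps)
      qed
    qed (fact False)
  qed
qed simp

text \<open>A solution of \<open>y' = D y\<close> satisfies \<open>(|y|\<^sup>2)' = 2 y \<bullet> D y \<le> 2 c |y|\<^sup>2\<close>, so \<open>exp (- 2 c t) |y|\<^sup>2\<close> decreases.
  This gives the growth of \<open>exp (t D)\<close> from the quadratic form alone, without diagonalising \<open>D\<close>.\<close>

lemma mat_exp_norm_bound:
  assumes upper: "\<And>x. x \<bullet> (D *v x) \<le> c * (norm x)\<^sup>2" and "0 \<le> t"
  shows "norm (mat_exp (t *\<^sub>R D) *v x) \<le> exp (c * t) * norm x"
proof -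
  let ?y = "\<lambda>t. mat_exp (t *\<^sub>R D) *v x"
  let ?h = "\<lambda>t. exp (- (2 * c * t)) * (?y t \<bullet> ?y t)"
  have y: "(?y has_vector_derivative D *v ?y t) (at t)" for t
    using matrix_vector_mult.has_vector_derivative[OF
        mat_exp_has_vector_derivative[of D t UNIV] has_vector_derivative_const[of x]]
    by (simp add: matrix_vector_mul_assoc)
  have yy: "((\<lambda>t. ?y t \<bullet> ?y t) has_real_derivative 2 * (?y t \<bullet> (D *v ?y t))) (at t)" for t
    using bounded_bilinear.has_vector_derivative[OF bounded_bilinear_inner y[of t] y[of t]]
    by (simp add: has_real_derivative_iff_has_vector_derivative inner_commute)
  have h: "(?h has_real_derivative 2 * exp (- (2 * c * t)) * (?y t \<bullet> (D *v ?y t) - c * (norm (?y t))\<^sup>2)) (at t)" for t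
    by (auto intro!: derivative_eq_intros yy simp: power2_norm_eq_inner algebra_simps)
  have "?h t \<le> ?h 0"
    by (rule DERIV_nonpos_imp_nonincreasing[OF \<open>0 \<le> t\<close>])
      (use h upper in \<open>force intro!: exI mult_nonneg_nonpos\<close>)
  then have "(norm (?y t))\<^sup>2 \<le> exp (2 * c * t) * (norm x)\<^sup>2"
    by (simp add: power2_norm_eq_inner exp_minus field_simps)
  also have "\<dots> = (exp (c * t) * norm x)\<^sup>2"
    by (simp add: power_mult_distrib mult_ac flip: exp_double)
  finally show ?thesis by (rule power2_le_imp_le) simp
qed

text \<open>For \<open>r \<ge> 1\<close> the upper bound of the quadratic form governs \<open>r\<^sup>D\<close>; for \<open>r < 1\<close> the logarithm is
  negative, so the same estimate applied to \<open>- D\<close> brings in the lower bound. The sum serves both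
  ranges.\<close>

lemma norm_mat_powr_le:
  assumes "\<And>x. l * (norm x)\<^sup>2 \<le> x \<bullet> (D *v x)" "\<And>x. x \<bullet> (D *v x) \<le> c * (norm x)\<^sup>2" "0 < r"
  shows "norm (mat_powr r D *v x) \<le> (r powr l + r powr c) * norm x"
proof (cases "1 \<le> r")
  case True
  have "norm (mat_powr r D *v x) \<le> r powr c * norm x"
    unfolding mat_powr_def using mat_exp_norm_bound[of D c "ln r" x] assms True
    by (simp add: powr_def)
  also have "\<dots> \<le> (r powr l + r powr c) * norm x"
    by (intro mult_right_mono) auto
  finally show ?thesis .
next
  case False
  have "norm (mat_exp (- ln r *\<^sub>R (- D)) *v x) \<le> exp (- l * - ln r) * norm x"
    using assms False by (intro mat_exp_norm_bound) (auto simp: matrix_vector_mult.minus_left)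
  then have "norm (mat_powr r D *v x) \<le> r powr l * norm x"
    unfolding mat_powr_def using assms False by (simp add: powr_def)
  also have "\<dots> \<le> (r powr l + r powr c) * norm x"
    by (intro mult_right_mono) auto
  finally show ?thesis .
qed

lemma mat_powr_mult:
  assumes "0 < r" "0 < t"
  shows "mat_powr (r * t) D = mat_powr r D ** mat_powr t D"
  using assms by (simp add: mat_powr_def ln_mult mat_exp_add)

lemma mat_powr_scaleR: "0 < r \<Longrightarrow> mat_powr r (c *\<^sub>R D) = mat_powr (r powr c) D"
  by (simp add: mat_powr_def mult.commute)

lemma commute_mat_powr: "X ** D = D ** X \<Longrightarrow> X ** mat_powr r D = mat_powr r D ** X"
  unfolding mat_powr_def
  by (rule commute_mat_exp)
    (simp add: matrix_mult.scaleR_left matrix_mult.scaleR_right)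

lemma transpose_mat_powr: "transpose (mat_powr r D) = mat_powr r (transpose D)"
  by (simp add: mat_powr_def transpose_mat_exp transpose_scalar flip: scalar_mult_eq_scaleR)

lemma tendsto_mat_powr: "(E \<longlongrightarrow> D) F \<Longrightarrow> ((\<lambda>x. mat_powr r (E x)) \<longlongrightarrow> mat_powr r D) F"
  unfolding mat_powr_def by (intro tendsto_mat_exp tendsto_intros)

section \<open>The spectrum of a symmetric matrix\<close>

lemma symmetric_inner_commute:
  fixes D :: "real^'m^'m"
  assumes "transpose D = D"
  shows "x \<bullet> (D *v y) = (D *v x) \<bullet> y"
  using dot_lmul_matrix[of x D y] transpose_matrix_vector[of D x] assms by simp

text \<open>For a complex eigenvector \<open>x + i y\<close> with eigenvalue \<open>z\<close>, comparing \<open>x \<bullet> D y\<close> with \<open>D x \<bullet> y\<close> forces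
  \<open>Im z (|x|\<^sup>2 + |y|\<^sup>2) = 0\<close>; then \<open>x\<close> and \<open>y\<close> are real eigenvectors unless zero.\<close>

lemma eigenvalues_symmetric:
  assumes sym: "transpose D = D"
  shows "eigenvalues D = complex_of_real ` {c. \<exists>x. x \<noteq> 0 \<and> D *v x = c *\<^sub>R x}"
proof (intro equalityI subsetI)
  fix z assume "z \<in> eigenvalues D"
  then obtain v where v: "v \<noteq> 0" "map_matrix complex_of_real D *v v = z *s v"
    by (auto simp: eigenvalues_def)
  define x y where "x = (\<chi> i. Re (v $ i))" and "y = (\<chi> i. Im (v $ i))"
  have comp: "(\<Sum>j\<in>UNIV. complex_of_real (D $ i $ j) * v $ j) = z * v $ i" for i
    using arg_cong[OF v(2), of "\<lambda>w. w $ i"] by (simp add: matrix_vector_mult_def map_matrix_def)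
  have Dx: "D *v x = Re z *\<^sub>R x - Im z *\<^sub>R y"
    using arg_cong[OF comp, of Re] by (simp add: vec_eq_iff x_def y_def matrix_vector_mult_def)
  have Dy: "D *v y = Re z *\<^sub>R y + Im z *\<^sub>R x"
    using arg_cong[OF comp, of Im] by (simp add: vec_eq_iff x_def y_def matrix_vector_mult_def algebra_simps)
  have nz: "x \<noteq> 0 \<or> y \<noteq> 0"
    using v(1) by (auto simp: vec_eq_iff x_def y_def complex_eq_iff)
  have "Im z * (x \<bullet> x + y \<bullet> y) = 0"
    using symmetric_inner_commute[OF sym, of x y]
    by (simp add: Dx Dy inner_right_distrib inner_left_distrib inner_diff_left inner_diff_right algebra_simps inner_commute)
  moreover have "x \<bullet> x + y \<bullet> y \<noteq> 0"
    using nz by (metis add_nonneg_eq_0_iff inner_eq_zero_iff inner_ge_zero)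
  ultimately have "Im z = 0" by simp
  then have "D *v x = Re z *\<^sub>R x" "D *v y = Re z *\<^sub>R y" and "z = complex_of_real (Re z)"
    using Dx Dy by (simp_all add: complex_eq_iff)
  with nz show "z \<in> complex_of_real ` {c. \<exists>x. x \<noteq> 0 \<and> D *v x = c *\<^sub>R x}"
    by blast
next
  fix z assume "z \<in> complex_of_real ` {c. \<exists>x. x \<noteq> 0 \<and> D *v x = c *\<^sub>R x}"
  then obtain c x where z: "z = complex_of_real c" "x \<noteq> 0" "D *v x = c *\<^sub>R x" by auto
  let ?v = "\<chi> i. complex_of_real (x $ i)"
  have "(\<Sum>j\<in>UNIV. D $ i $ j * x $ j) = c * x $ i" for i
    using arg_cong[OF z(3), of "\<lambda>w. w $ i"] by (simp add: matrix_vector_mult_def)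
  from arg_cong[OF this, of complex_of_real] have "map_matrix complex_of_real D *v ?v = z *s ?v"
    by (simp add: vec_eq_iff matrix_vector_mult_def map_matrix_def z(1))
  moreover have "?v \<noteq> 0" using z(2) by (simp add: vec_eq_iff)
  ultimately show "z \<in> eigenvalues D" unfolding eigenvalues_def by blast
qed

text \<open>Eigenvectors for distinct eigenvalues are orthogonal, hence independent. Finiteness is what gives
  \<^const>\<open>Min\<close> and \<^const>\<open>Max\<close> in the definitions of \<^const>\<open>eig_min\<close> and \<^const>\<open>eig_max\<close> their meaning.\<close>

lemma finite_eigenvalues_symmetric:
  assumes sym: "transpose D = D"
  shows "finite (eigenvalues D)"
proof -
  let ?R = "{c. \<exists>x. x \<noteq> 0 \<and> D *v x = c *\<^sub>R x}"
  obtain e where e: "\<And>c. c \<in> ?R \<Longrightarrow> e c \<noteq> 0 \<and> D *v e c = c *\<^sub>R e c"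
    using bchoice[of ?R "\<lambda>c x. x \<noteq> 0 \<and> D *v x = c *\<^sub>R x"] by blast
  have orth: "e c \<bullet> e d = 0" if "c \<in> ?R" "d \<in> ?R" "c \<noteq> d" for c d
  proof -
    have "d * (e c \<bullet> e d) = c * (e c \<bullet> e d)"
      using symmetric_inner_commute[OF sym, of "e c" "e d"] e that by simp
    with that show ?thesis by simp
  qed
  have inj: "inj_on e ?R"
    using e orth by (metis (no_types, lifting) inj_onI inner_eq_zero_iff)
  have "pairwise orthogonal (e ` ?R)"
    unfolding pairwise_def orthogonal_def using orth by blast
  moreover have "0 \<notin> e ` ?R" using e by force
  ultimately have "independent (e ` ?R)" by (rule pairwise_orthogonal_independent)
  then have "finite (e ` ?R)" by (rule independent_imp_finite)
  then have "finite ?R" using inj by (rule finite_imageD)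
  then show ?thesis by (simp add: eigenvalues_symmetric[OF sym])
qed

text \<open>A maximiser of the quadratic form on the unit sphere is an eigenvector: otherwise the form
  would increase to first order in the direction \<open>D x - \<mu> x\<close>.\<close>

lemma symmetric_max_eigenvector:
  fixes D :: "real^'m^'m"
  assumes sym: "transpose D = D"
  shows "\<exists>\<mu> x. x \<noteq> 0 \<and> D *v x = \<mu> *\<^sub>R x \<and> (\<forall>y. y \<bullet> (D *v y) \<le> \<mu> * (norm y)\<^sup>2)"
proof -
  let ?f = "\<lambda>x. x \<bullet> (D *v x)"
  have "continuous_on (sphere 0 1) ?f"
    unfolding matrix_vector_mult_def by (intro continuous_intros)
  moreover have "sphere (0::real^'m) 1 \<noteq> {}" by simp
  ultimately obtain x where x: "norm x = 1" "\<And>y. norm y = 1 \<Longrightarrow> ?f y \<le> ?f x"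
    using continuous_attains_sup[of "sphere (0::real^'m) 1" ?f] by auto
  define \<mu> where "\<mu> = ?f x"
  have max: "?f y \<le> \<mu> * (norm y)\<^sup>2" for y
  proof (cases "y = 0")
    case False
    have "?f (y /\<^sub>R norm y) \<le> \<mu>" using x(2)[of "y /\<^sub>R norm y"] False by (simp add: \<mu>_def)
    then show ?thesis
      using False by (simp add: matrix_vector_mult_scaleR power2_eq_square field_simps)
  qed simp
  define h where "h = \<mu> *\<^sub>R x - D *v x"
  define q where "q = \<mu> * (norm h)\<^sup>2 - ?f h"
  have q: "q \<ge> 0" using max[of h] by (simp add: q_def)
  \<comment> \<open>With \<open>q\<close> in place of \<open>q + 1\<close> this would minimise \<open>2 t |h|\<^sup>2 + t\<^sup>2 q\<close>; but \<open>q\<close> may vanish.\<close>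
  define t where "t = - ((norm h)\<^sup>2 / (q + 1))"
  have "0 \<le> \<mu> * (norm (x + t *\<^sub>R h))\<^sup>2 - ?f (x + t *\<^sub>R h)"
    using max[of "x + t *\<^sub>R h"] by simp
  also have "\<dots> = \<mu> * (norm x)\<^sup>2 - ?f x + 2 * t * (h \<bullet> (\<mu> *\<^sub>R x - D *v x)) + t\<^sup>2 * q"
    using symmetric_inner_commute[OF sym, of x h]
    unfolding q_def power2_norm_eq_inner
    by (simp add: inner_right_distrib inner_left_distrib
        inner_diff_right inner_diff_left matrix_vector_right_distrib matrix_vector_mult_scaleR
        power2_eq_square algebra_simps inner_commute)
  also have "\<dots> = 2 * t * (norm h)\<^sup>2 + t\<^sup>2 * q"
    unfolding h_def[symmetric] power2_norm_eq_inner[of h] using x(1) by (simp add: \<mu>_def)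
  also have "\<dots> = - ((norm h)\<^sup>2 / (q + 1))\<^sup>2 * (q + 2)"
    unfolding t_def using q by (simp add: power2_eq_square divide_simps) (simp add: algebra_simps)
  finally have "((norm h)\<^sup>2 / (q + 1))\<^sup>2 * (q + 2) \<le> 0" by simp
  then have "((norm h)\<^sup>2 / (q + 1))\<^sup>2 = 0"
    using q by (simp add: mult_le_0_iff)
  then have "h = 0" using q by auto
  then show ?thesis
    using x(1) max by (intro exI[of _ \<mu>] exI[of _ x]) (auto simp: h_def)
qed

lemma symmetric_form_le_eig_max:
  assumes sym: "transpose D = D"
  shows "x \<bullet> (D *v x) \<le> eig_max D * (norm x)\<^sup>2"
proof -
  obtain \<mu> y where \<mu>: "y \<noteq> 0" "D *v y = \<mu> *\<^sub>R y" "\<And>y. y \<bullet> (D *v y) \<le> \<mu> * (norm y)\<^sup>2"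
    using symmetric_max_eigenvector[OF sym] by blast
  have "complex_of_real \<mu> \<in> eigenvalues D"
    unfolding eigenvalues_symmetric[OF sym] using \<mu> by blast
  then have "\<mu> \<in> Re ` eigenvalues D" by force
  then have "\<mu> \<le> eig_max D"
    unfolding eig_max_def using finite_eigenvalues_symmetric[OF sym] by (intro Max_ge) auto
  then have "\<mu> * (norm x)\<^sup>2 \<le> eig_max D * (norm x)\<^sup>2" by (rule mult_right_mono) simp
  then show ?thesis using \<mu>(3)[of x] by simp
qed

lemma symmetric_form_ge_eig_min:
  assumes sym: "transpose D = D"
  shows "eig_min D * (norm x)\<^sup>2 \<le> x \<bullet> (D *v x)"
proof -
  have minus: "(- D) *v y = - (D *v y)" for y
    by (simp add: matrix_vector_mult_def vec_eq_iff sum_negf)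
  have "transpose (- D) = - D" using sym by (simp add: transpose_def vec_eq_iff)
  then obtain \<mu> y where \<mu>: "y \<noteq> 0" "(- D) *v y = \<mu> *\<^sub>R y" "\<And>y. y \<bullet> ((- D) *v y) \<le> \<mu> * (norm y)\<^sup>2"
    using symmetric_max_eigenvector by blast
  from \<mu>(2) have "D *v y = (- \<mu>) *\<^sub>R y"
    unfolding minus by (metis minus_minus scaleR_minus_left)
  then have "complex_of_real (- \<mu>) \<in> eigenvalues D"
    unfolding eigenvalues_symmetric[OF sym] using \<mu> by blast
  then have "- \<mu> \<in> Re ` eigenvalues D" by force
  then have "eig_min D \<le> - \<mu>"
    unfolding eig_min_def using finite_eigenvalues_symmetric[OF sym] by (intro Min_le) auto
  then have "eig_min D * (norm x)\<^sup>2 \<le> (- \<mu>) * (norm x)\<^sup>2" by (rule mult_right_mono) simp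
  then show ?thesis using \<mu>(3)[of x] by (simp add: minus)
qed

lemma eig_min_le_eig_max: "transpose D = D \<Longrightarrow> eig_min D \<le> eig_max D"
  using symmetric_form_ge_eig_min[of D "axis undefined 1"] symmetric_form_le_eig_max[of D "axis undefined 1"]
  by simp

section \<open>The exponents of the operator-stable laws\<close>

text \<open>Equivalently, \<open>D\<close> is symmetric with spectrum in \<open>[l, c]\<close>; the estimates use the quadratic form only.\<close>

definition form_between :: "real \<Rightarrow> real \<Rightarrow> real^'m^'m \<Rightarrow> bool" where
  "form_between l c D \<longleftrightarrow> transpose D = D \<and>
     (\<forall>x. l * (norm x)\<^sup>2 \<le> x \<bullet> (D *v x) \<and> x \<bullet> (D *v x) \<le> c * (norm x)\<^sup>2)"

text \<open>The density of \<open>1 - cos (x \<bullet> v)\<close> in polar coordinates \<open>x = r\<^sup>D \<theta>\<close>, with respect to \<open>dr \<sigma>(d\<theta>)\<close>.\<close>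

definition levy_kernel :: "real^'m^'m \<Rightarrow> real^'m \<Rightarrow> real \<times> (real^'m) \<Rightarrow> real" where
  "levy_kernel D v = (\<lambda>(r, \<theta>). indicator {0<..} r * (1 - cos ((mat_powr r D *v \<theta>) \<bullet> v)) / r\<^sup>2)"

lemma levy_kernel_nonneg: "0 \<le> levy_kernel D v x"
  by (auto simp: levy_kernel_def split: prod.split)

lemma spectral_measure_sets: "spectral_measure \<sigma> \<Longrightarrow> sets \<sigma> = sets (restrict_space borel (sphere 0 1))"
  by (simp add: spectral_measure_def)

lemma spectral_measure_space: "spectral_measure \<sigma> \<Longrightarrow> space \<sigma> = sphere 0 1"
  using sets_eq_imp_space_eq[OF spectral_measure_sets] by (simp add: space_restrict_space)

lemma spectral_measure_id_measurable: "spectral_measure \<sigma> \<Longrightarrow> (\<lambda>x. x) \<in> measurable \<sigma> borel"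
  using spectral_measure_sets[of \<sigma>]
  by (subst measurable_cong_sets[OF spectral_measure_sets refl]) (auto intro: measurable_restrict_space1)

lemma borel_measurable_mat_exp [measurable]: "mat_exp \<in> borel_measurable borel"
proof (rule borel_measurable_continuous_onI)
  show "continuous_on UNIV mat_exp"
    unfolding continuous_on_def by (auto intro!: tendsto_mat_exp tendsto_intros)
qed

lemma borel_measurable_matrix_vector_mult [measurable (raw)]:
  fixes f :: "'a \<Rightarrow> real^'n^'m"
  assumes "f \<in> borel_measurable M" "g \<in> borel_measurable M"
  shows "(\<lambda>x. f x *v g x) \<in> borel_measurable M"
proof -
  have "continuous_on UNIV (\<lambda>x::(real^'n^'m) \<times> (real^'n). fst x *v snd x)"
    unfolding matrix_vector_mult_def by (intro continuous_intros)
  from borel_measurable_continuous_Pair[OF assms this] show ?thesis by simp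
qed

lemma borel_measurable_levy_kernel:
  assumes \<sigma>: "spectral_measure \<sigma>"
    and [measurable]: "E \<in> borel_measurable M" "z \<in> borel_measurable M"
  shows "(\<lambda>(x, y). levy_kernel (E x) (z x) y) \<in> borel_measurable (M \<Otimes>\<^sub>M (lborel \<Otimes>\<^sub>M \<sigma>))"
proof -
  note [measurable] = spectral_measure_id_measurable[OF \<sigma>]
  have [measurable]: "(\<lambda>x. snd (snd x)) \<in> borel_measurable (M \<Otimes>\<^sub>M (lborel \<Otimes>\<^sub>M \<sigma>))"
    by (rule measurable_compose[OF _ spectral_measure_id_measurable[OF \<sigma>]]) measurable
  show ?thesis
    unfolding levy_kernel_def mat_powr_def case_prod_beta by measurable
qed

lemma borel_measurable_levy_kernel1:
  assumes \<sigma>: "spectral_measure \<sigma>"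
  shows "levy_kernel D v \<in> borel_measurable (lborel \<Otimes>\<^sub>M \<sigma>)"
  using measurable_Pair2[OF borel_measurable_levy_kernel[OF \<sigma>, of "\<lambda>_. D" "count_space UNIV" "\<lambda>_. v"], of undefined]
  by simp

text \<open>The Levy measure is the image of \<open>r\<^sup>-\<^sup>2 dr \<sigma>(d\<theta>)\<close> under the polar map
  \<open>(r, \<theta>) \<mapsto> r\<^sup>D \<theta>\<close>, so the exponent is an integral over a space that does not depend on \<open>D\<close>.\<close>

lemma psi_eq_kernel:
  assumes \<sigma>: "spectral_measure \<sigma>"
  shows "psi \<sigma> D v = - (\<integral>x. levy_kernel D v x \<partial>(lborel \<Otimes>\<^sub>M \<sigma>))"
proof -
  interpret finite_measure \<sigma> using \<sigma> by (simp add: spectral_measure_def)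
  have [measurable]: "(\<lambda>x. mat_powr (fst x) D *v snd x) \<in> borel_measurable (lborel \<Otimes>\<^sub>M \<sigma>)"
    using borel_measurable_mat_powr_mult[OF spectral_measure_sets[OF \<sigma>], of D] by (simp add: case_prod_beta)
  let ?N = "density (lborel \<Otimes>\<^sub>M \<sigma>) (\<lambda>x. ennreal (indicator {0<..} (fst x) * inverse ((fst x)\<^sup>2)))"
  have phi: "phi_measure \<sigma> D = distr ?N borel (\<lambda>x. mat_powr (fst x) D *v snd x)"
  proof (rule measure_eqI)
    show sets: "sets (phi_measure \<sigma> D) = sets (distr ?N borel (\<lambda>x. mat_powr (fst x) D *v snd x))"
      using sets.sigma_sets_eq[of borel] by (simp add: phi_measure_def)
    fix C assume "C \<in> sets (phi_measure \<sigma> D)"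
    then have [measurable]: "C \<in> sets borel" by (simp add: sets)
    have "emeasure (distr ?N borel (\<lambda>x. mat_powr (fst x) D *v snd x)) C =
      (\<integral>\<^sup>+x. ennreal (indicator {0<..} (fst x) * inverse ((fst x)\<^sup>2)) *
         indicator C (mat_powr (fst x) D *v snd x) \<partial>(lborel \<Otimes>\<^sub>M \<sigma>))"
      by (subst emeasure_distr) (auto simp: emeasure_density space_pair_measure intro!: nn_integral_cong split: split_indicator)
    also have "\<dots> = (\<integral>\<^sup>+r. \<integral>\<^sup>+\<theta>. ennreal (indicator {0<..} r * inverse (r\<^sup>2)) *
         indicator C (mat_powr r D *v \<theta>) \<partial>\<sigma> \<partial>lborel)"
      by (subst nn_integral_fst[symmetric]) auto
    also have "\<dots> = emeasure (phi_measure \<sigma> D) C"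
      unfolding emeasure_phi_measure[OF \<sigma> \<open>C \<in> sets borel\<close>]
      by (intro nn_integral_cong) (auto split: split_indicator simp: mult.commute)
    finally show "emeasure (phi_measure \<sigma> D) C = emeasure (distr ?N borel (\<lambda>x. mat_powr (fst x) D *v snd x)) C"
      by simp
  qed
  have "psi \<sigma> D v = (\<integral>x. (indicator {0<..} (fst x) * inverse ((fst x)\<^sup>2)) *
      (cos ((mat_powr (fst x) D *v snd x) \<bullet> v) - 1) \<partial>(lborel \<Otimes>\<^sub>M \<sigma>))"
    unfolding psi_def phi by (simp add: integral_distr integral_density)
  also have "\<dots> = (\<integral>x. - levy_kernel D v x \<partial>(lborel \<Otimes>\<^sub>M \<sigma>))"
    by (intro Bochner_Integration.integral_cong) (auto simp: levy_kernel_def field_simps split: split_indicator)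
  finally show ?thesis by simp
qed

lemma psi_nonpos: "spectral_measure \<sigma> \<Longrightarrow> psi \<sigma> D v \<le> 0"
  by (simp add: psi_eq_kernel levy_kernel_nonneg)

lemma psi_0 [simp]: "psi \<sigma> D 0 = 0"
  by (simp add: psi_def)

lemma borel_measurable_psi:
  assumes \<sigma>: "spectral_measure \<sigma>"
    and "E \<in> borel_measurable M" "z \<in> borel_measurable M"
  shows "(\<lambda>x. psi \<sigma> (E x) (z x)) \<in> borel_measurable M"
proof -
  interpret finite_measure \<sigma> using \<sigma> by (simp add: spectral_measure_def)
  interpret pair_sigma_finite lborel \<sigma> ..
  have "(\<lambda>x. \<integral>y. levy_kernel (E x) (z x) y \<partial>(lborel \<Otimes>\<^sub>M \<sigma>)) \<in> borel_measurable M"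
    by (rule borel_measurable_lebesgue_integral) (rule borel_measurable_levy_kernel[OF assms])
  then show ?thesis by (simp add: psi_eq_kernel[OF \<sigma>])
qed

text \<open>The substitution \<open>r \<mapsto> t r\<close> in the polar representation produces a factor \<open>t\<close>,
  which is the operator stability of the law with exponent \<open>psi \<sigma> D\<close>.\<close>

lemma psi_mat_powr:
  assumes \<sigma>: "spectral_measure \<sigma>" and sym: "transpose D = D" and t: "0 < t"
  shows "psi \<sigma> D (mat_powr t D *v v) = t * psi \<sigma> D v"
proof -
  interpret finite_measure \<sigma> using \<sigma> by (simp add: spectral_measure_def)
  note [measurable] = borel_measurable_levy_kernel1[OF \<sigma>]
  have psi: "psi \<sigma> D w = - enn2real (\<integral>\<^sup>+r. \<integral>\<^sup>+\<theta>. ennreal (levy_kernel D w (r, \<theta>)) \<partial>\<sigma> \<partial>lborel)" for w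
    unfolding psi_eq_kernel[OF \<sigma>]
    by (subst integral_eq_nn_integral, simp, simp add: levy_kernel_nonneg)
      (subst nn_integral_fst[symmetric], simp_all)
  have ker: "levy_kernel D (mat_powr t D *v v) (r, \<theta>) = t\<^sup>2 * levy_kernel D v (t * r, \<theta>)" for r \<theta>
  proof (cases "0 < r")
    case True
    have "(mat_powr r D *v \<theta>) \<bullet> (mat_powr t D *v v) = (mat_powr t D *v (mat_powr r D *v \<theta>)) \<bullet> v"
      by (rule symmetric_inner_commute) (simp add: transpose_mat_powr sym)
    also have "\<dots> = (mat_powr (t * r) D *v \<theta>) \<bullet> v"
      using True t by (simp add: mat_powr_mult matrix_vector_mul_assoc)
    finally show ?thesis using True t by (simp add: levy_kernel_def field_simps)
  next
    case False
    then show ?thesis using t by (simp add: levy_kernel_def zero_less_mult_iff)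
  qed
  let ?G = "\<lambda>r. \<integral>\<^sup>+\<theta>. ennreal (levy_kernel D v (r, \<theta>)) \<partial>\<sigma>"
  have [measurable]: "?G \<in> borel_measurable lborel" by measurable
  have "(\<integral>\<^sup>+r. \<integral>\<^sup>+\<theta>. ennreal (levy_kernel D (mat_powr t D *v v) (r, \<theta>)) \<partial>\<sigma> \<partial>lborel)
      = (\<integral>\<^sup>+r. ennreal (t\<^sup>2) * ?G (t * r) \<partial>lborel)"
  proof (intro nn_integral_cong)
    fix r :: real
    have "(\<lambda>\<theta>. levy_kernel D v (t * r, \<theta>)) \<in> borel_measurable \<sigma>"
      by (rule measurable_Pair2[OF borel_measurable_levy_kernel1[OF \<sigma>]]) simp
    then show "(\<integral>\<^sup>+\<theta>. ennreal (levy_kernel D (mat_powr t D *v v) (r, \<theta>)) \<partial>\<sigma>) = ennreal (t\<^sup>2) * ?G (t * r)"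
      unfolding ker by (subst nn_integral_cmult[symmetric]) (auto simp: ennreal_mult levy_kernel_nonneg)
  qed
  also have "\<dots> = ennreal t * (ennreal \<bar>t\<bar> * (\<integral>\<^sup>+r. ?G (0 + t * r) \<partial>lborel))"
    using t by (simp add: nn_integral_cmult power2_eq_square ennreal_mult mult.assoc)
  also have "\<dots> = ennreal t * (\<integral>\<^sup>+r. ?G r \<partial>lborel)"
    by (subst nn_integral_real_affine[of ?G t 0]) (use t in auto)
  finally show ?thesis
    using t by (simp add: psi enn2real_mult)
qed

text \<open>A bound for \<^const>\<open>levy_kernel\<close> when \<open>|r\<^sup>D|\<close> is at most \<open>r\<^sup>p\<close> and \<open>w = |v|\<close>: the square controls small
  \<open>r\<close>, the constant \<open>2\<close> large \<open>r\<close>.\<close>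

definition radial_bound :: "real \<Rightarrow> real \<Rightarrow> real \<Rightarrow> real" where
  "radial_bound p w r = indicator {0<..} r * min 2 (w\<^sup>2 * r powr (2 * p)) / r\<^sup>2"

lemma borel_measurable_radial_bound [measurable]: "radial_bound p w \<in> borel_measurable borel"
  unfolding radial_bound_def by measurable

lemma radial_bound_nonneg: "0 \<le> radial_bound p w r"
  by (simp add: radial_bound_def)

lemma radial_bound_mono:
  assumes "0 \<le> w" "w \<le> w'"
  shows "radial_bound p w r \<le> radial_bound p w' r"
  unfolding radial_bound_def using power_mono[OF assms(2,1), of 2]
  by (intro divide_right_mono mult_left_mono min.mono mult_right_mono) auto

text \<open>The integral is split at \<open>\<rho> = w\<^bsup>-1/p\<^esup>\<close>, where the two bounds balance. The condition \<open>p > 1/2\<close>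
  makes \<open>r\<^bsup>2p-2\<^esup>\<close> integrable at \<open>0\<close>.\<close>

lemma nn_integral_radial_bound:
  assumes p: "1 / 2 < p" and w: "0 \<le> w"
  shows "(\<integral>\<^sup>+r. ennreal (radial_bound p w r) \<partial>lborel) \<le> ennreal ((1 / (2 * p - 1) + 2) * w powr (1 / p))"
proof (cases "w = 0")
  case True
  then show ?thesis by (simp add: radial_bound_def)
next
  case False
  with w have w: "0 < w" by simp
  define \<rho> where "\<rho> = w powr (- 1 / p)"
  have \<rho>: "0 < \<rho>" using w by (simp add: \<rho>_def)
  have 1: "((\<lambda>r. w\<^sup>2 * r powr (2 * p - 2)) has_integral w\<^sup>2 * (\<rho> powr (2 * p - 2 + 1) / (2 * p - 2 + 1))) {0..\<rho>}"
    using p \<rho> by (intro has_integral_mult_right has_integral_powr_from_0) auto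
  have 2: "((\<lambda>r. 2 * r powr - 2) has_integral 2 * (- (\<rho> powr (-2 + 1)) / (-2 + 1))) {\<rho>..}"
    using \<rho> by (intro has_integral_mult_right has_integral_powr_to_inf) auto
  have le: "radial_bound p w r \<le> indicator {0..\<rho>} r * (w\<^sup>2 * r powr (2 * p - 2)) + indicator {\<rho>..} r * (2 * r powr - 2)" for r
  proof (cases "0 < r")
    case True
    have eq: "r powr (2 * p) / r\<^sup>2 = r powr (2 * p - 2)" "1 / r\<^sup>2 = r powr - 2"
      using True by (simp_all add: powr_diff powr_minus powr_numeral field_simps)
    have "min 2 (w\<^sup>2 * r powr (2 * p)) / r\<^sup>2 \<le> w\<^sup>2 * (r powr (2 * p) / r\<^sup>2)"
        "min 2 (w\<^sup>2 * r powr (2 * p)) / r\<^sup>2 \<le> 2 * (1 / r\<^sup>2)"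
      by (simp_all add: divide_right_mono)
    then have "min 2 (w\<^sup>2 * r powr (2 * p)) / r\<^sup>2 \<le> w\<^sup>2 * r powr (2 * p - 2)"
        "min 2 (w\<^sup>2 * r powr (2 * p)) / r\<^sup>2 \<le> 2 * r powr - 2"
      unfolding eq .
    moreover have "0 \<le> w\<^sup>2 * r powr (2 * p - 2)" "0 \<le> 2 * r powr - 2" by auto
    moreover have "x \<le> indicator {0..\<rho>} r * A + indicator {\<rho>..} r * B"
      if "x \<le> A" "x \<le> B" "0 \<le> A" "0 \<le> B" for x A B :: real
      using that True by (cases "r \<le> \<rho>") (auto split: split_indicator)
    ultimately show ?thesis using True by (simp add: radial_bound_def)
  next
    case False
    then show ?thesis by (simp add: radial_bound_def)
  qed
  have "(\<integral>\<^sup>+r. ennreal (radial_bound p w r) \<partial>lborel) \<le>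
    (\<integral>\<^sup>+r. ennreal (indicator {0..\<rho>} r * (w\<^sup>2 * r powr (2 * p - 2))) + ennreal (indicator {\<rho>..} r * (2 * r powr - 2)) \<partial>lborel)"
    using ennreal_leI[OF le] by (intro nn_integral_mono) (simp add: ennreal_plus)
  also have "\<dots> = (\<integral>\<^sup>+r. ennreal (indicator {0..\<rho>} r * (w\<^sup>2 * r powr (2 * p - 2))) \<partial>lborel) +
     (\<integral>\<^sup>+r. ennreal (indicator {\<rho>..} r * (2 * r powr - 2)) \<partial>lborel)"
    by (intro nn_integral_add) auto
  also have "\<dots> = ennreal (w\<^sup>2 * (\<rho> powr (2 * p - 2 + 1) / (2 * p - 2 + 1))) + ennreal (2 * (- (\<rho> powr (-2 + 1)) / (-2 + 1)))"
    by (intro arg_cong2[where f="(+)"] nn_integral_has_integral_lebesgue 1 2) auto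
  also have "\<dots> = ennreal (w\<^sup>2 * \<rho> powr (2 * p - 1) / (2 * p - 1) + 2 * \<rho> powr - 1)"
    using p by (subst ennreal_plus[symmetric]) auto
  also have "\<rho> powr - 1 = w powr (1 / p)"
    by (simp only: \<rho>_def powr_powr) simp
  also have "w\<^sup>2 * \<rho> powr (2 * p - 1) = w powr (2 + (- 1 / p) * (2 * p - 1))"
    using w by (simp only: \<rho>_def powr_powr powr_add) simp
  also have "2 + (- 1 / p) * (2 * p - 1) = 1 / p"
    using p by (simp add: field_simps)
  finally show ?thesis by (simp add: algebra_simps)
qed

lemma one_minus_cos_le: "1 - cos x \<le> x\<^sup>2 / 2" for x :: real
proof -
  have "1 - cos x = 2 * (sin (x / 2))\<^sup>2"
    using cos_double_sin[of "x / 2"] by simp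
  also have "(sin (x / 2))\<^sup>2 \<le> (x / 2)\<^sup>2"
    using abs_sin_x_le_abs_x[of "x / 2"] by (metis abs_le_square_iff)
  finally show ?thesis by (simp add: power2_eq_square)
qed

lemma levy_kernel_le:
  assumes D: "form_between l c D" and \<theta>: "norm \<theta> = 1"
  shows "levy_kernel D v (r, \<theta>) \<le> radial_bound l (norm v) r + radial_bound c (norm v) r"
proof (cases "0 < r")
  case True
  let ?x = "(mat_powr r D *v \<theta>) \<bullet> v" let ?w = "norm v"
  have "norm (mat_powr r D *v \<theta>) \<le> r powr l + r powr c"
    using norm_mat_powr_le[of l D c r \<theta>] D \<theta> True by (simp add: form_between_def)
  then have "\<bar>?x\<bar> \<le> (r powr l + r powr c) * ?w"
    using Cauchy_Schwarz_ineq2[of "mat_powr r D *v \<theta>" v] mult_right_mono[of _ _ ?w] by fastforce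
  then have "?x\<^sup>2 \<le> ((r powr l + r powr c) * ?w)\<^sup>2"
    by (metis abs_ge_zero power2_abs power_mono)
  also have "\<dots> = ?w\<^sup>2 * (r powr l + r powr c)\<^sup>2" by (simp add: power_mult_distrib)
  also have "\<dots> \<le> ?w\<^sup>2 * (2 * (r powr (2 * l) + r powr (2 * c)))"
  proof (rule mult_left_mono)
    have "(r powr l + r powr c)\<^sup>2 \<le> 2 * ((r powr l)\<^sup>2 + (r powr c)\<^sup>2)"
      using zero_le_power2[of "r powr l - r powr c"] by (simp add: power2_eq_square algebra_simps)
    also have "\<dots> = 2 * (r powr (2 * l) + r powr (2 * c))"
      by (simp add: power2_eq_square flip: powr_add)
    finally show "(r powr l + r powr c)\<^sup>2 \<le> 2 * (r powr (2 * l) + r powr (2 * c))" .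
  qed simp
  finally have "1 - cos ?x \<le> ?w\<^sup>2 * r powr (2 * l) + ?w\<^sup>2 * r powr (2 * c)"
    using one_minus_cos_le[of ?x] by (simp add: algebra_simps)
  moreover have "1 - cos ?x \<le> 2" using cos_ge_minus_one[of ?x] by simp
  moreover have "0 \<le> ?w\<^sup>2 * r powr (2 * l)" "0 \<le> ?w\<^sup>2 * r powr (2 * c)" by auto
  moreover have "t \<le> min 2 A + min 2 B" if "t \<le> A + B" "t \<le> 2" "0 \<le> A" "0 \<le> B" for t A B :: real
    using that by (auto simp: min_def)
  ultimately have "1 - cos ?x \<le> min 2 (?w\<^sup>2 * r powr (2 * l)) + min 2 (?w\<^sup>2 * r powr (2 * c))"
    by blast
  then show ?thesis
    using True by (simp add: levy_kernel_def radial_bound_def divide_right_mono flip: add_divide_distrib)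
next
  case False
  then show ?thesis by (simp add: levy_kernel_def radial_bound_nonneg)
qed

lemma integrable_radial_bound:
  assumes \<sigma>: "spectral_measure \<sigma>" and p: "1 / 2 < p" and w: "0 \<le> w"
  shows "integrable (lborel \<Otimes>\<^sub>M \<sigma>) (\<lambda>x. radial_bound p w (fst x))"
    and "(\<integral>x. radial_bound p w (fst x) \<partial>(lborel \<Otimes>\<^sub>M \<sigma>)) \<le> measure \<sigma> (space \<sigma>) * (1 / (2 * p - 1) + 2) * w powr (1 / p)"
proof -
  interpret finite_measure \<sigma> using \<sigma> by (simp add: spectral_measure_def)
  have "(\<integral>\<^sup>+x. ennreal (radial_bound p w (fst x)) \<partial>(lborel \<Otimes>\<^sub>M \<sigma>)) =
      (\<integral>\<^sup>+r. ennreal (radial_bound p w r) \<partial>lborel) * emeasure \<sigma> (space \<sigma>)"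
    by (subst nn_integral_fst[symmetric]) (auto simp: nn_integral_multc)
  also have "\<dots> \<le> ennreal ((1 / (2 * p - 1) + 2) * w powr (1 / p)) * emeasure \<sigma> (space \<sigma>)"
    by (intro mult_right_mono nn_integral_radial_bound p w) simp
  also have "\<dots> = ennreal (measure \<sigma> (space \<sigma>) * (1 / (2 * p - 1) + 2) * w powr (1 / p))"
    using p by (simp add: emeasure_eq_measure mult_ac flip: ennreal_mult)
  finally have le: "(\<integral>\<^sup>+x. ennreal (radial_bound p w (fst x)) \<partial>(lborel \<Otimes>\<^sub>M \<sigma>)) \<le>
    ennreal (measure \<sigma> (space \<sigma>) * (1 / (2 * p - 1) + 2) * w powr (1 / p))" .
  then have "(\<integral>\<^sup>+x. ennreal (radial_bound p w (fst x)) \<partial>(lborel \<Otimes>\<^sub>M \<sigma>)) < \<infinity>"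
    by (rule le_less_trans) simp
  then show "integrable (lborel \<Otimes>\<^sub>M \<sigma>) (\<lambda>x. radial_bound p w (fst x))"
    by (intro integrableI_bounded) (auto simp: radial_bound_nonneg)
  show "(\<integral>x. radial_bound p w (fst x) \<partial>(lborel \<Otimes>\<^sub>M \<sigma>)) \<le> measure \<sigma> (space \<sigma>) * (1 / (2 * p - 1) + 2) * w powr (1 / p)"
    using le p by (subst integral_eq_nn_integral) (auto simp: radial_bound_nonneg intro!: enn2real_leI)
qed

text \<open>The total mass of \<open>\<sigma>\<close> times the constants of the two radial integrals.\<close>

definition psi_const :: "(real^'m) measure \<Rightarrow> real \<Rightarrow> real \<Rightarrow> real" where
  "psi_const \<sigma> l c = measure \<sigma> (space \<sigma>) * (1 / (2 * l - 1) + 2 + (1 / (2 * c - 1) + 2))"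

text \<open>The powers \<open>1/l\<close> and \<open>1/c\<close> come from the two radial bounds. They turn into the indices \<open>b\<close> and \<open>a\<close> of
  the class of integrands.\<close>

lemma psi_bound:
  assumes \<sigma>: "spectral_measure \<sigma>" and D: "form_between l c D" and l: "1 / 2 < l" "1 / 2 < c"
  shows "- psi \<sigma> D v \<le> psi_const \<sigma> l c * (norm v powr (1 / l) + norm v powr (1 / c))"
proof -
  let ?N = "lborel \<Otimes>\<^sub>M \<sigma>" let ?w = "norm v" let ?s = "measure \<sigma> (space \<sigma>)"
  note int = integrable_radial_bound[OF \<sigma> l(1), of ?w] integrable_radial_bound[OF \<sigma> l(2), of ?w]
  have "- psi \<sigma> D v = (\<integral>x. levy_kernel D v x \<partial>?N)" by (simp add: psi_eq_kernel[OF \<sigma>])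
  also have "\<dots> \<le> (\<integral>x. radial_bound l ?w (fst x) + radial_bound c ?w (fst x) \<partial>?N)"
    using levy_kernel_le[OF D, of _ v] int
    by (intro integral_mono') (auto simp: levy_kernel_nonneg radial_bound_nonneg space_pair_measure spectral_measure_space[OF \<sigma>])
  also have "\<dots> \<le> ?s * (1 / (2 * l - 1) + 2) * ?w powr (1 / l) + ?s * (1 / (2 * c - 1) + 2) * ?w powr (1 / c)"
    using int by (simp add: add_mono)
  also have "\<dots> \<le> psi_const \<sigma> l c * (?w powr (1 / l) + ?w powr (1 / c))"
  proof -
    define p q where "p = 1 / (2 * l - 1) + 2" and "q = 1 / (2 * c - 1) + 2"
    have "0 \<le> p" "0 \<le> q" using l by (simp_all add: p_def q_def)
    then have "0 \<le> ?s * p * ?w powr (1 / c)" "0 \<le> ?s * q * ?w powr (1 / l)" by simp_all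
    then show ?thesis unfolding psi_const_def p_def[symmetric] q_def[symmetric]
      by (simp add: algebra_simps)
  qed
  finally show ?thesis .
qed

lemma psi_const_nonneg: "1 / 2 < l \<Longrightarrow> 1 / 2 < c \<Longrightarrow> 0 \<le> psi_const \<sigma> l c"
  by (simp add: psi_const_def)

text \<open>The radial bounds of the bounded sequence \<open>z\<close> dominate
  uniformly in \<open>n\<close>, because all \<open>E n\<close> have the same form bounds.\<close>

lemma tendsto_psi:
  assumes \<sigma>: "spectral_measure \<sigma>" and E: "\<And>n. form_between l c (E n)" and l: "1 / 2 < l" "1 / 2 < c"
    and lim: "E \<longlonglongrightarrow> D" "z \<longlonglongrightarrow> v"
  shows "(\<lambda>n. psi \<sigma> (E n) (z n)) \<longlonglongrightarrow> psi \<sigma> D v"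
proof -
  obtain K where K: "\<And>n. norm (z n) \<le> K"
    using convergent_imp_Bseq[OF convergentI[OF lim(2)]] unfolding Bseq_def by blast
  have K0: "0 \<le> K" using order_trans[OF norm_ge_zero K] .
  have "(\<lambda>n. \<integral>x. levy_kernel (E n) (z n) x \<partial>(lborel \<Otimes>\<^sub>M \<sigma>)) \<longlonglongrightarrow> (\<integral>x. levy_kernel D v x \<partial>(lborel \<Otimes>\<^sub>M \<sigma>))"
  proof (rule integral_dominated_convergence)
    show "integrable (lborel \<Otimes>\<^sub>M \<sigma>) (\<lambda>x. radial_bound l K (fst x) + radial_bound c K (fst x))"
      by (intro Bochner_Integration.integrable_add integrable_radial_bound \<sigma> l K0)
    show "AE x in lborel \<Otimes>\<^sub>M \<sigma>. (\<lambda>n. levy_kernel (E n) (z n) x) \<longlonglongrightarrow> levy_kernel D v x"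
    proof (intro AE_I2)
      fix x :: "real \<times> (real^'a)"
      have "(\<lambda>n. mat_powr (fst x) (E n)) \<longlonglongrightarrow> mat_powr (fst x) D" by (rule tendsto_mat_powr[OF lim(1)])
      then show "(\<lambda>n. levy_kernel (E n) (z n) x) \<longlonglongrightarrow> levy_kernel D v x"
        unfolding levy_kernel_def case_prod_beta
        by (cases "fst x = 0")
         (auto intro!: tendsto_intros lim matrix_vector_mult.tendsto)
    qed
    show "AE x in lborel \<Otimes>\<^sub>M \<sigma>. norm (levy_kernel (E n) (z n) x) \<le> radial_bound l K (fst x) + radial_bound c K (fst x)" for n
    proof (intro AE_I2)
      fix x :: "real \<times> (real^'a)" assume "x \<in> space (lborel \<Otimes>\<^sub>M \<sigma>)"
      then have "norm (snd x) = 1" by (auto simp: space_pair_measure spectral_measure_space[OF \<sigma>])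
      then have "levy_kernel (E n) (z n) x \<le> radial_bound l (norm (z n)) (fst x) + radial_bound c (norm (z n)) (fst x)"
        using levy_kernel_le[OF E, of "snd x" n "z n" "fst x"] by simp
      also have "\<dots> \<le> radial_bound l K (fst x) + radial_bound c K (fst x)"
        by (intro add_mono radial_bound_mono K norm_ge_zero)
      finally show "norm (levy_kernel (E n) (z n) x) \<le> radial_bound l K (fst x) + radial_bound c K (fst x)"
        by (simp add: levy_kernel_nonneg)
    qed
  qed (use \<sigma> in \<open>auto intro: borel_measurable_levy_kernel1\<close>)
  then show ?thesis
    unfolding psi_eq_kernel[OF \<sigma>] by (rule tendsto_minus)
qed

section \<open>Characteristic functions and convergence in distribution\<close>

inductive trig_poly :: "('b::real_inner \<Rightarrow> real) \<Rightarrow> bool" where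
  cos: "trig_poly (\<lambda>x. c * cos (v \<bullet> x))"
| sin: "trig_poly (\<lambda>x. c * sin (v \<bullet> x))"
| add: "trig_poly f \<Longrightarrow> trig_poly g \<Longrightarrow> trig_poly (\<lambda>x. f x + g x)"

lemma trig_poly_const: "trig_poly (\<lambda>x. c)"
  using trig_poly.cos[of c 0] by simp

text \<open>By the product-to-sum formulas. Closure under products is what allows polynomials to be substituted.\<close>

lemma trig_poly_mult:
  assumes "trig_poly f" "trig_poly g"
  shows "trig_poly (\<lambda>x. f x * g x)"
  using assms
proof (induction f arbitrary: g rule: trig_poly.induct)
  case (cos c v)
  show ?case using \<open>trig_poly g\<close>
  proof (induction g rule: trig_poly.induct)
    case (cos d w)
    have "(c * cos (v \<bullet> x)) * (d * cos (w \<bullet> x)) =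
      (c * d / 2) * cos ((v - w) \<bullet> x) + (c * d / 2) * cos ((v + w) \<bullet> x)" for x
      by (simp add: inner_diff_left inner_add_left cos_add cos_diff algebra_simps)
    then show ?case by (simp only:) (intro trig_poly.intros)
  next
    case (sin d w)
    have "(c * cos (v \<bullet> x)) * (d * sin (w \<bullet> x)) =
      (c * d / 2) * sin ((v + w) \<bullet> x) + (- c * d / 2) * sin ((v - w) \<bullet> x)" for x
      by (simp add: inner_diff_left inner_add_left sin_add sin_diff algebra_simps)
    then show ?case by (simp only:) (intro trig_poly.intros)
  next
    case (add h k)
    then show ?case by (simp only: distrib_left) (rule trig_poly.add)
  qed
next
  case (sin c v)
  show ?case using \<open>trig_poly g\<close>
  proof (induction g rule: trig_poly.induct)
    case (cos d w)
    have "(c * sin (v \<bullet> x)) * (d * cos (w \<bullet> x)) =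
      (c * d / 2) * sin ((v + w) \<bullet> x) + (c * d / 2) * sin ((v - w) \<bullet> x)" for x
      by (simp add: inner_diff_left inner_add_left sin_add sin_diff algebra_simps)
    then show ?case by (simp only:) (intro trig_poly.intros)
  next
    case (sin d w)
    have "(c * sin (v \<bullet> x)) * (d * sin (w \<bullet> x)) =
      (c * d / 2) * cos ((v - w) \<bullet> x) + (- c * d / 2) * cos ((v + w) \<bullet> x)" for x
      by (simp add: inner_diff_left inner_add_left cos_add cos_diff algebra_simps)
    then show ?case by (simp only:) (intro trig_poly.intros)
  next
    case (add h k)
    then show ?case by (simp only: distrib_left) (rule trig_poly.add)
  qed
next
  case (add h k)
  from add.IH(1)[OF add.prems] add.IH(2)[OF add.prems] show ?case
    by (simp only: distrib_right) (rule trig_poly.add)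
qed

lemma trig_poly_continuous: "trig_poly f \<Longrightarrow> continuous_on UNIV f"
  by (induction rule: trig_poly.induct) (auto intro!: continuous_intros)

lemma trig_poly_sum: "finite I \<Longrightarrow> (\<And>i. i \<in> I \<Longrightarrow> trig_poly (f i)) \<Longrightarrow> trig_poly (\<lambda>x. \<Sum>i\<in>I. f i x)"
  by (induction I rule: finite_induct) (auto intro: trig_poly_const trig_poly.add)

lemma trig_poly_bounded: "trig_poly f \<Longrightarrow> \<exists>K. \<forall>x. \<bar>f x\<bar> \<le> K"
proof (induction rule: trig_poly.induct)
  case (cos c v)
  show ?case by (intro exI[of _ "\<bar>c\<bar>"]) (simp add: abs_mult mult_left_le)
next
  case (sin c v)
  show ?case by (intro exI[of _ "\<bar>c\<bar>"]) (simp add: abs_mult mult_left_le)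
next
  case (add f g)
  then obtain K L where "\<forall>x. \<bar>f x\<bar> \<le> K" "\<forall>x. \<bar>g x\<bar> \<le> L" by auto
  have "\<bar>f x + g x\<bar> \<le> K + L" for x
    using \<open>\<forall>x. \<bar>f x\<bar> \<le> K\<close>[rule_format, of x] \<open>\<forall>x. \<bar>g x\<bar> \<le> L\<close>[rule_format, of x] by linarith
  then show ?case by blast
qed

text \<open>The map \<open>x \<mapsto> (sin (x\<^sub>b / L))\<^sub>b\<close> is injective on the cube of half-width \<open>L\<close> and bounded
  everywhere. Polynomials in it are trigonometric polynomials, so they approximate \<open>g\<close> uniformly on
  the cube by the theorem of Stone and Weierstrass, and stay bounded outside the cube by
  (almost) the same constant as \<open>g\<close>.\<close>

lemma trig_poly_approx:
  fixes g :: "'b::euclidean_space \<Rightarrow> real"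
  assumes g: "continuous_on UNIV g" "\<And>x. \<bar>g x\<bar> \<le> K" and "0 < L" "0 < e"
  obtains p where "trig_poly p" "\<And>x. \<bar>p x\<bar> \<le> K + e"
    "\<And>x. (\<And>b. b \<in> Basis \<Longrightarrow> \<bar>x \<bullet> b\<bar> \<le> L) \<Longrightarrow> \<bar>g x - p x\<bar> \<le> e"
proof -
  define S where "S = cbox (- One) (One :: 'b)"
  define A where "A y = (\<Sum>b\<in>Basis. (L * arcsin (y \<bullet> b)) *\<^sub>R b)" for y :: 'b
  define \<Phi> where "\<Phi> x = (\<Sum>b\<in>Basis. sin ((x \<bullet> b) / L) *\<^sub>R b)" for x :: 'b
  have "continuous_on S A"
    unfolding A_def S_def by (intro continuous_intros) (auto simp: mem_box)
  then have "continuous_on S (\<lambda>y. g (A y))"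
    using continuous_on_compose2[OF g(1)] by auto
  moreover have "compact S" by (simp add: S_def)
  ultimately obtain q where q: "real_polynomial_function q" "\<And>y. y \<in> S \<Longrightarrow> \<bar>g (A y) - q y\<bar> < e"
    using Stone_Weierstrass_real_polynomial_function[of S "\<lambda>y. g (A y)" e] \<open>0 < e\<close> by metis
  have \<Phi>: "\<Phi> x \<in> S" for x
    by (auto simp: S_def \<Phi>_def mem_box)
  have inv: "A (\<Phi> x) = x" if "\<And>b. b \<in> Basis \<Longrightarrow> \<bar>x \<bullet> b\<bar> \<le> L" for x
  proof (rule euclidean_eqI)
    fix b :: 'b assume b: "b \<in> Basis"
    have "\<bar>(x \<bullet> b) / L\<bar> \<le> 1" using that[OF b] \<open>0 < L\<close> by simp
    then have "arcsin (sin ((x \<bullet> b) / L)) = (x \<bullet> b) / L"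
      using pi_half_gt_zero pi_ge_two by (intro arcsin_sin) linarith+
    then show "A (\<Phi> x) \<bullet> b = x \<bullet> b"
      using b \<open>0 < L\<close> by (simp add: A_def \<Phi>_def)
  qed
  have "trig_poly (\<lambda>x. q (\<Phi> x))"
    using q(1)
  proof (induction rule: real_polynomial_function.induct)
    case (linear f)
    have "f (\<Phi> x) = (\<Sum>b\<in>Basis. f b * sin (((1 / L) *\<^sub>R b) \<bullet> x))" for x
      unfolding \<Phi>_def using linear
      by (simp add: linear_sum[OF bounded_linear.linear[OF linear]] linear_scale[OF bounded_linear.linear[OF linear]] mult.commute inner_commute)
    then show ?case by (simp only:) (intro trig_poly_sum trig_poly.sin finite_Basis)
  qed (auto intro: trig_poly_const trig_poly.add trig_poly_mult)
  moreover have "\<bar>q (\<Phi> x)\<bar> \<le> K + e" for x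
    using q(2)[OF \<Phi>[of x]] g(2)[of "A (\<Phi> x)"] by linarith
  moreover have "\<bar>g x - q (\<Phi> x)\<bar> \<le> e" if "\<And>b. b \<in> Basis \<Longrightarrow> \<bar>x \<bullet> b\<bar> \<le> L" for x
    using q(2)[OF \<Phi>[of x]] inv[OF that] by simp
  ultimately show ?thesis using that by blast
qed

text \<open>Levy's theorem on the line gives tightness of every coordinate.\<close>

lemma levy_continuity_coordinate:
  fixes X :: "nat \<Rightarrow> 'w \<Rightarrow> real"
  assumes "prob_space P" "prob_space Q"
    and [measurable]: "\<And>n. X n \<in> borel_measurable P" "Y \<in> borel_measurable Q"
    and cf: "\<And>t. (\<lambda>n. CLINT \<omega>|P. iexp (t * X n \<omega>)) \<longlonglongrightarrow> (CLINT \<omega>|Q. iexp (t * Y \<omega>))"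
    and h: "continuous_on UNIV h" "\<And>x. \<bar>h x\<bar> \<le> K"
  shows "(\<lambda>n. LINT \<omega>|P. h (X n \<omega>)) \<longlonglongrightarrow> (LINT \<omega>|Q. h (Y \<omega>) :: real)"
proof -
  interpret P: prob_space P by fact
  interpret Q: prob_space Q by fact
  have P: "real_distribution (distr P borel (X n))" for n
    by (rule P.real_distribution_distr) simp
  have Q: "real_distribution (distr Q borel Y)"
    by (rule Q.real_distribution_distr) simp
  have "weak_conv_m (\<lambda>n. distr P borel (X n)) (distr Q borel Y)"
    using cf by (intro levy_continuity[OF P Q]) (simp add: char_def integral_distr)
  from weak_conv_imp_integral_bdd_continuous_conv[OF P Q this, of h K]
  have "(\<lambda>n. integral\<^sup>L (distr P borel (X n)) h) \<longlonglongrightarrow> integral\<^sup>L (distr Q borel Y) h"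
    using h by (simp add: continuous_on_eq_continuous_at)
  moreover have [measurable]: "h \<in> borel_measurable borel"
    using h by (intro borel_measurable_continuous_onI)
  ultimately show ?thesis by (simp add: integral_distr)
qed

lemma trig_poly_integral_tendsto:
  fixes X :: "nat \<Rightarrow> 'w \<Rightarrow> 'b::euclidean_space"
  assumes P: "prob_space P" and Q: "prob_space Q"
    and [measurable]: "\<And>n. X n \<in> borel_measurable P" "Y \<in> borel_measurable Q"
    and cf: "\<And>v. (\<lambda>n. CLINT \<omega>|P. iexp (v \<bullet> X n \<omega>)) \<longlonglongrightarrow> (CLINT \<omega>|Q. iexp (v \<bullet> Y \<omega>))"
    and p: "trig_poly p"
  shows "(\<lambda>n. LINT \<omega>|P. p (X n \<omega>)) \<longlonglongrightarrow> (LINT \<omega>|Q. p (Y \<omega>))"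
proof -
  interpret P: prob_space P by fact
  interpret Q: prob_space Q by fact
  have intP: "integrable P (\<lambda>\<omega>. iexp (v \<bullet> X n \<omega>))" for v n
    by (rule P.integrable_const_bound[where B=1]) auto
  have intQ: "integrable Q (\<lambda>\<omega>. iexp (v \<bullet> Y \<omega>))" for v
    by (rule Q.integrable_const_bound[where B=1]) auto
  show ?thesis using p
  proof (induction rule: trig_poly.induct)
    case (cos c v)
    have "(\<lambda>n. Re (CLINT \<omega>|P. iexp (v \<bullet> X n \<omega>))) \<longlonglongrightarrow> Re (CLINT \<omega>|Q. iexp (v \<bullet> Y \<omega>))"
      by (intro tendsto_intros cf)
    then have "(\<lambda>n. LINT \<omega>|P. cos (v \<bullet> X n \<omega>)) \<longlonglongrightarrow> (LINT \<omega>|Q. cos (v \<bullet> Y \<omega>))"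
      using intP intQ by (simp add: Re_exp flip: integral_Re)
    then show ?case by (simp add: tendsto_mult_left)
  next
    case (sin c v)
    have "(\<lambda>n. Im (CLINT \<omega>|P. iexp (v \<bullet> X n \<omega>))) \<longlonglongrightarrow> Im (CLINT \<omega>|Q. iexp (v \<bullet> Y \<omega>))"
      by (intro tendsto_intros cf)
    then have "(\<lambda>n. LINT \<omega>|P. sin (v \<bullet> X n \<omega>)) \<longlonglongrightarrow> (LINT \<omega>|Q. sin (v \<bullet> Y \<omega>))"
      using intP intQ by (simp add: Im_exp flip: integral_Im)
    then show ?case by (simp add: tendsto_mult_left)
  next
    case (add f g)
    have meas: "f \<in> borel_measurable borel" "g \<in> borel_measurable borel"
      using add trig_poly_continuous by (auto intro: borel_measurable_continuous_onI)
    note [measurable] = meas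
    obtain K L where K: "\<And>x. \<bar>f x\<bar> \<le> K" and L: "\<And>x. \<bar>g x\<bar> \<le> L"
      using trig_poly_bounded add by metis
    have "integrable P (\<lambda>\<omega>. f (X n \<omega>))" for n
      by (rule P.integrable_const_bound[where B=K]) (auto simp: K)
    moreover have "integrable P (\<lambda>\<omega>. g (X n \<omega>))" for n
      by (rule P.integrable_const_bound[where B=L]) (auto simp: L)
    moreover have "integrable Q (\<lambda>\<omega>. f (Y \<omega>))"
      by (rule Q.integrable_const_bound[where B=K]) (auto simp: K)
    moreover have "integrable Q (\<lambda>\<omega>. g (Y \<omega>))"
      by (rule Q.integrable_const_bound[where B=L]) (auto simp: L)
    ultimately show ?case using add by (simp add: tendsto_add)
  qed
qed

lemma bounded_continuous_integral_diff_le: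
  fixes Z :: "'w \<Rightarrow> 'b::euclidean_space" and h :: "real \<Rightarrow> real" and K e \<delta> :: real
  assumes "prob_space P" and [measurable]: "Z \<in> borel_measurable P"
    and g: "continuous_on UNIV g" "\<And>x. \<bar>g x\<bar> \<le> K" and p: "continuous_on UNIV p" "\<And>x. \<bar>p x\<bar> \<le> K + e"
    and h: "continuous_on UNIV h" "\<And>x. 0 \<le> h x" "\<And>x. h x \<le> 1"
    and small: "\<And>b. b \<in> Basis \<Longrightarrow> (LINT \<omega>|P. h (Z \<omega> \<bullet> b)) \<le> \<delta>"
    and near: "\<And>x. \<bar>g x - p x\<bar> \<le> e + (\<Sum>b\<in>Basis. (2 * K + e) * h (x \<bullet> b))"
  shows "\<bar>(LINT \<omega>|P. g (Z \<omega>)) - (LINT \<omega>|P. p (Z \<omega>))\<bar> \<le> e + real DIM('b) * (2 * K + e) * \<delta>"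
proof -
  interpret prob_space P by fact
  have [measurable]: "g \<in> borel_measurable borel" "p \<in> borel_measurable borel" "h \<in> borel_measurable borel"
    using g p h by (auto intro: borel_measurable_continuous_onI)
  have ig: "integrable P (\<lambda>\<omega>. g (Z \<omega>))"
    using g by (auto intro!: integrable_const_bound[where B=K])
  have ip: "integrable P (\<lambda>\<omega>. p (Z \<omega>))"
    using p by (auto intro!: integrable_const_bound[where B="K+e"])
  have ih: "integrable P (\<lambda>\<omega>. h (Z \<omega> \<bullet> b))" for b
    using h by (auto intro!: integrable_const_bound[where B=1])
  have "\<bar>(LINT \<omega>|P. g (Z \<omega>)) - (LINT \<omega>|P. p (Z \<omega>))\<bar> = \<bar>LINT \<omega>|P. g (Z \<omega>) - p (Z \<omega>)\<bar>"
    using ig ip by simp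
  also have "\<dots> \<le> (LINT \<omega>|P. \<bar>g (Z \<omega>) - p (Z \<omega>)\<bar>)"
    by (rule integral_abs_bound)
  also have "\<dots> \<le> (LINT \<omega>|P. e + (\<Sum>b\<in>Basis. (2 * K + e) * h (Z \<omega> \<bullet> b)))"
    using ig ip ih near by (intro integral_mono) auto
  also have "\<dots> = e + (\<Sum>b\<in>Basis. (2 * K + e) * (LINT \<omega>|P. h (Z \<omega> \<bullet> b)))"
    using ih by (simp add: prob_space)
  also have "\<dots> \<le> e + (\<Sum>b\<in>(Basis::'b set). (2 * K + e) * \<delta>)"
    using small g(2)[of 0] p(2)[of 0] by (intro add_left_mono sum_mono mult_left_mono) auto
  finally show ?thesis by (simp add: mult_ac)
qed

text \<open>Expectations of trigonometric polynomials converge because the characteristic functions do. A bounded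
  continuous \<open>g\<close> is replaced by such a polynomial on a large cube; the probability of leaving the
  cube is controlled, uniformly in \<open>n\<close>, by the coordinates.\<close>

theorem levy_continuity_euclidean:
  fixes X :: "nat \<Rightarrow> 'w \<Rightarrow> 'b::euclidean_space" and g :: "'b \<Rightarrow> real"
  assumes P: "prob_space P" and Q: "prob_space Q"
    and X[measurable]: "\<And>n. X n \<in> borel_measurable P" and Y[measurable]: "Y \<in> borel_measurable Q"
    and cf: "\<And>v. (\<lambda>n. CLINT \<omega>|P. iexp (v \<bullet> X n \<omega>)) \<longlonglongrightarrow> (CLINT \<omega>|Q. iexp (v \<bullet> Y \<omega>))"
    and g: "continuous_on UNIV g" "bounded (range g)"
  shows "(\<lambda>n. LINT \<omega>|P. g (X n \<omega>)) \<longlonglongrightarrow> (LINT \<omega>|Q. g (Y \<omega>))"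
proof -
  interpret P: prob_space P by fact
  interpret Q: prob_space Q by fact
  obtain K where K: "0 < K" "\<And>x. \<bar>g x\<bar> \<le> K"
    using g(2) unfolding bounded_pos by auto
  \<comment> \<open>A continuous majorant of the indicator of \<open>|x| \<ge> L + 1\<close> that vanishes for \<open>|x| \<le> L\<close>.\<close>
  define h :: "real \<Rightarrow> real \<Rightarrow> real" where "h L x = min 1 (max 0 (\<bar>x\<bar> - L))" for L x
  have h: "continuous_on UNIV (h L)" "0 \<le> h L x" "h L x \<le> 1" "\<bar>h L x\<bar> \<le> 1" for L x
    by (auto simp: h_def intro!: continuous_intros)
  then have h_meas[measurable]: "h L \<in> borel_measurable borel" for L
    by (intro borel_measurable_continuous_onI) auto
  have tight: "(\<lambda>n. LINT \<omega>|Q. h (real n) (Y \<omega> \<bullet> b)) \<longlonglongrightarrow> (LINT \<omega>|Q. 0)" for b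
  proof (rule integral_dominated_convergence[where w="\<lambda>_. 1"])
    show "AE x in Q. (\<lambda>n. h (real n) (Y x \<bullet> b)) \<longlonglongrightarrow> 0"
    proof (intro AE_I2 tendsto_eventually)
      fix x
      obtain N where "\<bar>Y x \<bullet> b\<bar> \<le> real N" using real_arch_simple by blast
      then show "\<forall>\<^sub>F n in sequentially. h (real n) (Y x \<bullet> b) = 0"
        by (intro eventually_sequentiallyI[of N]) (auto simp: h_def)
    qed
  qed (auto simp: h)
  have coord: "(\<lambda>n. LINT \<omega>|P. h L (X n \<omega> \<bullet> b)) \<longlonglongrightarrow> (LINT \<omega>|Q. h L (Y \<omega> \<bullet> b))" for L b
  proof (rule levy_continuity_coordinate[OF P Q, where X="\<lambda>n \<omega>. X n \<omega> \<bullet> b" and Y="\<lambda>\<omega>. Y \<omega> \<bullet> b" and h="h L" and K=1])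
    show "(\<lambda>n. CLINT \<omega>|P. iexp (t * (X n \<omega> \<bullet> b))) \<longlonglongrightarrow> (CLINT \<omega>|Q. iexp (t * (Y \<omega> \<bullet> b)))" for t
      using cf[of "t *\<^sub>R b"] by (simp add: inner_commute)
  qed (auto simp: h)
  show ?thesis
  proof (rule LIMSEQ_I)
    fix e0 :: real assume "0 < e0"
    define e where "e = e0 / 8"
    have e: "0 < e" using \<open>0 < e0\<close> by (simp add: e_def)
    define D where "D = real DIM('b)"
    have D: "0 < D" by (simp add: D_def)
    define \<delta> where "\<delta> = e / (D * (2 * K + e))"
    have \<delta>: "0 < \<delta>" using e K D by (simp add: \<delta>_def)
    have "\<forall>\<^sub>F n in sequentially. \<forall>b\<in>Basis. (LINT \<omega>|Q. h (real n) (Y \<omega> \<bullet> b)) < \<delta>"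
      using order_tendstoD(2)[OF tight] \<delta> by (auto intro!: eventually_ball_finite)
    then obtain N where "\<And>b. b \<in> Basis \<Longrightarrow> (LINT \<omega>|Q. h (real N) (Y \<omega> \<bullet> b)) < \<delta>"
      unfolding eventually_sequentially by auto
    then have N: "\<And>b. b \<in> Basis \<Longrightarrow> (LINT \<omega>|Q. h (real N) (Y \<omega> \<bullet> b)) < \<delta>" .
    obtain p where p: "trig_poly p" "\<And>x. \<bar>p x\<bar> \<le> K + e"
      "\<And>x. (\<And>b. b \<in> Basis \<Longrightarrow> \<bar>x \<bullet> b\<bar> \<le> real N + 1) \<Longrightarrow> \<bar>g x - p x\<bar> \<le> e"
      using trig_poly_approx[OF g(1) K(2), of "real N + 1" e] e by auto
    have near: "\<bar>g x - p x\<bar> \<le> e + (\<Sum>b\<in>Basis. (2 * K + e) * h (real N) (x \<bullet> b))" for x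
    proof (cases "\<forall>b\<in>Basis. \<bar>x \<bullet> b\<bar> \<le> real N + 1")
      case True
      have "0 \<le> (\<Sum>b\<in>Basis. (2 * K + e) * h (real N) (x \<bullet> b))"
        using K e by (intro sum_nonneg mult_nonneg_nonneg h) auto
      then show ?thesis using p(3)[of x] True by auto
    next
      case False
      then obtain b where b: "b \<in> Basis" "h (real N) (x \<bullet> b) = 1" by (auto simp: h_def)
      have "\<bar>g x - p x\<bar> \<le> 2 * K + e" using K(2)[of x] p(2)[of x] by linarith
      also have "\<dots> = (2 * K + e) * h (real N) (x \<bullet> b)" using b by simp
      also have "\<dots> \<le> (\<Sum>b\<in>Basis. (2 * K + e) * h (real N) (x \<bullet> b))"
        using K e b by (intro member_le_sum mult_nonneg_nonneg h) auto
      finally show ?thesis using e by simp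
    qed
    have \<delta>_eq: "e + D * (2 * K + e) * \<delta> = 2 * e"
      using D K e by (simp add: \<delta>_def)
    have Qsmall: "\<bar>(LINT \<omega>|Q. g (Y \<omega>)) - (LINT \<omega>|Q. p (Y \<omega>))\<bar> \<le> 2 * e"
      unfolding \<delta>_eq[symmetric] D_def
      by (rule bounded_continuous_integral_diff_le[where h="h (real N)"]) (use Q Y g K p h near N trig_poly_continuous in \<open>auto intro: less_imp_le\<close>)
    have Psmall: "\<bar>(LINT \<omega>|P. g (X n \<omega>)) - (LINT \<omega>|P. p (X n \<omega>))\<bar> \<le> 2 * e"
      if "\<forall>b\<in>Basis. (LINT \<omega>|P. h (real N) (X n \<omega> \<bullet> b)) < \<delta>" for n
      unfolding \<delta>_eq[symmetric] D_def
      by (rule bounded_continuous_integral_diff_le[where h="h (real N)"]) (use P X g K p h near that trig_poly_continuous in \<open>auto intro: less_imp_le\<close>)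
    have "\<forall>\<^sub>F n in sequentially. \<bar>(LINT \<omega>|P. p (X n \<omega>)) - (LINT \<omega>|Q. p (Y \<omega>))\<bar> < e"
      using tendstoD[OF trig_poly_integral_tendsto[OF P Q X Y cf p(1)] e] by (simp add: dist_real_def)
    moreover have "\<forall>\<^sub>F n in sequentially. \<forall>b\<in>Basis. (LINT \<omega>|P. h (real N) (X n \<omega> \<bullet> b)) < \<delta>"
      using order_tendstoD(2)[OF coord] N by (auto intro!: eventually_ball_finite)
    ultimately have "\<forall>\<^sub>F n in sequentially. norm ((LINT \<omega>|P. g (X n \<omega>)) - (LINT \<omega>|Q. g (Y \<omega>))) < e0"
    proof eventually_elim
      case (elim n)
      then show ?case using Psmall[of n] Qsmall e unfolding e_def real_norm_def by linarith
    qed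
    then show "\<exists>no. \<forall>n\<ge>no. norm ((LINT \<omega>|P. g (X n \<omega>)) - (LINT \<omega>|Q. g (Y \<omega>))) < e0"
      by (simp add: eventually_sequentially)
  qed
qed

section \<open>Convergence in probability\<close>

text \<open>This metric for convergence in probability turns estimates of probabilities into estimates of
  integrals, and makes the triangle inequality available.\<close>

definition prob_dist :: "'w measure \<Rightarrow> ('w \<Rightarrow> 'b::metric_space) \<Rightarrow> ('w \<Rightarrow> 'b) \<Rightarrow> real" where
  "prob_dist P X Y = (LINT \<omega>|P. min 1 (dist (X \<omega>) (Y \<omega>)))"

lemma min_one_subadditive: "a \<le> b + c \<Longrightarrow> 0 \<le> b \<Longrightarrow> 0 \<le> c \<Longrightarrow> min 1 a \<le> min 1 b + min 1 c"
  for a b c :: real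
  by (auto simp: min_def)

context prob_space
begin

lemma integrable_min_dist [simp]:
  fixes X :: "'a \<Rightarrow> 'b::{metric_space, second_countable_topology}"
  assumes "X \<in> borel_measurable M" "Y \<in> borel_measurable M"
  shows "integrable M (\<lambda>\<omega>. min 1 (dist (X \<omega>) (Y \<omega>)))"
  using assms by (intro integrable_const_bound[where B=1]) auto

lemma prob_dist_nonneg: "0 \<le> prob_dist M X Y"
  by (simp add: prob_dist_def)

lemma prob_dist_triangle:
  fixes X :: "'a \<Rightarrow> 'b::{metric_space, second_countable_topology}"
  assumes "X \<in> borel_measurable M" "Y \<in> borel_measurable M" "Z \<in> borel_measurable M"
  shows "prob_dist M X Z \<le> prob_dist M X Y + prob_dist M Y Z"
proof -
  have "min 1 (dist x z) \<le> min 1 (dist x y) + min 1 (dist y z)" for x y z :: 'b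
    by (intro min_one_subadditive dist_triangle) auto
  then have "prob_dist M X Z \<le> (LINT \<omega>|M. min 1 (dist (X \<omega>) (Y \<omega>)) + min 1 (dist (Y \<omega>) (Z \<omega>)))"
    unfolding prob_dist_def using assms by (intro integral_mono) auto
  then show ?thesis using assms by (simp add: prob_dist_def)
qed

lemma prob_gt_le_prob_dist:
  fixes X :: "'a \<Rightarrow> 'b::{metric_space, second_countable_topology}"
  assumes [measurable]: "X \<in> borel_measurable M" "Y \<in> borel_measurable M" and "0 < e"
  shows "prob {\<omega>\<in>space M. dist (X \<omega>) (Y \<omega>) > e} \<le> prob_dist M X Y / min 1 e"
proof -
  let ?A = "{\<omega>\<in>space M. dist (X \<omega>) (Y \<omega>) > e}"
  have [measurable]: "?A \<in> events" by measurable
  have int: "integrable M (indicator ?A :: _ \<Rightarrow> real)"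
    by (rule integrable_real_indicator) (auto simp: less_top[symmetric])
  have "prob ?A * min 1 e = (LINT \<omega>|M. indicator ?A \<omega> * min 1 e)" using int by simp
  also have "\<dots> \<le> prob_dist M X Y"
    unfolding prob_dist_def using \<open>0 < e\<close>
    by (intro integral_mono) (auto simp: int split: split_indicator)
  finally show ?thesis using \<open>0 < e\<close> by (simp add: field_simps)
qed

lemma prob_dist_le_prob_gt:
  fixes X :: "'a \<Rightarrow> 'b::{metric_space, second_countable_topology}"
  assumes [measurable]: "X \<in> borel_measurable M" "Y \<in> borel_measurable M" and "0 < e"
  shows "prob_dist M X Y \<le> e + prob {\<omega>\<in>space M. dist (X \<omega>) (Y \<omega>) > e}"
proof -
  let ?A = "{\<omega>\<in>space M. dist (X \<omega>) (Y \<omega>) > e}"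
  have [measurable]: "?A \<in> events" by measurable
  have int: "integrable M (indicator ?A :: _ \<Rightarrow> real)"
    by (rule integrable_real_indicator) (auto simp: less_top[symmetric])
  have "prob_dist M X Y \<le> (LINT \<omega>|M. e + indicator ?A \<omega>)"
    unfolding prob_dist_def using \<open>0 < e\<close>
    by (intro integral_mono) (auto simp: int split: split_indicator)
  also have "\<dots> = e + prob ?A" using int by (simp add: prob_space)
  finally show ?thesis .
qed

lemma tendsto_prob_iff_prob_dist:
  fixes X :: "nat \<Rightarrow> 'a \<Rightarrow> 'b::{metric_space, second_countable_topology}"
  shows "tendsto_prob M X Y \<longleftrightarrow> (\<forall>k. X k \<in> borel_measurable M) \<and> Y \<in> borel_measurable M \<and>
     (\<lambda>k. prob_dist M (X k) Y) \<longlonglongrightarrow> 0"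
proof (intro iffI conjI)
  assume L: "tendsto_prob M X Y"
  then have m: "\<And>k. X k \<in> borel_measurable M" "Y \<in> borel_measurable M"
    and lim: "\<And>e. 0 < e \<Longrightarrow> (\<lambda>k. prob {\<omega>\<in>space M. dist (X k \<omega>) (Y \<omega>) > e}) \<longlonglongrightarrow> 0"
    by (auto simp: tendsto_prob_def)
  then show "\<forall>k. X k \<in> borel_measurable M" "Y \<in> borel_measurable M" by auto
  show "(\<lambda>k. prob_dist M (X k) Y) \<longlonglongrightarrow> 0"
  proof (rule LIMSEQ_I)
    fix e :: real assume "0 < e"
    then have e: "0 < e / 2" by simp
    have "\<forall>\<^sub>F k in sequentially. prob {\<omega>\<in>space M. dist (X k \<omega>) (Y \<omega>) > e / 2} < e / 2"
      by (rule order_tendstoD(2)[OF lim[OF e] e])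
    then have "\<forall>\<^sub>F k in sequentially. norm (prob_dist M (X k) Y - 0) < e"
    proof eventually_elim
      case (elim k)
      then show ?case
        using prob_dist_le_prob_gt[OF m(1) m(2) e, of k] prob_dist_nonneg[of "X k" Y] by simp
    qed
    then show "\<exists>no. \<forall>k\<ge>no. norm (prob_dist M (X k) Y - 0) < e" by (simp add: eventually_sequentially)
  qed
next
  assume R: "(\<forall>k. X k \<in> borel_measurable M) \<and> Y \<in> borel_measurable M \<and> (\<lambda>k. prob_dist M (X k) Y) \<longlonglongrightarrow> 0"
  show "tendsto_prob M X Y"
    unfolding tendsto_prob_def
  proof (intro conjI allI impI)
    fix e :: real assume "0 < e"
    show "(\<lambda>k. prob {\<omega>\<in>space M. e < dist (X k \<omega>) (Y \<omega>)}) \<longlonglongrightarrow> 0"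
    proof (rule tendsto_sandwich[OF _ _ tendsto_const])
      show "(\<lambda>k. prob_dist M (X k) Y / min 1 e) \<longlonglongrightarrow> 0"
        using tendsto_divide[OF R[THEN conjunct2, THEN conjunct2] tendsto_const, of "min 1 e"] \<open>0 < e\<close> by simp
    qed (use R \<open>0 < e\<close> prob_gt_le_prob_dist in \<open>auto intro!: always_eventually\<close>)
  qed (use R in auto)
qed

lemma tendsto_prob_AE_cong:
  fixes X :: "nat \<Rightarrow> 'a \<Rightarrow> 'b::{metric_space, second_countable_topology}"
  assumes X: "tendsto_prob M X Y"
    and m: "\<And>k. X' k \<in> borel_measurable M" "Y' \<in> borel_measurable M"
    and ae: "\<And>k. AE \<omega> in M. X k \<omega> = X' k \<omega>" "AE \<omega> in M. Y \<omega> = Y' \<omega>"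
  shows "tendsto_prob M X' Y'"
proof -
  have [measurable]: "X k \<in> borel_measurable M" "Y \<in> borel_measurable M" for k
    using X by (auto simp: tendsto_prob_def)
  note [measurable] = m
  have "prob_dist M (X' k) Y' = prob_dist M (X k) Y" for k
    unfolding prob_dist_def
    by (intro integral_cong_AE) (use ae(1)[of k] ae(2) in \<open>auto elim: eventually_elim2\<close>)
  then show ?thesis using X m by (simp add: tendsto_prob_iff_prob_dist)
qed

lemma tendsto_prob_add:
  fixes X :: "nat \<Rightarrow> 'a \<Rightarrow> 'b::{real_normed_vector, second_countable_topology}"
  assumes "tendsto_prob M X Y" "tendsto_prob M X' Y'"
  shows "tendsto_prob M (\<lambda>k \<omega>. X k \<omega> + X' k \<omega>) (\<lambda>\<omega>. Y \<omega> + Y' \<omega>)"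
proof -
  have m[measurable]: "X k \<in> borel_measurable M" "Y \<in> borel_measurable M"
      "X' k \<in> borel_measurable M" "Y' \<in> borel_measurable M" for k
    using assms by (auto simp: tendsto_prob_iff_prob_dist)
  have lim: "(\<lambda>k. prob_dist M (X k) Y + prob_dist M (X' k) Y') \<longlonglongrightarrow> 0 + 0"
    using assms by (intro tendsto_add) (simp_all add: tendsto_prob_iff_prob_dist)
  have "min 1 (dist (x + x') (y + y')) \<le> min 1 (dist x y) + min 1 (dist x' y')" for x x' y y' :: 'b
    by (intro min_one_subadditive dist_triangle_add) auto
  then have le: "prob_dist M (\<lambda>\<omega>. X k \<omega> + X' k \<omega>) (\<lambda>\<omega>. Y \<omega> + Y' \<omega>) \<le> prob_dist M (X k) Y + prob_dist M (X' k) Y'" for k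
  proof -
    have "prob_dist M (\<lambda>\<omega>. X k \<omega> + X' k \<omega>) (\<lambda>\<omega>. Y \<omega> + Y' \<omega>) \<le>
        (LINT \<omega>|M. min 1 (dist (X k \<omega>) (Y \<omega>)) + min 1 (dist (X' k \<omega>) (Y' \<omega>)))"
      unfolding prob_dist_def
      using \<open>\<And>x x' y y'. min 1 (dist (x + x') (y + y')) \<le> min 1 (dist x y) + min 1 (dist x' y')\<close>
      by (intro integral_mono) auto
    then show ?thesis by (simp add: prob_dist_def)
  qed
  have "(\<lambda>k. prob_dist M (\<lambda>\<omega>. X k \<omega> + X' k \<omega>) (\<lambda>\<omega>. Y \<omega> + Y' \<omega>)) \<longlonglongrightarrow> 0"
    by (rule tendsto_sandwich[OF _ _ tendsto_const lim[simplified]])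
      (auto intro!: always_eventually prob_dist_nonneg le)
  then show ?thesis by (auto simp: tendsto_prob_iff_prob_dist)
qed

lemma tendsto_prob_bounded_linear:
  fixes X :: "nat \<Rightarrow> 'a \<Rightarrow> 'b::{real_normed_vector, second_countable_topology}"
    and L :: "'b \<Rightarrow> 'c::{real_normed_vector, second_countable_topology}"
  assumes "bounded_linear L" "tendsto_prob M X Y"
  shows "tendsto_prob M (\<lambda>k \<omega>. L (X k \<omega>)) (\<lambda>\<omega>. L (Y \<omega>))"
proof -
  interpret L: bounded_linear L by fact
  have [measurable]: "L \<in> borel_measurable borel"
    by (intro borel_measurable_continuous_onI L.continuous_on continuous_on_id)
  have m[measurable]: "X k \<in> borel_measurable M" "Y \<in> borel_measurable M" for k
    using assms by (auto simp: tendsto_prob_iff_prob_dist)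
  have lim: "(\<lambda>k. prob_dist M (X k) Y) \<longlonglongrightarrow> 0"
    using assms by (auto simp: tendsto_prob_iff_prob_dist)
  obtain K where K: "0 \<le> K" "\<And>x. norm (L x) \<le> norm x * K"
    using L.nonneg_bounded by blast
  have "min 1 (dist (L x) (L y)) \<le> (K + 1) * min 1 (dist x y)" for x y
  proof (cases "dist x y \<le> 1")
    case True
    have "dist (L x) (L y) \<le> K * dist x y"
      using K(2)[of "x - y"] by (simp add: dist_norm L.diff mult.commute)
    also have "\<dots> \<le> (K + 1) * dist x y" by (simp add: algebra_simps)
    finally show ?thesis using True by (simp add: min_def)
  qed (use K in simp)
  then have le: "prob_dist M (\<lambda>\<omega>. L (X k \<omega>)) (\<lambda>\<omega>. L (Y \<omega>)) \<le> (K + 1) * prob_dist M (X k) Y" for k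
  proof -
    have "prob_dist M (\<lambda>\<omega>. L (X k \<omega>)) (\<lambda>\<omega>. L (Y \<omega>)) \<le> (LINT \<omega>|M. (K + 1) * min 1 (dist (X k \<omega>) (Y \<omega>)))"
      unfolding prob_dist_def using \<open>\<And>x y. min 1 (dist (L x) (L y)) \<le> (K + 1) * min 1 (dist x y)\<close>
      by (intro integral_mono) auto
    then show ?thesis by (simp add: prob_dist_def)
  qed
  have "(\<lambda>k. prob_dist M (\<lambda>\<omega>. L (X k \<omega>)) (\<lambda>\<omega>. L (Y \<omega>))) \<longlonglongrightarrow> 0"
    by (rule tendsto_sandwich[OF _ _ tendsto_const tendsto_mult_right_zero[OF lim, of "K + 1"]])
      (auto intro!: always_eventually prob_dist_nonneg le)
  then show ?thesis by (simp add: tendsto_prob_iff_prob_dist)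
qed

lemma norm_iexp_diff_le: "norm (iexp x - iexp y) \<le> \<bar>x - y\<bar>"
proof -
  have "iexp x - iexp y = iexp y * (iexp (x - y) - 1)"
    by (simp add: algebra_simps flip: exp_add)
  then have "norm (iexp x - iexp y) = norm (iexp (x - y) - 1)"
    by (simp add: norm_mult)
  also have "\<dots> \<le> \<bar>x - y\<bar>"
    using iexp_approx1[of "x - y" 0] by simp
  finally show ?thesis .
qed

lemma tendsto_prob_imp_char_tendsto:
  fixes X :: "nat \<Rightarrow> 'a \<Rightarrow> 'b::euclidean_space"
  assumes "tendsto_prob M X Y"
  shows "(\<lambda>k. CLINT \<omega>|M. iexp (v \<bullet> X k \<omega>)) \<longlonglongrightarrow> (CLINT \<omega>|M. iexp (v \<bullet> Y \<omega>))"
proof -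
  have m[measurable]: "X k \<in> borel_measurable M" "Y \<in> borel_measurable M" for k
    using assms by (auto simp: tendsto_prob_iff_prob_dist)
  have lim: "(\<lambda>k. prob_dist M (X k) Y) \<longlonglongrightarrow> 0"
    using assms by (auto simp: tendsto_prob_iff_prob_dist)
  have int: "integrable M (\<lambda>\<omega>. iexp (v \<bullet> X k \<omega>))" "integrable M (\<lambda>\<omega>. iexp (v \<bullet> Y \<omega>))" for k
    by (auto intro!: integrable_const_bound[where B=1])
  have pt: "norm (iexp (v \<bullet> x) - iexp (v \<bullet> y)) \<le> (2 + norm v) * min 1 (dist x y)" for x y
  proof (cases "dist x y \<le> 1")
    case True
    have "norm (iexp (v \<bullet> x) - iexp (v \<bullet> y)) \<le> \<bar>v \<bullet> (x - y)\<bar>"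
      using norm_iexp_diff_le[of "v \<bullet> x" "v \<bullet> y"] by (simp add: inner_diff_right)
    also have "\<dots> \<le> norm v * dist x y"
      using Cauchy_Schwarz_ineq2[of v "x - y"] by (simp add: dist_norm)
    also have "\<dots> \<le> (2 + norm v) * dist x y" by (simp add: algebra_simps)
    finally show ?thesis using True by (simp add: min_def)
  next
    case False
    have "norm (iexp (v \<bullet> x) - iexp (v \<bullet> y)) \<le> norm (iexp (v \<bullet> x)) + norm (iexp (v \<bullet> y))"
      by (rule norm_triangle_ineq4)
    also have "\<dots> \<le> 2 + norm v" by simp
    finally show ?thesis using False by simp
  qed
  have "norm ((CLINT \<omega>|M. iexp (v \<bullet> X k \<omega>)) - (CLINT \<omega>|M. iexp (v \<bullet> Y \<omega>))) \<le> (2 + norm v) * prob_dist M (X k) Y" for k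
  proof -
    have "norm ((CLINT \<omega>|M. iexp (v \<bullet> X k \<omega>)) - (CLINT \<omega>|M. iexp (v \<bullet> Y \<omega>)))
        = norm (CLINT \<omega>|M. iexp (v \<bullet> X k \<omega>) - iexp (v \<bullet> Y \<omega>))"
      using int by (subst Bochner_Integration.integral_diff) auto
    also have "\<dots> \<le> (LINT \<omega>|M. norm (iexp (v \<bullet> X k \<omega>) - iexp (v \<bullet> Y \<omega>)))"
      by (rule integral_norm_bound)
    also have "\<dots> \<le> (LINT \<omega>|M. (2 + norm v) * min 1 (dist (X k \<omega>) (Y \<omega>)))"
      using pt int by (intro integral_mono integrable_norm Bochner_Integration.integrable_diff integrable_mult_right integrable_min_dist m) auto
    finally show ?thesis by (simp add: prob_dist_def)
  qed
  then have "(\<lambda>k. (CLINT \<omega>|M. iexp (v \<bullet> X k \<omega>)) - (CLINT \<omega>|M. iexp (v \<bullet> Y \<omega>))) \<longlonglongrightarrow> 0"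
    by (rule Lim_null_comparison[OF always_eventually[OF allI] tendsto_mult_right_zero[OF lim, of "2 + norm v"]])
  then show ?thesis by (rule LIM_zero_cancel)
qed

text \<open>The limit law is the point mass at \<open>0\<close>, and convergence in distribution is tested on the bounded
  continuous function \<open>min 1 |x|\<close>.\<close>

lemma char_tendsto_1_imp_prob_dist:
  fixes Z :: "nat \<Rightarrow> 'a \<Rightarrow> 'b::euclidean_space"
  assumes [measurable]: "\<And>n. Z n \<in> borel_measurable M"
    and cf: "\<And>v. (\<lambda>n. CLINT \<omega>|M. iexp (v \<bullet> Z n \<omega>)) \<longlonglongrightarrow> 1"
  shows "(\<lambda>n. LINT \<omega>|M. min 1 (norm (Z n \<omega>))) \<longlonglongrightarrow> 0"
proof -
  have "(\<lambda>n. LINT \<omega>|M. min 1 (norm (Z n \<omega>))) \<longlonglongrightarrow> (LINT \<omega>|M. min 1 (norm (0::'b)))"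
  proof (rule levy_continuity_euclidean[where g="\<lambda>x. min 1 (norm x)" and Y="\<lambda>_. 0"])
    show "(\<lambda>n. CLINT \<omega>|M. iexp (v \<bullet> Z n \<omega>)) \<longlonglongrightarrow> (CLINT \<omega>|M. iexp (v \<bullet> 0))" for v
      using cf[of v] by (simp add: prob_space)
    show "bounded (range (\<lambda>x::'b. min 1 (norm x)))"
      by (auto simp: bounded_iff intro!: exI[of _ 1])
  qed (auto intro!: continuous_intros prob_space_axioms)
  then show ?thesis by simp
qed

text \<open>Along a fast subsequence the distances are almost surely summable.\<close>

lemma Cauchy_imp_tendsto_prob:
  fixes X :: "nat \<Rightarrow> 'a \<Rightarrow> 'b::{banach, second_countable_topology}"
  assumes X[measurable]: "\<And>k. X k \<in> borel_measurable M"
    and Cauchy: "\<And>e. 0 < e \<Longrightarrow> \<exists>N. \<forall>k\<ge>N. \<forall>l\<ge>N. prob_dist M (X k) (X l) < e"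
  shows "\<exists>Y. tendsto_prob M X Y"
proof -
  have "\<exists>N. \<forall>k\<ge>N. \<forall>l\<ge>N. prob_dist M (X k) (X l) < (1/2) ^ j" for j
    by (rule Cauchy) simp
  then obtain N where N: "\<And>j k l. N j \<le> k \<Longrightarrow> N j \<le> l \<Longrightarrow> prob_dist M (X k) (X l) < (1/2) ^ j"
    by metis
  define r where "r j = (\<Sum>i\<le>j. N i)" for j
  have r: "N j \<le> r i" if "j \<le> i" for i j
    unfolding r_def using that by (intro member_le_sum) auto
  define W where "W j \<omega> = min 1 (dist (X (r j) \<omega>) (X (r (Suc j)) \<omega>))" for j \<omega>
  have W: "(LINT \<omega>|M. W j \<omega>) < (1/2) ^ j" for j
    using N[OF r[of j j] r[of j "Suc j"]] by (simp add: prob_dist_def W_def)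
  have [measurable]: "W j \<in> borel_measurable M" for j unfolding W_def by measurable
  have "(\<integral>\<^sup>+\<omega>. (\<Sum>j. ennreal (W j \<omega>)) \<partial>M) = (\<Sum>j. \<integral>\<^sup>+\<omega>. ennreal (W j \<omega>) \<partial>M)"
    by (rule nn_integral_suminf) measurable
  also have "\<dots> = (\<Sum>j. ennreal (LINT \<omega>|M. W j \<omega>))"
    by (intro suminf_cong nn_integral_eq_integral) (auto simp: W_def)
  also have "\<dots> \<le> (\<Sum>j. ennreal ((1/2) ^ j))"
    using W by (intro suminf_le ennreal_leI less_imp_le) auto
  also have "\<dots> = ennreal (\<Sum>j. (1/2) ^ j)"
    by (intro suminf_ennreal2) auto
  also have "\<dots> < \<infinity>" by simp
  finally have "AE \<omega> in M. (\<Sum>j. ennreal (W j \<omega>)) \<noteq> \<infinity>"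
    by (intro nn_integral_noteq_infinite) auto
  then have conv: "AE \<omega> in M. convergent (\<lambda>j. X (r j) \<omega>)"
  proof eventually_elim
    case (elim \<omega>)
    have sW: "summable (\<lambda>j. W j \<omega>)"
      by (rule summable_suminf_not_top) (use elim in \<open>auto simp: W_def\<close>)
    then have "\<forall>\<^sub>F j in sequentially. W j \<omega> < 1"
      by (intro order_tendstoD(2)[OF summable_LIMSEQ_zero]) auto
    then have "\<forall>\<^sub>F j in sequentially. norm (norm (X (r (Suc j)) \<omega> - X (r j) \<omega>)) \<le> W j \<omega>"
      by eventually_elim (auto simp: W_def min_def dist_norm norm_minus_commute split: if_splits)
    from summable_comparison_test_ev[OF this sW]
    have "summable (\<lambda>j. X (r (Suc j)) \<omega> - X (r j) \<omega>)"
      by (rule summable_norm_cancel)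
    then have "convergent (\<lambda>n. X (r n) \<omega> - X (r 0) \<omega>)"
      by (simp add: summable_iff_convergent sum_lessThan_telescope[of "\<lambda>n. X (r n) \<omega>"])
    from convergent_add[OF this convergent_const[of "X (r 0) \<omega>"]] show ?case by simp
  qed
  define Y where "Y \<omega> = lim (\<lambda>j. X (r j) \<omega>)" for \<omega>
  have Y[measurable]: "Y \<in> borel_measurable M" unfolding Y_def by measurable
  have "(\<lambda>j. prob_dist M (X (r j)) Y) \<longlonglongrightarrow> (LINT \<omega>|M. 0)"
    unfolding prob_dist_def
  proof (rule integral_dominated_convergence[where w="\<lambda>_. 1"])
    show "AE \<omega> in M. (\<lambda>j. min 1 (dist (X (r j) \<omega>) (Y \<omega>))) \<longlonglongrightarrow> 0"
      using conv
    proof eventually_elim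
      case (elim \<omega>)
      then have "(\<lambda>j. X (r j) \<omega>) \<longlonglongrightarrow> Y \<omega>" by (simp add: Y_def convergent_LIMSEQ_iff)
      then have "(\<lambda>j. min 1 (dist (X (r j) \<omega>) (Y \<omega>))) \<longlonglongrightarrow> min 1 (dist (Y \<omega>) (Y \<omega>))"
        by (intro tendsto_intros)
      then show ?case by simp
    qed
  qed auto
  then have sub: "(\<lambda>j. prob_dist M (X (r j)) Y) \<longlonglongrightarrow> 0" by simp
  have "(\<lambda>k. prob_dist M (X k) Y) \<longlonglongrightarrow> 0"
  proof (rule LIMSEQ_I)
    fix e :: real assume "0 < e"
    then have e: "0 < e / 2" by simp
    have "(\<lambda>j. (1/2::real) ^ j) \<longlonglongrightarrow> 0" by (rule LIMSEQ_power_zero) simp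
    from order_tendstoD(2)[OF this e] order_tendstoD(2)[OF sub e]
    have "\<forall>\<^sub>F j in sequentially. (1/2) ^ j < e / 2 \<and> prob_dist M (X (r j)) Y < e / 2"
      by eventually_elim simp
    then obtain j where j: "(1/2) ^ j < e / 2" "prob_dist M (X (r j)) Y < e / 2"
      by (auto simp: eventually_sequentially)
    have "norm (prob_dist M (X k) Y - 0) < e" if "N j \<le> k" for k
      using N[OF that r[of j j]] j prob_dist_triangle[OF X[of k] X[of "r j"] Y] prob_dist_nonneg[of "X k" Y] by simp
    then show "\<exists>no. \<forall>k\<ge>no. norm (prob_dist M (X k) Y - 0) < e" by blast
  qed
  then have "tendsto_prob M X Y" by (simp add: tendsto_prob_iff_prob_dist)
  then show ?thesis by blast
qed

end

section \<open>Setwise convergence and integrals of nonnegative functions\<close>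

lemma integrable_indicator_times:
  fixes g :: "'a \<Rightarrow> real"
  assumes "integrable N g" "A \<in> sets N"
  shows "integrable N (\<lambda>x. indicator A x * g x)"
  using integrable_mult_indicator[OF assms(2,1)] by simp

lemma integral_split_tendsto:
  fixes g :: "'a \<Rightarrow> real"
  assumes g: "integrable N g" and E: "incseq E" "\<And>n. E n \<in> sets N" and full: "AE x in N. \<exists>n. x \<in> E n"
  shows "(\<lambda>n. LINT x|N. indicator (- E n) x * g x) \<longlonglongrightarrow> 0"
proof -
  have "(\<lambda>n. LINT x|N. indicator (- E n) x * g x) \<longlonglongrightarrow> (LINT x|N. 0)"
  proof (rule integral_dominated_convergence[where w="\<lambda>x. \<bar>g x\<bar>"])
    show "AE x in N. (\<lambda>n. indicator (- E n) x * g x) \<longlonglongrightarrow> 0"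
      using full
    proof eventually_elim
      case (elim x)
      then obtain n where "x \<in> E n" ..
      then have "x \<in> E m" if "n \<le> m" for m using that E(1) by (auto simp: incseq_def)
      then show ?case
        by (intro tendsto_eventually eventually_sequentiallyI[of n]) simp
    qed
    show "(\<lambda>x. indicator (- E n) x * g x) \<in> borel_measurable N" for n
      using g E(2)[of n] by (auto intro!: borel_measurable_times borel_measurable_indicator' simp: )
  qed (use g in \<open>auto split: split_indicator\<close>)
  then show ?thesis by simp
qed

lemma integral_indicator_mono:
  fixes g :: "'a \<Rightarrow> real"
  assumes g: "integrable N g" "\<And>x. 0 \<le> g x" and A: "A \<in> sets N" "A' \<in> sets N" "A \<subseteq> A'"
  shows "(LINT x|N. indicator A x * g x) \<le> (LINT x|N. indicator A' x * g x)"
  using assms by (intro integral_mono integrable_indicator_times) (auto split: split_indicator)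

text \<open>A gliding hump. If mass of \<open>g\<^sub>k\<close> escaped from an exhausting sequence \<open>E\<^sub>n\<close>, one could choose
  \<open>k\<^sub>1 < k\<^sub>2 < \<dots>\<close> and \<open>n\<^sub>1 < n\<^sub>2 < \<dots>\<close> such that \<open>g\<^bsub>k j\<^esub>\<close> has a fixed amount of mass on the shell
  between \<open>E\<^bsub>n (j-1)\<^esub>\<close> and \<open>E\<^bsub>n j\<^esub>\<close> and hardly any outside of it apart from a fixed core. On the
  union of every other shell the integrals would then oscillate.\<close>

lemma no_escaping_mass:
  fixes g :: "nat \<Rightarrow> 'a \<Rightarrow> real"
  assumes int: "\<And>k. integrable N (g k)" and nonneg: "\<And>k x. 0 \<le> g k x"
    and f: "integrable N f" "\<And>x. 0 \<le> f x"
    and E: "incseq E" "\<And>n. E n \<in> sets N" and full: "AE x in N. \<exists>n. x \<in> E n"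
    and conv: "\<And>A n. A \<in> sets N \<Longrightarrow> A \<subseteq> E n \<Longrightarrow> (\<lambda>k. LINT x|N. indicator A x * g k x) \<longlonglongrightarrow> (LINT x|N. indicator A x * f x)"
    and set_conv: "\<And>A. A \<in> sets N \<Longrightarrow> convergent (\<lambda>k. exp (- (LINT x|N. indicator A x * g k x)))"
    and "0 < e"
  shows "\<exists>n. \<forall>\<^sub>F k in sequentially. (LINT x|N. indicator (space N - E n) x * g k x) \<le> e"
proof (rule ccontr)
  define I where "I A k = (LINT x|N. indicator A x * g k x)" for A k
  assume neg: "\<not> ?thesis"
  have esc: "\<exists>k>m. I (space N - E n) k > e" for n m
  proof -
    have "\<not> (\<forall>\<^sub>F k in sequentially. I (space N - E n) k \<le> e)"
      using neg unfolding I_def by blast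
    then obtain k where "Suc m \<le> k" "\<not> I (space N - E n) k \<le> e"
      unfolding eventually_sequentially by blast
    then show ?thesis by (intro exI[of _ k]) auto
  qed
  define d where "d = e / 8"
  have d: "0 < d" using \<open>0 < e\<close> by (simp add: d_def)
  have tail: "(\<lambda>n. LINT x|N. indicator (space N - E n) x * h x) \<longlonglongrightarrow> 0" if "integrable N h" for h :: "'a \<Rightarrow> real"
  proof -
    have "(LINT x|N. indicator (space N - E n) x * h x) = (LINT x|N. indicator (- E n) x * h x)" for n
      by (intro Bochner_Integration.integral_cong) (auto split: split_indicator)
    then show ?thesis using integral_split_tendsto[OF that E full] by simp
  qed
  have Eset: "E n - E m \<in> sets N" "space N - E n \<in> sets N" for n m using E(2) by auto
  have I_mono: "I A k \<le> I A' k" if "A \<in> sets N" "A' \<in> sets N" "A \<subseteq> A'" for A A' k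
    unfolding I_def using that by (intro integral_indicator_mono int nonneg)
  have I_Un: "I (A \<union> A') k \<le> I A k + I A' k" if A: "A \<in> sets N" "A' \<in> sets N" for A A' k
  proof -
    have "I (A \<union> A') k \<le> (LINT x|N. indicator A x * g k x + indicator A' x * g k x)"
      unfolding I_def using A int nonneg
      by (intro integral_mono Bochner_Integration.integrable_add integrable_indicator_times)
        (auto split: split_indicator)
    also have "\<dots> = I A k + I A' k"
      unfolding I_def using A int
      by (intro Bochner_Integration.integral_add integrable_indicator_times) auto
    finally show ?thesis .
  qed
  obtain n0 where n0: "(LINT x|N. indicator (space N - E n0) x * f x) < d"
    using order_tendstoD(2)[OF tail[OF f(1)] d] by (auto simp: eventually_sequentially)
  define Good where "Good p p' \<longleftrightarrow> fst p < fst p' \<and> snd p < snd p' \<and>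
     I (space N - E (snd p)) (fst p') > e \<and> I (E (snd p) - E n0) (fst p') < 2 * d \<and> I (space N - E (snd p')) (fst p') < d"
    for p p' :: "nat \<times> nat"
  have step: "\<exists>p'. n0 \<le> snd p' \<and> Good p p'" if "n0 \<le> snd p" for p
  proof -
    obtain k n where p: "p = (k, n)" by (cases p)
    have "(LINT x|N. indicator (E n - E n0) x * f x) \<le> (LINT x|N. indicator (space N - E n0) x * f x)"
      using sets.sets_into_space[OF E(2)] by (intro integral_indicator_mono f Eset) auto
    with n0 d have "(LINT x|N. indicator (E n - E n0) x * f x) < 2 * d" by linarith
    from order_tendstoD(2)[OF conv[of "E n - E n0" n] this] Eset
    obtain m where m: "\<And>k. m \<le> k \<Longrightarrow> I (E n - E n0) k < 2 * d"
      by (auto simp: eventually_sequentially I_def)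
    obtain k' where k': "max m k < k'" "I (space N - E n) k' > e" using esc by blast
    from order_tendstoD(2)[OF tail[OF int[of k']] d]
    obtain n' where n': "\<And>i. n' \<le> i \<Longrightarrow> I (space N - E i) k' < d" by (auto simp: eventually_sequentially I_def)
    have "Good p (k', max n' (Suc n))"
      using k' m[of k'] n'[of "max n' (Suc n)"] by (auto simp: Good_def p)
    moreover have "n0 \<le> snd (k', max n' (Suc n))" using that by (simp add: p)
    ultimately show ?thesis by blast
  qed
  obtain q where q: "\<And>j. n0 \<le> snd (q j)" "\<And>j. Good (q j) (q (Suc j))"
    using dependent_nat_choice[of "\<lambda>_ p. n0 \<le> snd p" "\<lambda>_. Good"] step by (metis order_refl snd_conv)
  define k n where "k j = fst (q j)" and "n j = snd (q j)" for j
  have k: "strict_mono k" and n: "strict_mono n"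
    using q(2) by (auto simp: strict_mono_Suc_iff k_def n_def Good_def)
  have hump: "I (space N - E (n j)) (k (Suc j)) > e" "I (E (n j) - E n0) (k (Suc j)) < 2 * d"
      "I (space N - E (n (Suc j))) (k (Suc j)) < d" "n0 \<le> n j" for j
    using q[of j] by (auto simp: k_def n_def Good_def)
  have E_mono: "E i \<subseteq> E j" if "i \<le> j" for i j using E(1) that by (auto simp: incseq_def)
  \<comment> \<open>Only the shells that carry the humps of odd index.\<close>
  define A where "A = (\<Union>i. E (n (2 * i + 1)) - E (n (2 * i)))"
  have A: "A \<in> sets N" unfolding A_def using Eset by auto
  have high: "I A (k (2 * i + 1)) \<ge> 7 * d" for i
  proof -
    have "e < I (space N - E (n (2 * i))) (k (2 * i + 1))" using hump(1)[of "2 * i"] by simp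
    also have "\<dots> \<le> I ((E (n (2 * i + 1)) - E (n (2 * i))) \<union> (space N - E (n (2 * i + 1)))) (k (2 * i + 1))"
      using Eset by (intro I_mono) auto
    also have "\<dots> \<le> I (E (n (2 * i + 1)) - E (n (2 * i))) (k (2 * i + 1)) + I (space N - E (n (2 * i + 1))) (k (2 * i + 1))"
      by (intro I_Un Eset)
    also have "\<dots> \<le> I A (k (2 * i + 1)) + d"
      using hump(3)[of "2 * i"] A by (intro add_mono I_mono Eset) (auto simp: A_def)
    finally show ?thesis by (simp add: d_def)
  qed
  have low: "I A (k (2 * i + 2)) \<le> 3 * d" for i
  proof -
    have "A \<subseteq> (E (n (2 * i + 1)) - E n0) \<union> (space N - E (n (2 * i + 2)))"
    proof
      fix x assume "x \<in> A"
      then obtain j where j: "x \<in> E (n (2 * j + 1))" "x \<notin> E (n (2 * j))" by (auto simp: A_def)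
      have "x \<notin> E n0" using j(2) E_mono[OF hump(4)[of "2 * j"]] by auto
      moreover have "x \<in> space N" using j(1) sets.sets_into_space[OF E(2)] by auto
      moreover have "x \<in> E (n (2 * i + 1))" if "j \<le> i"
        using j(1) E_mono[of "n (2 * j + 1)" "n (2 * i + 1)"] that n by (auto simp: strict_mono_less_eq)
      moreover have "x \<notin> E (n (2 * i + 2))" if "i < j"
        using j(2) E_mono[of "n (2 * i + 2)" "n (2 * j)"] that n by (auto simp: strict_mono_less_eq)
      ultimately show "x \<in> (E (n (2 * i + 1)) - E n0) \<union> (space N - E (n (2 * i + 2)))"
        by (cases "j \<le> i") auto
    qed
    then have "I A (k (2 * i + 2)) \<le> I ((E (n (2 * i + 1)) - E n0) \<union> (space N - E (n (2 * i + 2)))) (k (2 * i + 2))"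
      using A Eset by (intro I_mono) auto
    also have "\<dots> \<le> I (E (n (2 * i + 1)) - E n0) (k (2 * i + 2)) + I (space N - E (n (2 * i + 2))) (k (2 * i + 2))"
      by (intro I_Un Eset)
    also have "\<dots> \<le> 2 * d + d"
      using hump(2)[of "2 * i + 1"] hump(3)[of "2 * i + 1"] by (intro add_mono) (auto simp: numeral_eq_Suc)
    finally show ?thesis by simp
  qed
  obtain l where l: "(\<lambda>k. exp (- I A k)) \<longlonglongrightarrow> l"
    using set_conv[OF A] unfolding convergent_def I_def by blast
  have "strict_mono (\<lambda>i. k (2 * i + 1))" "strict_mono (\<lambda>i. k (2 * i + 2))"
    using k by (auto simp: strict_mono_def)
  from this[THEN LIMSEQ_subseq_LIMSEQ[OF l]]
  have "(\<lambda>i. exp (- I A (k (2 * i + 1)))) \<longlonglongrightarrow> l" "(\<lambda>i. exp (- I A (k (2 * i + 2)))) \<longlonglongrightarrow> l"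
    by (simp_all add: o_def)
  then have odd: "(\<lambda>i. exp (- I A (k (2 * i + 1)))) \<longlonglongrightarrow> l" and even: "(\<lambda>i. exp (- I A (k (2 * i + 2)))) \<longlonglongrightarrow> l"
    by blast+
  have "l \<le> exp (- (7 * d))"
    by (rule LIMSEQ_le_const2[OF odd]) (use high in \<open>simp add: exI[of _ 0]\<close>)
  moreover have "exp (- (3 * d)) \<le> l"
    by (rule LIMSEQ_le_const[OF even]) (use low in \<open>simp add: exI[of _ 0]\<close>)
  ultimately have "exp (- (3 * d)) \<le> exp (- (7 * d))" by linarith
  then show False using d by simp
qed

text \<open>This is the step of the theorem of Vitali, Hahn and Saks that makes the stochastic integral
  independent of the approximating sequence.\<close>

theorem setwise_convergence_imp_integral_convergence:
  fixes g :: "nat \<Rightarrow> 'a::euclidean_space \<Rightarrow> real"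
  assumes int: "\<And>k. integrable lborel (g k)" and nonneg: "\<And>k x. 0 \<le> g k x"
    and f: "integrable lborel f" "\<And>x. 0 \<le> f x"
    and lim: "AE x in lborel. (\<lambda>k. g k x) \<longlonglongrightarrow> f x"
    and set_conv: "\<And>A. A \<in> sets borel \<Longrightarrow> convergent (\<lambda>k. exp (- (LINT x|lborel. indicator A x * g k x)))"
  shows "(\<lambda>k. LINT x|lborel. g k x) \<longlonglongrightarrow> (LINT x|lborel. f x)"
proof -
  \<comment> \<open>On subsets of \<open>E n\<close> the sequence is eventually dominated by \<open>f + 1\<close> on a ball.\<close>
  define E where "E n = {x. norm x \<le> real n \<and> (\<forall>k\<ge>n. g k x \<le> f x + 1)}" for n
  have [measurable]: "g k \<in> borel_measurable borel" "f \<in> borel_measurable borel" for k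
    using int[of k] f(1) by auto
  have E: "incseq E" "\<And>n. E n \<in> sets borel"
    unfolding E_def by (force simp: incseq_def, measurable)
  have full: "AE x in lborel. \<exists>n. x \<in> E n"
    using lim
  proof eventually_elim
    case (elim x)
    then have "\<forall>\<^sub>F k in sequentially. g k x < f x + 1" by (rule order_tendstoD) simp
    then obtain m where "\<And>k. m \<le> k \<Longrightarrow> g k x < f x + 1" by (auto simp: eventually_sequentially)
    moreover obtain m' where "norm x \<le> real m'" using real_arch_simple by blast
    ultimately have "x \<in> E (max m m')" by (auto simp: E_def less_imp_le)
    then show ?case ..
  qed
  have conv: "(\<lambda>k. LINT x|lborel. indicator A x * g k x) \<longlonglongrightarrow> (LINT x|lborel. indicator A x * f x)"
    if A: "A \<in> sets borel" "A \<subseteq> E n" for A n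
  proof -
    have "(\<lambda>k. LINT x|lborel. indicator A x * g (k + n) x) \<longlonglongrightarrow> (LINT x|lborel. indicator A x * f x)"
    proof (rule integral_dominated_convergence[where w="\<lambda>x. f x + indicator (cball 0 (real n)) x"])
      have "integrable lborel (indicator (cball 0 (real n)) :: 'a \<Rightarrow> real)"
        using emeasure_bounded_finite[of "cball (0::'a) (real n)"] by (simp add: integrable_indicator_iff)
      then show "integrable lborel (\<lambda>x. f x + indicator (cball 0 (real n)) x)" using f by simp
      show "AE x in lborel. (\<lambda>k. indicator A x * g (k + n) x) \<longlonglongrightarrow> indicator A x * f x"
        using lim by eventually_elim (intro tendsto_intros LIMSEQ_ignore_initial_segment)
      show "AE x in lborel. norm (indicator A x * g (k + n) x) \<le> f x + indicator (cball 0 (real n)) x" for k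
        using A nonneg f(2) by (intro AE_I2) (auto simp: E_def split: split_indicator)
    qed (use A in auto)
    then show ?thesis by (rule LIMSEQ_offset)
  qed
  show ?thesis
  proof (rule LIMSEQ_I)
    fix e :: real assume "0 < e"
    then have e: "0 < e / 4" by simp
    have "\<exists>n. \<forall>\<^sub>F k in sequentially. (LINT x|lborel. indicator (space lborel - E n) x * g k x) \<le> e / 4"
      by (rule no_escaping_mass[OF int nonneg f E(1) _ full]) (use E conv set_conv e in auto)
    then obtain n1 where n1: "\<forall>\<^sub>F k in sequentially. (LINT x|lborel. indicator (- E n1) x * g k x) \<le> e / 4"
      by (auto simp: Compl_eq_Diff_UNIV)
    obtain n2 where n2: "(LINT x|lborel. indicator (- E n2) x * f x) < e / 4"
      using order_tendstoD(2)[OF integral_split_tendsto[OF f(1) E(1) _ full] e] E(2) by (auto simp: eventually_sequentially)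
    define F where "F = E (max n1 n2)"
    have F: "F \<in> sets borel" "- F \<subseteq> - E n1" "- F \<subseteq> - E n2"
      using E unfolding F_def incseq_def by (auto dest!: spec)
    have split: "(LINT x|lborel. h x) = (LINT x|lborel. indicator F x * h x) + (LINT x|lborel. indicator (- F) x * h x)"
      if "integrable lborel h" for h :: "'a \<Rightarrow> real"
    proof -
      have "(LINT x|lborel. h x) = (LINT x|lborel. indicator F x * h x + indicator (- F) x * h x)"
        by (intro Bochner_Integration.integral_cong) (auto split: split_indicator)
      also have "\<dots> = (LINT x|lborel. indicator F x * h x) + (LINT x|lborel. indicator (- F) x * h x)"
        using that F(1) integrable_indicator_times[of lborel h F] integrable_indicator_times[of lborel h "- F"]
        by (intro Bochner_Integration.integral_add) auto
      finally show ?thesis .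
    qed
    have nn: "0 \<le> (LINT x|lborel. indicator (- F) x * g k x)" "0 \<le> (LINT x|lborel. indicator (- F) x * f x)" for k
      using nonneg f by auto
    have fF: "(LINT x|lborel. indicator (- F) x * f x) < e / 4"
      using integral_indicator_mono[of lborel f "- F" "- E n2"] f F E n2 by fastforce
    have "\<forall>\<^sub>F k in sequentially. \<bar>(LINT x|lborel. indicator F x * g k x) - (LINT x|lborel. indicator F x * f x)\<bar> < e / 4"
      using tendstoD[OF conv[of F "max n1 n2"] e] F by (simp add: F_def dist_real_def)
    then have "\<forall>\<^sub>F k in sequentially. norm ((LINT x|lborel. g k x) - (LINT x|lborel. f x)) < e"
      using n1
    proof eventually_elim
      case (elim k)
      have "(LINT x|lborel. indicator (- F) x * g k x) \<le> e / 4"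
        using integral_indicator_mono[of lborel "g k" "- F" "- E n1"] int nonneg F E elim(2) by fastforce
      then show ?case
        using elim(1) fF nn(1)[of k] nn(2) split[OF int[of k]] split[OF f(1)] \<open>0 < e\<close> unfolding real_norm_def by linarith
    qed
    then show "\<exists>no. \<forall>k\<ge>no. norm ((LINT x|lborel. g k x) - (LINT x|lborel. f x)) < e"
      by (simp add: eventually_sequentially)
  qed
qed

section \<open>Integrals of simple functions\<close>

(* Sums over a fixed index set are easier to combine than sums over the indices of the sets containing s. *)
declare sum_indicator_scaleR [simp del]

lemma finite_borel_setsD [dest]: "A \<in> finite_borel_sets \<Longrightarrow> A \<in> sets borel"
  and finite_borel_sets_finite: "A \<in> finite_borel_sets \<Longrightarrow> emeasure lborel A < \<infinity>"
  by (auto simp: finite_borel_sets_def)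

lemma empty_in_finite_borel_sets [simp]: "{} \<in> finite_borel_sets"
  by (simp add: finite_borel_sets_def)

lemma finite_borel_sets_subset:
  "A \<in> finite_borel_sets \<Longrightarrow> A' \<subseteq> A \<Longrightarrow> A' \<in> sets borel \<Longrightarrow> A' \<in> finite_borel_sets"
  using emeasure_mono[of A' A lborel] by (auto simp: finite_borel_sets_def)

lemma finite_borel_sets_Un:
  "A \<in> finite_borel_sets \<Longrightarrow> A' \<in> finite_borel_sets \<Longrightarrow> A \<union> A' \<in> finite_borel_sets"
  using emeasure_subadditive[of A lborel A'] by (auto simp: finite_borel_sets_def elim!: le_less_trans)

lemma finite_borel_sets_UN:
  "finite I \<Longrightarrow> (\<And>i. i \<in> I \<Longrightarrow> A i \<in> finite_borel_sets) \<Longrightarrow> (\<Union>i\<in>I. A i) \<in> finite_borel_sets"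
  by (induction I rule: finite_induct) (auto intro: finite_borel_sets_Un)

lemma mos_ISRM_prob_space: "mos_ISRM P B \<sigma> M \<Longrightarrow> prob_space P"
  and mos_ISRM_measurable: "mos_ISRM P B \<sigma> M \<Longrightarrow> A \<in> finite_borel_sets \<Longrightarrow> M A \<in> borel_measurable P"
  by (auto simp: mos_ISRM_def)

lemma mos_ISRM_sums:
  assumes "mos_ISRM P B \<sigma> M" "range A \<subseteq> finite_borel_sets" "disjoint_family A" "(\<Union>i. A i) \<in> finite_borel_sets"
  shows "AE \<omega> in P. (\<lambda>i. M (A i) \<omega>) sums M (\<Union>i. A i) \<omega>"
  using assms by (auto simp: mos_ISRM_def)

lemma mos_ISRM_char:
  assumes "mos_ISRM P B \<sigma> M" "A \<in> finite_borel_sets"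
  shows "(CLINT \<omega>|P. iexp (v \<bullet> M A \<omega>)) = exp (complex_of_real (LINT s:A|lborel. psi \<sigma> (B s) v))"
  using assms by (auto simp: mos_ISRM_def)

text \<open>Countable additivity for the constant sequence \<open>{}\<close>: a constant series converges only if its terms vanish.\<close>

lemma mos_ISRM_empty:
  assumes "mos_ISRM P B \<sigma> M"
  shows "AE \<omega> in P. M {} \<omega> = 0"
proof -
  have "AE \<omega> in P. (\<lambda>i::nat. M {} \<omega>) sums M (\<Union>i::nat. {}) \<omega>"
    by (rule mos_ISRM_sums[OF assms]) (auto simp: disjoint_family_on_def)
  then show ?thesis
  proof eventually_elim
    case (elim \<omega>)
    then have "(\<lambda>i::nat. M {} \<omega>) \<longlonglongrightarrow> 0" by (intro summable_LIMSEQ_zero) (rule sums_summable)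
    then show ?case by (simp add: LIMSEQ_const_iff)
  qed
qed

lemma mos_ISRM_Un:
  assumes M: "mos_ISRM P B \<sigma> M" and A: "A \<in> finite_borel_sets" "A' \<in> finite_borel_sets" "A \<inter> A' = {}"
  shows "AE \<omega> in P. M (A \<union> A') \<omega> = M A \<omega> + M A' \<omega>"
proof -
  define S where "S i = (if i = 0 then A else if i = 1 then A' else {})" for i :: nat
  have U: "(\<Union>i. S i) = A \<union> A'"
    by (auto simp: S_def split: if_splits)
  have "AE \<omega> in P. (\<lambda>i. M (S i) \<omega>) sums M (\<Union>i. S i) \<omega>"
    using A by (intro mos_ISRM_sums[OF M])
      (auto simp: U finite_borel_sets_Un, auto simp: disjoint_family_on_def S_def)
  with mos_ISRM_empty[OF M] show ?thesis
  proof eventually_elim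
    case (elim \<omega>)
    have "(\<lambda>i. M (S i) \<omega>) sums (\<Sum>i\<in>{0, 1}. M (S i) \<omega>)"
      by (rule sums_finite) (use elim in \<open>auto simp: S_def\<close>)
    with elim(2) have "M (\<Union>i. S i) \<omega> = (\<Sum>i\<in>{0, 1}. M (S i) \<omega>)" by (rule sums_unique2)
    then show ?case unfolding U by (simp add: S_def)
  qed
qed

lemma mos_ISRM_finite_UN:
  assumes M: "mos_ISRM P B \<sigma> M" and "finite I" "\<And>i. i \<in> I \<Longrightarrow> A i \<in> finite_borel_sets" "disjoint_family_on A I"
  shows "AE \<omega> in P. M (\<Union>i\<in>I. A i) \<omega> = (\<Sum>i\<in>I. M (A i) \<omega>)"
  using assms(2-)
proof (induction I rule: finite_induct)
  case empty
  then show ?case using mos_ISRM_empty[OF M] by simp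
next
  case (insert i I)
  have "AE \<omega> in P. M (A i \<union> (\<Union>i\<in>I. A i)) \<omega> = M (A i) \<omega> + M (\<Union>i\<in>I. A i) \<omega>"
    using insert.prems insert.hyps
    by (intro mos_ISRM_Un[OF M] finite_borel_sets_UN) (fastforce simp: disjoint_family_on_def)+
  moreover have "AE \<omega> in P. M (\<Union>i\<in>I. A i) \<omega> = (\<Sum>i\<in>I. M (A i) \<omega>)"
    using insert.prems by (intro insert.IH) (auto simp: disjoint_family_on_def)
  ultimately show ?case
    by eventually_elim (use insert.hyps in auto)
qed

text \<open>All almost sure identities between integrals of simple functions come from this one: on the
  atoms of the algebra generated by the \<open>A i\<close> the coefficients cancel.\<close>

lemma mos_ISRM_linear_relation:
  fixes R :: "'i \<Rightarrow> real^'m^'m"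
  assumes M: "mos_ISRM P B \<sigma> M" and I: "finite I" "\<And>i. i \<in> I \<Longrightarrow> A i \<in> finite_borel_sets"
    and zero: "\<And>s. (\<Sum>i\<in>I. indicat_real (A i) s *\<^sub>R R i) = 0"
  shows "AE \<omega> in P. (\<Sum>i\<in>I. R i *v M (A i) \<omega>) = 0"
proof -
  define T where "T J = (\<Inter>i\<in>J. A i) - (\<Union>i\<in>I - J. A i)" for J
  have T_iff: "s \<in> T J \<longleftrightarrow> (\<forall>i\<in>I. s \<in> A i \<longleftrightarrow> i \<in> J)" if "J \<subseteq> I" for J s
    using that by (auto simp: T_def)
  have T: "T J \<in> finite_borel_sets" if "J \<subseteq> I" "i \<in> J" for J i
  proof (rule finite_borel_sets_subset)
    show "A i \<in> finite_borel_sets" using I(2) that by auto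
    have "finite J" using that I(1) finite_subset by blast
    then show "T J \<in> sets borel"
      unfolding T_def using I that by (intro sets.Diff sets.finite_INT sets.finite_UN) auto
  qed (use that in \<open>auto simp: T_def\<close>)
  have A_eq: "A i = (\<Union>J\<in>{J\<in>Pow I. i \<in> J}. T J)" if "i \<in> I" for i
  proof (intro equalityI subsetI)
    fix s assume "s \<in> A i"
    then have "s \<in> T {j\<in>I. s \<in> A j}" "{j\<in>I. s \<in> A j} \<in> {J\<in>Pow I. i \<in> J}"
      using that by (auto simp: T_iff)
    then show "s \<in> (\<Union>J\<in>{J\<in>Pow I. i \<in> J}. T J)" by blast
  qed (auto simp: T_def)
  have "AE \<omega> in P. \<forall>i\<in>I. M (A i) \<omega> = (\<Sum>J\<in>{J\<in>Pow I. i \<in> J}. M (T J) \<omega>)"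
  proof (intro AE_finite_allI I(1))
    fix i assume i: "i \<in> I"
    have "AE \<omega> in P. M (\<Union>J\<in>{J\<in>Pow I. i \<in> J}. T J) \<omega> = (\<Sum>J\<in>{J\<in>Pow I. i \<in> J}. M (T J) \<omega>)"
    proof (rule mos_ISRM_finite_UN[OF M])
      show "disjoint_family_on T {J\<in>Pow I. i \<in> J}"
        unfolding disjoint_family_on_def
      proof (intro ballI impI equals0I)
        fix J K s assume *: "J \<in> {J\<in>Pow I. i \<in> J}" "K \<in> {J\<in>Pow I. i \<in> J}" "J \<noteq> K" "s \<in> T J \<inter> T K"
        then have "\<forall>i\<in>I. i \<in> J \<longleftrightarrow> i \<in> K" using T_iff[of J s] T_iff[of K s] by auto
        with * show False by blast
      qed
    qed (use I(1) T in auto)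
    then show "AE \<omega> in P. M (A i) \<omega> = (\<Sum>J\<in>{J\<in>Pow I. i \<in> J}. M (T J) \<omega>)"
      by (simp only: A_eq[OF i, symmetric])
  qed
  with mos_ISRM_empty[OF M] show ?thesis
  proof eventually_elim
    case (elim \<omega>)
    have "(\<Sum>i\<in>I. R i *v M (A i) \<omega>) = (\<Sum>i\<in>I. \<Sum>J\<in>{J\<in>Pow I. i \<in> J}. R i *v M (T J) \<omega>)"
      using elim(2) by (simp add: linear_sum[OF matrix_vector_mul_linear] o_def)
    also have "\<dots> = (\<Sum>J\<in>Pow I. \<Sum>i\<in>{i\<in>I. i \<in> J}. R i *v M (T J) \<omega>)"
      using I(1) by (intro sum.swap_restrict) auto
    also have "\<dots> = 0"
    proof (rule sum.neutral, rule ballI)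
      fix J assume J: "J \<in> Pow I"
      then have fin: "finite J" using I(1) finite_subset by blast
      have eq: "{i\<in>I. i \<in> J} = J" using J by auto
      show "(\<Sum>i\<in>{i\<in>I. i \<in> J}. R i *v M (T J) \<omega>) = 0"
      proof (cases "T J = {}")
        case True
        then show ?thesis using elim(1) by simp
      next
        case False
        then obtain s where "s \<in> T J" by auto
        then have "(\<Sum>i\<in>I. indicat_real (A i) s *\<^sub>R R i) = (\<Sum>i\<in>I. if i \<in> J then R i else 0)"
          using J by (intro sum.cong) (auto simp: T_iff)
        also have "\<dots> = (\<Sum>i\<in>J. R i)"
          using I(1) J by (simp add: sum.If_cases Int_absorb1 Int_commute)
        finally have "(\<Sum>i\<in>J. R i) = 0" using zero by simp
        moreover have "(\<Sum>i\<in>J. R i *v x) = (\<Sum>i\<in>J. R i) *v x" for x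
          using fin by (induction J rule: finite_induct) (auto simp: matrix_vector_mult_add_rdistrib)
        ultimately show ?thesis by (simp add: eq)
      qed
    qed
    finally show ?case .
  qed
qed

text \<open>This description needs no disjoint representation, so closure under sums and products with matrices and
  indicators is immediate from it.\<close>

lemma is_simple_iff:
  "is_simple f \<longleftrightarrow> f \<in> borel_measurable borel \<and> finite (range f) \<and> {s. f s \<noteq> 0} \<in> finite_borel_sets"
proof
  assume "is_simple f"
  then obtain k R A where "simple_rep f k R A"
    unfolding is_simple_def by blast
  then have A: "\<And>j. j < k \<Longrightarrow> A j \<in> finite_borel_sets"
    and f: "f = (\<lambda>s. \<Sum>j<k. indicat_real (A j) s *\<^sub>R R j)"
    by (auto simp: simple_rep_def)
  have meas: "f \<in> borel_measurable borel"
    unfolding f using A by (intro borel_measurable_sum borel_measurable_scaleR borel_measurable_indicator) auto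
  have "f s = (\<Sum>j\<in>{j. j < k \<and> s \<in> A j}. R j)" for s
    unfolding f by (rule sum.mono_neutral_cong_right) auto
  then have "range f \<subseteq> (\<lambda>J. \<Sum>j\<in>J. R j) ` Pow {..<k}"
    by (auto intro!: image_eqI)
  then have "finite (range f)" by (rule finite_subset) simp
  moreover have "{s. f s \<noteq> 0} \<in> finite_borel_sets"
  proof (rule finite_borel_sets_subset)
    show "(\<Union>j\<in>{..<k}. A j) \<in> finite_borel_sets" using A by (intro finite_borel_sets_UN) auto
    show "{s. f s \<noteq> 0} \<subseteq> (\<Union>j\<in>{..<k}. A j)"
    proof (rule subsetI, rule ccontr)
      fix s assume "s \<in> {s. f s \<noteq> 0}" "s \<notin> (\<Union>j\<in>{..<k}. A j)"
      moreover then have "f s = 0" unfolding f by (intro sum.neutral) auto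
      ultimately show False by simp
    qed
    show "{s. f s \<noteq> 0} \<in> sets borel" using meas by measurable
  qed
  ultimately show "f \<in> borel_measurable borel \<and> finite (range f) \<and> {s. f s \<noteq> 0} \<in> finite_borel_sets"
    using meas by simp
next
  assume f: "f \<in> borel_measurable borel \<and> finite (range f) \<and> {s. f s \<noteq> 0} \<in> finite_borel_sets"
  define V where "V = range f - {0}"
  have "finite V" using f by (simp add: V_def)
  then obtain h where h: "bij_betw h {0..<card V} V" using ex_bij_betw_nat_finite by blast
  define A where "A j = f -` {h j}" for j
  have A: "A j \<in> finite_borel_sets" if "j < card V" for j
  proof (rule finite_borel_sets_subset)
    show "{s. f s \<noteq> 0} \<in> finite_borel_sets" using f by simp
    have "h j \<in> V" using h that by (auto simp: bij_betw_def)
    then show "A j \<subseteq> {s. f s \<noteq> 0}" by (auto simp: A_def V_def)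
    show "A j \<in> sets borel"
      unfolding A_def using f measurable_sets[of f borel borel "{h j}"] by simp
  qed
  have "f s = (\<Sum>j<card V. indicat_real (A j) s *\<^sub>R h j)" for s
  proof (cases "f s = 0")
    case True
    have "h j \<noteq> 0" if "j < card V" for j
      using h that by (auto simp: bij_betw_def V_def)
    then have "(\<Sum>j<card V. indicat_real (A j) s *\<^sub>R h j) = 0"
      using True by (intro sum.neutral) (auto simp: A_def indicator_def)
    then show ?thesis using True by simp
  next
    case False
    then have "f s \<in> V" by (simp add: V_def)
    then obtain i where i: "i < card V" "h i = f s"
      using h by (force simp: bij_betw_def)
    have "indicat_real (A j) s *\<^sub>R h j = (if j = i then h i else 0)" if "j < card V" for j
      using h that i by (auto simp: A_def indicator_def bij_betw_def inj_on_def)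
    then have "(\<Sum>j<card V. indicat_real (A j) s *\<^sub>R h j) = (\<Sum>j<card V. if j = i then h i else 0)"
      by (intro sum.cong) auto
    then show ?thesis using i by simp
  qed
  moreover have "disjoint_family_on A {..<card V}"
    using h by (auto simp: disjoint_family_on_def A_def bij_betw_def inj_on_def)
  ultimately have "simple_rep f (card V) h A"
    using A by (auto simp: simple_rep_def)
  then show "is_simple f" unfolding is_simple_def by blast
qed

lemma simple_integral_rep:
  assumes "is_simple f"
  obtains k R A where "simple_rep f k R A" "simple_integral M f = (\<lambda>\<omega>. \<Sum>j<k. R j *v M (A j) \<omega>)"
proof -
  have "\<exists>X. \<exists>k R A. simple_rep f k R A \<and> X = (\<lambda>\<omega>. \<Sum>j<k. R j *v M (A j) \<omega>)"
    using assms by (auto simp: is_simple_def)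
  from someI_ex[OF this] that show ?thesis
    unfolding simple_integral_def by blast
qed

lemma borel_measurable_simple_integral:
  assumes M: "mos_ISRM P B \<sigma> M" and "is_simple f"
  shows "simple_integral M f \<in> borel_measurable P"
proof -
  obtain k R A where rep: "simple_rep f k R A" "simple_integral M f = (\<lambda>\<omega>. \<Sum>j<k. R j *v M (A j) \<omega>)"
    using simple_integral_rep[OF assms(2)] .
  then show ?thesis
    using mos_ISRM_measurable[OF M]
    by (auto simp: simple_rep_def intro!: borel_measurable_sum borel_measurable_matrix_vector_mult)
qed

text \<open>The family on the right may overlap, and may have repeated or zero coefficients. The proof compares it with the chosen
  disjoint representation through one linear relation.\<close>

lemma simple_integral_AE_eq:
  fixes R :: "'i \<Rightarrow> real^'m^'m"
  assumes M: "mos_ISRM P B \<sigma> M" and f: "is_simple f"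
    and I: "finite I" "\<And>i. i \<in> I \<Longrightarrow> A i \<in> finite_borel_sets"
    and eq: "\<And>s. f s = (\<Sum>i\<in>I. indicat_real (A i) s *\<^sub>R R i)"
  shows "AE \<omega> in P. simple_integral M f \<omega> = (\<Sum>i\<in>I. R i *v M (A i) \<omega>)"
proof -
  obtain k S T where rep: "simple_rep f k S T" "simple_integral M f = (\<lambda>\<omega>. \<Sum>j<k. S j *v M (T j) \<omega>)"
    using simple_integral_rep[OF f] .
  have "AE \<omega> in P. (\<Sum>x\<in>I <+> {..<k}. case_sum R (\<lambda>j. - S j) x *v M (case_sum A T x) \<omega>) = 0"
  proof (rule mos_ISRM_linear_relation[OF M])
    fix s
    have "f s = (\<Sum>j<k. indicat_real (T j) s *\<^sub>R S j)" using rep(1) by (simp add: simple_rep_def)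
    then show "(\<Sum>x\<in>I <+> {..<k}. indicat_real (case_sum A T x) s *\<^sub>R case_sum R (\<lambda>j. - S j) x) = 0"
      using I(1) eq[of s] by (simp add: sum.Plus sum_negf)
  qed (use I rep(1) in \<open>auto simp: simple_rep_def\<close>)
  then show ?thesis
    by eventually_elim
      (use I(1) in \<open>simp add: sum.Plus rep(2) sum_negf matrix_vector_mult.minus_left\<close>)
qed

lemma borel_measurable_matrix_mult_left [measurable (raw)]:
  fixes C :: "real^'n^'k" and f :: "'a \<Rightarrow> real^'m^'n"
  assumes "f \<in> borel_measurable M"
  shows "(\<lambda>s. C ** f s) \<in> borel_measurable M"
proof -
  have "continuous_on UNIV (\<lambda>X::real^'m^'n. C ** X)"
    by (rule bounded_linear.continuous_on[OF matrix_mult.bounded_linear_right continuous_on_id])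
  then show ?thesis by (intro measurable_compose[OF assms] borel_measurable_continuous_onI)
qed

lemma is_simple_linear:
  fixes C D :: "real^'m^'m"
  assumes f: "is_simple f" and g: "is_simple g"
  shows "is_simple (\<lambda>s. C ** f s + D ** g s)"
proof -
  have [measurable]: "f \<in> borel_measurable borel" "g \<in> borel_measurable borel" using f g by (auto simp: is_simple_iff)
  have "{s. C ** f s + D ** g s \<noteq> 0} \<in> finite_borel_sets"
  proof (rule finite_borel_sets_subset)
    show "{s. f s \<noteq> 0} \<union> {s. g s \<noteq> 0} \<in> finite_borel_sets"
      using f g by (intro finite_borel_sets_Un) (auto simp: is_simple_iff)
  qed auto
  moreover have "range (\<lambda>s. C ** f s + D ** g s) \<subseteq> (\<lambda>(x, y). C ** x + D ** y) ` (range f \<times> range g)" by auto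
  then have "finite (range (\<lambda>s. C ** f s + D ** g s))"
    by (rule finite_subset) (use f g in \<open>auto simp: is_simple_iff\<close>)
  ultimately show ?thesis by (simp add: is_simple_iff)
qed

lemma is_simple_indicator:
  assumes f: "is_simple f" and A: "A \<in> sets borel"
  shows "is_simple (\<lambda>s. indicat_real A s *\<^sub>R f s)"
proof -
  have meas: "(\<lambda>s. indicat_real A s *\<^sub>R f s) \<in> borel_measurable borel"
    using f A by (auto simp: is_simple_iff)
  have "{s. indicat_real A s *\<^sub>R f s \<noteq> 0} \<in> finite_borel_sets"
  proof (rule finite_borel_sets_subset)
    show "{s. f s \<noteq> 0} \<in> finite_borel_sets" using f by (simp add: is_simple_iff)
    show "{s. indicat_real A s *\<^sub>R f s \<noteq> 0} \<in> sets borel" using meas by measurable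
  qed auto
  moreover have "range (\<lambda>s. indicat_real A s *\<^sub>R f s) \<subseteq> insert 0 (range f)"
    by (auto simp: indicator_def)
  then have "finite (range (\<lambda>s. indicat_real A s *\<^sub>R f s))"
    by (rule finite_subset) (use f in \<open>auto simp: is_simple_iff\<close>)
  ultimately show ?thesis using meas by (auto simp: is_simple_iff)
qed

lemma is_simple_indicator_const:
  "A \<in> finite_borel_sets \<Longrightarrow> is_simple (\<lambda>s. indicat_real A s *\<^sub>R R)"
proof -
  assume A: "A \<in> finite_borel_sets"
  have "simple_rep (\<lambda>s. indicat_real A s *\<^sub>R R) 1 (\<lambda>_. R) (\<lambda>_. A)"
    using A by (auto simp: simple_rep_def disjoint_family_on_def)
  then show ?thesis unfolding is_simple_def by blast
qed

lemma simple_integral_linear: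
  assumes M: "mos_ISRM P B \<sigma> M" and f: "is_simple f" and g: "is_simple g"
  shows "AE \<omega> in P. simple_integral M (\<lambda>s. C ** f s + D ** g s) \<omega> =
    C *v simple_integral M f \<omega> + D *v simple_integral M g \<omega>"
proof -
  obtain k R A where 1: "simple_rep f k R A" "simple_integral M f = (\<lambda>\<omega>. \<Sum>j<k. R j *v M (A j) \<omega>)"
    using simple_integral_rep[OF f] .
  obtain l S T where 2: "simple_rep g l S T" "simple_integral M g = (\<lambda>\<omega>. \<Sum>j<l. S j *v M (T j) \<omega>)"
    using simple_integral_rep[OF g] .
  let ?R = "case_sum (\<lambda>j. C ** R j) (\<lambda>j. D ** S j)"
  have "AE \<omega> in P. simple_integral M (\<lambda>s. C ** f s + D ** g s) \<omega> =
      (\<Sum>x\<in>{..<k} <+> {..<l}. ?R x *v M (case_sum A T x) \<omega>)"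
  proof (rule simple_integral_AE_eq[OF M is_simple_linear[OF f g]])
    fix s
    have "f s = (\<Sum>j<k. indicat_real (A j) s *\<^sub>R R j)" "g s = (\<Sum>j<l. indicat_real (T j) s *\<^sub>R S j)"
      using 1(1) 2(1) by (simp_all add: simple_rep_def)
    then show "C ** f s + D ** g s = (\<Sum>x\<in>{..<k} <+> {..<l}. indicat_real (case_sum A T x) s *\<^sub>R ?R x)"
      by (simp add: sum.Plus matrix_mult.sum_right matrix_mult.scaleR_right)
  qed (use 1(1) 2(1) in \<open>auto simp: simple_rep_def\<close>)
  then show ?thesis
    by (simp add: sum.Plus 1(2) 2(2) matrix_vector_mult.sum_right matrix_vector_mul_assoc)
qed

lemma simple_integral_indicator_mat_1:
  assumes M: "mos_ISRM P B \<sigma> M" and A: "A \<in> finite_borel_sets"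
  shows "AE \<omega> in P. simple_integral M (\<lambda>s. indicat_real A s *\<^sub>R mat 1) \<omega> = M A \<omega>"
  using simple_integral_AE_eq[OF M is_simple_indicator_const[OF A, of "mat 1"], where I="{()}" and A="\<lambda>_. A" and R="\<lambda>_. mat 1"] A
  by simp

definition exponent_between :: "real \<Rightarrow> real \<Rightarrow> (real^'d \<Rightarrow> real^'m^'m) \<Rightarrow> bool" where
  "exponent_between l c B \<longleftrightarrow> B \<in> borel_measurable borel \<and> (\<forall>s. form_between l c (B s)) \<and> 1 / 2 < l \<and> 1 / 2 < c"

text \<open>The integrand of the log-characteristic function of \<open>\<integral> f dM\<close> at \<open>v\<close>.\<close>

definition int_exponent :: "(real^'m) measure \<Rightarrow> (real^'d \<Rightarrow> real^'m^'m) \<Rightarrow> (real^'d \<Rightarrow> real^'m^'m) \<Rightarrow> real^'m \<Rightarrow> real^'d \<Rightarrow> real" where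
  "int_exponent \<sigma> B f v s = psi \<sigma> (B s) (transpose (f s) *v v)"

lemma borel_measurable_transpose [measurable]: "transpose \<in> borel_measurable (borel :: (real^'m^'n) measure)"
proof (rule borel_measurable_continuous_onI)
  show "continuous_on UNIV (transpose :: real^'m^'n \<Rightarrow> real^'n^'m)"
    unfolding transpose_def by (intro continuous_intros)
qed

lemma borel_measurable_int_exponent:
  assumes \<sigma>: "spectral_measure \<sigma>" and B: "exponent_between l c B" and [measurable]: "f \<in> borel_measurable borel"
  shows "int_exponent \<sigma> B f v \<in> borel_measurable borel"
proof -
  have "B \<in> borel_measurable borel" using B by (simp add: exponent_between_def)
  moreover have "(\<lambda>s. transpose (f s) *v v) \<in> borel_measurable borel" by measurable
  ultimately show ?thesis
    unfolding int_exponent_def[abs_def] by (rule borel_measurable_psi[OF \<sigma>])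
qed

lemma int_exponent_nonpos: "spectral_measure \<sigma> \<Longrightarrow> int_exponent \<sigma> B f v s \<le> 0"
  by (simp add: int_exponent_def psi_nonpos)

lemma integrable_psi_const:
  assumes \<sigma>: "spectral_measure \<sigma>" and B: "exponent_between l c B" and A: "A \<in> finite_borel_sets"
  shows "integrable lborel (\<lambda>s. indicat_real A s * psi \<sigma> (B s) v)"
proof (rule Bochner_Integration.integrable_bound)
  have Bm: "B \<in> borel_measurable borel" and l: "1 / 2 < l" "1 / 2 < c" and form: "\<And>s. form_between l c (B s)"
    using B by (simp_all add: exponent_between_def)
  let ?K = "psi_const \<sigma> l c * (norm v powr (1 / l) + norm v powr (1 / c))"
  show "integrable lborel (\<lambda>s. indicat_real A s * ?K)"
    using A finite_borel_sets_finite[OF A] by (intro integrable_mult_left integrable_real_indicator) auto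
  show "(\<lambda>s. indicat_real A s * psi \<sigma> (B s) v) \<in> borel_measurable lborel"
    using A borel_measurable_psi[OF \<sigma> Bm, of "\<lambda>_. v"] by (auto intro!: borel_measurable_times)
  show "AE s in lborel. norm (indicat_real A s * psi \<sigma> (B s) v) \<le> norm (indicat_real A s * ?K)"
  proof (intro AE_I2)
    fix s
    have "0 \<le> ?K" by (intro mult_nonneg_nonneg psi_const_nonneg l add_nonneg_nonneg) auto
    then show "norm (indicat_real A s * psi \<sigma> (B s) v) \<le> norm (indicat_real A s * ?K)"
      using psi_bound[OF \<sigma> form l, of s v] psi_nonpos[OF \<sigma>, of "B s" v]
      unfolding real_norm_def abs_mult[of "indicat_real A s"] by (intro mult_left_mono abs_ge_zero) linarith
  qed
qed

lemma int_exponent_simple: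
  assumes rep: "simple_rep f k R A"
  shows "int_exponent \<sigma> B f v s = (\<Sum>j<k. indicat_real (A j) s * psi \<sigma> (B s) (transpose (R j) *v v))"
proof (cases "\<exists>i<k. s \<in> A i")
  case True
  then obtain i where i: "i < k" "s \<in> A i" by blast
  have ind: "indicat_real (A j) s = (if j = i then 1 else 0)" if "j < k" for j
    using rep i that by (cases "j = i") (fastforce simp: simple_rep_def disjoint_family_on_def indicator_def)+
  have "f s = (\<Sum>j<k. indicat_real (A j) s *\<^sub>R R j)"
    using rep by (simp add: simple_rep_def)
  also have "\<dots> = (\<Sum>j<k. if j = i then R i else 0)"
    by (intro sum.cong) (auto simp: ind)
  finally have "f s = (\<Sum>j<k. if j = i then R i else 0)" .
  then have "f s = R i" using i by simp
  moreover have "(\<Sum>j<k. indicat_real (A j) s * psi \<sigma> (B s) (transpose (R j) *v v)) =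
      (\<Sum>j<k. if j = i then psi \<sigma> (B s) (transpose (R i) *v v) else 0)"
    using ind by (intro sum.cong) auto
  ultimately show ?thesis using i by (simp add: int_exponent_def)
next
  case False
  then have "f s = 0" using rep by (auto simp: simple_rep_def intro!: sum.neutral)
  moreover have "transpose (0 :: real^'b^'b) = 0" by (simp add: transpose_def vec_eq_iff)
  ultimately show ?thesis using False by (auto simp: int_exponent_def intro!: sum.neutral)
qed

lemma integrable_int_exponent_simple:
  assumes \<sigma>: "spectral_measure \<sigma>" and B: "exponent_between l c B" and f: "is_simple f"
  shows "integrable lborel (int_exponent \<sigma> B f v)"
proof -
  obtain k R A where rep: "simple_rep f k R A" using f by (auto simp: is_simple_def)
  then have "integrable lborel (\<lambda>s. \<Sum>j<k. indicat_real (A j) s * psi \<sigma> (B s) (transpose (R j) *v v))"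
    by (intro Bochner_Integration.integrable_sum integrable_psi_const[OF \<sigma> B]) (auto simp: simple_rep_def)
  then show ?thesis by (simp add: int_exponent_simple[OF rep] cong: Bochner_Integration.integrable_cong)
qed

text \<open>The summands of a disjoint representation are independent. Empty sets may occur several times in it; they are
  discarded, since independence is available only for families of distinct sets.\<close>

lemma char_simple_integral:
  assumes \<sigma>: "spectral_measure \<sigma>" and B: "exponent_between l c B" and M: "mos_ISRM P B \<sigma> M" and f: "is_simple f"
  shows "(CLINT \<omega>|P. iexp (v \<bullet> simple_integral M f \<omega>)) = exp (complex_of_real (LINT s|lborel. int_exponent \<sigma> B f v s))"
proof -
  interpret prob_space P by (rule mos_ISRM_prob_space[OF M])
  obtain k R A where rep: "simple_rep f k R A" and int: "simple_integral M f = (\<lambda>\<omega>. \<Sum>j<k. R j *v M (A j) \<omega>)"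
    using simple_integral_rep[OF f] .
  define J where "J = {j\<in>{..<k}. A j \<noteq> {}}"
  have A: "A j \<in> finite_borel_sets" if "j \<in> J" for j using rep that by (auto simp: J_def simple_rep_def)
  have J: "finite J" by (simp add: J_def)
  have disj: "disjoint_family_on A J"
    using rep by (auto simp: simple_rep_def J_def disjoint_family_on_def)
  have inj: "inj_on A J"
    using disj by (auto simp: inj_on_def disjoint_family_on_def J_def)
  let ?w = "\<lambda>S. transpose (R (the_inv_into J A S)) *v v"
  have w: "?w (A j) = transpose (R j) *v v" if "j \<in> J" for j
    using the_inv_into_f_f[OF inj that] by simp
  have "disjoint (A ` J)" using disjoint_family_on_disjoint_image[OF disj] .
  then have "indep_vars (\<lambda>_. borel) M (A ` J)"
    using M A unfolding mos_ISRM_def by blast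
  then have indep: "indep_vars (\<lambda>_. borel) (\<lambda>S \<omega>. iexp (?w S \<bullet> M S \<omega>)) (A ` J)"
    by (rule indep_vars_compose2[where Y="\<lambda>S x. iexp (?w S \<bullet> x)"]) measurable
  have meas: "M (A j) \<in> borel_measurable P" if "j \<in> J" for j using mos_ISRM_measurable[OF M A[OF that]] .
  have "AE \<omega> in P. iexp (v \<bullet> simple_integral M f \<omega>) = (\<Prod>S\<in>A ` J. iexp (?w S \<bullet> M S \<omega>))"
    using mos_ISRM_empty[OF M]
  proof eventually_elim
    case (elim \<omega>)
    have "v \<bullet> simple_integral M f \<omega> = (\<Sum>j<k. v \<bullet> (R j *v M (A j) \<omega>))"
      by (simp add: int inner_sum_right)
    also have "\<dots> = (\<Sum>j\<in>J. v \<bullet> (R j *v M (A j) \<omega>))"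
      by (rule sum.mono_neutral_right) (auto simp: J_def elim)
    also have "\<dots> = (\<Sum>j\<in>J. (transpose (R j) *v v) \<bullet> M (A j) \<omega>)"
      by (simp add: dot_lmul_matrix transpose_matrix_vector)
    finally have "iexp (v \<bullet> simple_integral M f \<omega>) = (\<Prod>j\<in>J. iexp ((transpose (R j) *v v) \<bullet> M (A j) \<omega>))"
      using J by (simp add: exp_sum sum_distrib_left)
    also have "\<dots> = (\<Prod>S\<in>A ` J. iexp (?w S \<bullet> M S \<omega>))"
      using inj w by (simp add: prod.reindex)
    finally show ?case .
  qed
  then have "(CLINT \<omega>|P. iexp (v \<bullet> simple_integral M f \<omega>)) = (CLINT \<omega>|P. \<Prod>S\<in>A ` J. iexp (?w S \<bullet> M S \<omega>))"
    using borel_measurable_simple_integral[OF M f] meas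
    by (intro integral_cong_AE borel_measurable_prod) auto
  also have "\<dots> = (\<Prod>S\<in>A ` J. (CLINT \<omega>|P. iexp (?w S \<bullet> M S \<omega>)))"
    by (rule indep_vars_lebesgue_integral[OF _ indep])
      (use J meas in \<open>auto intro!: integrable_const_bound[where B=1]\<close>)
  also have "\<dots> = (\<Prod>S\<in>A ` J. exp (complex_of_real (LINT s:S|lborel. psi \<sigma> (B s) (?w S))))"
    using A by (intro prod.cong refl mos_ISRM_char[OF M]) auto
  also have "\<dots> = exp (complex_of_real (\<Sum>S\<in>A ` J. (LINT s:S|lborel. psi \<sigma> (B s) (?w S))))"
    using J by (simp add: exp_sum)
  also have "(\<Sum>S\<in>A ` J. (LINT s:S|lborel. psi \<sigma> (B s) (?w S))) =
      (\<Sum>j\<in>J. (LINT s|lborel. indicat_real (A j) s * psi \<sigma> (B s) (transpose (R j) *v v)))"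
    using inj w by (simp add: sum.reindex set_lebesgue_integral_def)
  also have "\<dots> = (\<Sum>j<k. (LINT s|lborel. indicat_real (A j) s * psi \<sigma> (B s) (transpose (R j) *v v)))"
    by (rule sum.mono_neutral_left) (auto simp: J_def)
  also have "\<dots> = (LINT s|lborel. (\<Sum>j<k. indicat_real (A j) s * psi \<sigma> (B s) (transpose (R j) *v v)))"
    using rep by (intro Bochner_Integration.integral_sum[symmetric] integrable_psi_const[OF \<sigma> B]) (auto simp: simple_rep_def)
  also have "\<dots> = (LINT s|lborel. int_exponent \<sigma> B f v s)"
    by (simp add: int_exponent_simple[OF rep])
  finally show ?thesis .
qed

section \<open>The integral of a matrix-valued function\<close>

text \<open>With \<open>1/l = b\<close> and \<open>1/c = a\<close> this is the function \<open>x\<^sup>b + x\<^sup>a\<close> that defines the class of integrands.\<close>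

definition modular :: "real \<Rightarrow> real \<Rightarrow> real \<Rightarrow> real" where
  "modular l c x = x powr (1 / l) + x powr (1 / c)"

lemma modular_nonneg: "0 \<le> modular l c x"
  by (simp add: modular_def)

lemma modular_0 [simp]: "modular l c 0 = 0"
  by (simp add: modular_def)

lemma modular_mono: "0 < l \<Longrightarrow> 0 < c \<Longrightarrow> 0 \<le> x \<Longrightarrow> x \<le> y \<Longrightarrow> modular l c x \<le> modular l c y"
  by (simp add: modular_def add_mono powr_mono2)

lemma modular_scale:
  assumes "0 \<le> K" "0 \<le> x"
  shows "modular l c (K * x) \<le> modular l c K * modular l c x"
proof -
  have "0 \<le> K powr (1 / l) * x powr (1 / c)" "0 \<le> K powr (1 / c) * x powr (1 / l)" by simp_all
  then show ?thesis using assms by (simp add: modular_def powr_mult algebra_simps)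
qed

lemma modular_add:
  assumes "0 < l" "0 < c" "0 \<le> x" "0 \<le> y"
  shows "modular l c (x + y) \<le> modular l c 2 * (modular l c x + modular l c y)"
proof -
  have "modular l c (x + y) \<le> modular l c (2 * max x y)"
    using assms by (intro modular_mono) auto
  also have "\<dots> \<le> modular l c 2 * modular l c (max x y)"
    using assms by (intro modular_scale) auto
  also have "\<dots> \<le> modular l c 2 * (modular l c x + modular l c y)"
    using modular_nonneg by (intro mult_left_mono) (auto simp: max_def)
  finally show ?thesis .
qed

lemma borel_measurable_modular [measurable]: "modular l c \<in> borel_measurable borel"
  unfolding modular_def[abs_def] by measurable

text \<open>The norm is the Euclidean norm of the entries, in place of the equivalent operator norm.\<close>

definition modular_integrable :: "real \<Rightarrow> real \<Rightarrow> (real^'d \<Rightarrow> real^'m^'m) \<Rightarrow> bool" where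
  "modular_integrable l c f \<longleftrightarrow> f \<in> borel_measurable borel \<and> integrable lborel (\<lambda>s. modular l c (norm (f s)))"

lemma modular_integrable_linear:
  fixes f g :: "real^'d \<Rightarrow> real^'m^'m"
  assumes l: "0 < l" "0 < c" and f: "modular_integrable l c f" and g: "modular_integrable l c g"
  shows "modular_integrable l c (\<lambda>s. C ** f s + D ** g s)"
proof -
  have [measurable]: "f \<in> borel_measurable borel" "g \<in> borel_measurable borel"
    using f g by (auto simp: modular_integrable_def)
  obtain K where K: "0 \<le> K" "\<And>(A :: real^'m^'m) (X :: real^'m^'m). norm (A ** X) \<le> norm A * norm X * K"
    using matrix_mult.nonneg_bounded by blast
  let ?b = "\<lambda>s. modular l c 2 * (modular l c (norm C * K) * modular l c (norm (f s)) + modular l c (norm D * K) * modular l c (norm (g s)))"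
  have mult: "modular l c (norm (A ** X)) \<le> modular l c (norm A * K) * modular l c (norm X)" for A X :: "real^'m^'m"
  proof -
    have "modular l c (norm (A ** X)) \<le> modular l c ((norm A * K) * norm X)"
      using l K(2)[of A X] by (intro modular_mono) (auto simp: mult_ac)
    also have "\<dots> \<le> modular l c (norm A * K) * modular l c (norm X)"
      using K(1) by (intro modular_scale) auto
    finally show ?thesis .
  qed
  have "integrable lborel (\<lambda>s. modular l c (norm (C ** f s + D ** g s)))"
  proof (rule Bochner_Integration.integrable_bound)
    show "integrable lborel ?b" using f g by (auto simp: modular_integrable_def)
    show "AE s in lborel. norm (modular l c (norm (C ** f s + D ** g s))) \<le> norm (?b s)"
    proof (intro AE_I2)
      fix s
      have "modular l c (norm (C ** f s + D ** g s)) \<le> modular l c (norm (C ** f s) + norm (D ** g s))"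
        using l by (intro modular_mono norm_triangle_ineq) auto
      also have "\<dots> \<le> modular l c 2 * (modular l c (norm (C ** f s)) + modular l c (norm (D ** g s)))"
        using l by (intro modular_add) auto
      also have "\<dots> \<le> ?b s"
        by (intro mult_left_mono add_mono mult modular_nonneg)
      finally show "norm (modular l c (norm (C ** f s + D ** g s))) \<le> norm (?b s)"
        by (simp add: modular_nonneg)
    qed
  qed measurable
  then show ?thesis by (simp add: modular_integrable_def)
qed

lemma norm_transpose_mult_bound:
  obtains K where "0 \<le> K" "\<And>(A :: real^'m^'m) v. norm (transpose A *v v) \<le> K * norm A * norm v"
proof -
  obtain K1 where K1: "0 \<le> K1" "\<And>(A :: real^'m^'m) v. norm (A *v v) \<le> norm A * norm v * K1"
    using matrix_vector_mult.nonneg_bounded by blast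
  have "bounded_linear (transpose :: real^'m^'m \<Rightarrow> real^'m^'m)"
    unfolding linear_conv_bounded_linear[symmetric]
    by (auto intro!: linearI simp: transpose_def vec_eq_iff)
  then obtain K2 where K2: "0 \<le> K2" "\<And>A :: real^'m^'m. norm (transpose A) \<le> norm A * K2"
    using bounded_linear.nonneg_bounded by blast
  have "norm (transpose A *v v) \<le> (K2 * K1) * norm A * norm v" for A :: "real^'m^'m" and v
  proof -
    have "norm (transpose A *v v) \<le> norm (transpose A) * norm v * K1" by (rule K1)
    also have "\<dots> \<le> (norm A * K2) * norm v * K1" by (intro mult_right_mono K2 K1) auto
    finally show ?thesis by (simp add: mult_ac)
  qed
  then show ?thesis using that[of "K2 * K1"] K1(1) K2(1) by simp
qed

lemma int_exponent_bound:
  fixes B :: "real^'d \<Rightarrow> real^'m^'m"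
  assumes \<sigma>: "spectral_measure \<sigma>" and B: "exponent_between l c B"
  obtains C where "0 \<le> C" "\<And>(f :: real^'d \<Rightarrow> real^'m^'m) s. \<bar>int_exponent \<sigma> B f v s\<bar> \<le> C * modular l c (norm (f s))"
proof -
  have l: "1 / 2 < l" "1 / 2 < c" and form: "\<And>s. form_between l c (B s)"
    using B by (simp_all add: exponent_between_def)
  obtain K where K: "0 \<le> K" "\<And>(A :: real^'m^'m) v. norm (transpose A *v v) \<le> K * norm A * norm v"
    using norm_transpose_mult_bound by blast
  have "\<bar>int_exponent \<sigma> B f v s\<bar> \<le> psi_const \<sigma> l c * modular l c (K * norm v) * modular l c (norm (f s))"
    for f :: "real^'d \<Rightarrow> real^'m^'m" and s
  proof -
    have "\<bar>int_exponent \<sigma> B f v s\<bar> \<le> psi_const \<sigma> l c * modular l c (norm (transpose (f s) *v v))"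
      using psi_bound[OF \<sigma> form l, of s] psi_nonpos[OF \<sigma>, of "B s"] by (simp add: int_exponent_def modular_def)
    also have "\<dots> \<le> psi_const \<sigma> l c * (modular l c (K * norm v) * modular l c (norm (f s)))"
    proof (intro mult_left_mono psi_const_nonneg l)
      have "modular l c (norm (transpose (f s) *v v)) \<le> modular l c ((K * norm v) * norm (f s))"
        using K(2)[of "f s" v] l by (intro modular_mono) (auto simp: mult_ac)
      also have "\<dots> \<le> modular l c (K * norm v) * modular l c (norm (f s))"
        using K(1) by (intro modular_scale) auto
      finally show "modular l c (norm (transpose (f s) *v v)) \<le> modular l c (K * norm v) * modular l c (norm (f s))" .
    qed
    finally show ?thesis by simp
  qed
  then show ?thesis
    using that[of "psi_const \<sigma> l c * modular l c (K * norm v)"] psi_const_nonneg[OF l, of \<sigma>] modular_nonneg by simp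
qed

lemma integrable_int_exponent:
  assumes \<sigma>: "spectral_measure \<sigma>" and B: "exponent_between l c B" and f: "modular_integrable l c f"
  shows "integrable lborel (int_exponent \<sigma> B f v)"
proof -
  obtain C where C: "0 \<le> C" "\<And>f s. \<bar>int_exponent \<sigma> B f v s\<bar> \<le> C * modular l c (norm (f s))"
    using int_exponent_bound[OF \<sigma> B, of v] by blast
  show ?thesis
  proof (rule Bochner_Integration.integrable_bound)
    show "integrable lborel (\<lambda>s. C * modular l c (norm (f s)))" using f by (simp add: modular_integrable_def)
    show "int_exponent \<sigma> B f v \<in> borel_measurable lborel"
      using borel_measurable_int_exponent[OF \<sigma> B] f by (simp add: modular_integrable_def)
  qed (use C in \<open>auto intro: order_trans[OF _ abs_ge_self]\<close>)
qed

lemma int_exponent_tendsto: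
  assumes \<sigma>: "spectral_measure \<sigma>" and B: "exponent_between l c B" and lim: "(\<lambda>k. F k s) \<longlonglongrightarrow> f s"
  shows "(\<lambda>k. int_exponent \<sigma> B (F k) v s) \<longlonglongrightarrow> int_exponent \<sigma> B f v s"
  unfolding int_exponent_def
proof (rule tendsto_psi[OF \<sigma>])
  show "(\<lambda>k. transpose (F k s) *v v) \<longlonglongrightarrow> transpose (f s) *v v"
    unfolding transpose_def
    by (intro matrix_vector_mult.tendsto tendsto_intros)
      (auto intro!: vec_tendstoI tendsto_vec_nth lim)
qed (use B in \<open>auto simp: exponent_between_def\<close>)

lemma int_exponent_indicator:
  "int_exponent \<sigma> B (\<lambda>s. indicat_real A s *\<^sub>R f s) v s = indicat_real A s * int_exponent \<sigma> B f v s"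
proof -
  have "transpose (0 :: real^'b^'b) = 0" by (simp add: transpose_def vec_eq_iff)
  then show ?thesis by (auto simp: int_exponent_def split: split_indicator)
qed

lemma has_isrm_integral_linear:
  fixes f g :: "real^'d \<Rightarrow> real^'m^'m"
  assumes M: "mos_ISRM P B \<sigma> M" and f: "has_isrm_integral P M f X" and g: "has_isrm_integral P M g Y"
  shows "has_isrm_integral P M (\<lambda>s. C ** f s + D ** g s) (\<lambda>\<omega>. C *v X \<omega> + D *v Y \<omega>)"
proof -
  interpret prob_space P by (rule mos_ISRM_prob_space[OF M])
  obtain F where F: "\<And>k. is_simple (F k)" "AE s in lborel. (\<lambda>k. F k s) \<longlonglongrightarrow> f s"
    "\<And>A. A \<in> sets borel \<Longrightarrow> \<exists>Y. tendsto_prob P (\<lambda>k. simple_integral M (\<lambda>s. indicat_real A s *\<^sub>R F k s)) Y"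
    "tendsto_prob P (\<lambda>k. simple_integral M (F k)) X" and [measurable]: "f \<in> borel_measurable borel"
    using f unfolding has_isrm_integral_def by blast
  obtain G where G: "\<And>k. is_simple (G k)" "AE s in lborel. (\<lambda>k. G k s) \<longlonglongrightarrow> g s"
    "\<And>A. A \<in> sets borel \<Longrightarrow> \<exists>Y. tendsto_prob P (\<lambda>k. simple_integral M (\<lambda>s. indicat_real A s *\<^sub>R G k s)) Y"
    "tendsto_prob P (\<lambda>k. simple_integral M (G k)) Y" and [measurable]: "g \<in> borel_measurable borel"
    using g unfolding has_isrm_integral_def by blast
  have lin: "tendsto_prob P (\<lambda>k. simple_integral M (\<lambda>s. C ** F' k s + D ** G' k s)) (\<lambda>\<omega>. C *v X' \<omega> + D *v Y' \<omega>)"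
    if F': "\<And>k. is_simple (F' k)" "tendsto_prob P (\<lambda>k. simple_integral M (F' k)) X'"
      and G': "\<And>k. is_simple (G' k)" "tendsto_prob P (\<lambda>k. simple_integral M (G' k)) Y'" for F' G' X' Y'
  proof (rule tendsto_prob_AE_cong)
    show lim: "tendsto_prob P (\<lambda>k \<omega>. C *v simple_integral M (F' k) \<omega> + D *v simple_integral M (G' k) \<omega>)
        (\<lambda>\<omega>. C *v X' \<omega> + D *v Y' \<omega>)"
      by (intro tendsto_prob_add tendsto_prob_bounded_linear[OF matrix_vector_mult.bounded_linear_right F'(2)]
        tendsto_prob_bounded_linear[OF matrix_vector_mult.bounded_linear_right G'(2)])
    then show "(\<lambda>\<omega>. C *v X' \<omega> + D *v Y' \<omega>) \<in> borel_measurable P" by (simp add: tendsto_prob_def)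
    show "AE \<omega> in P. C *v simple_integral M (F' k) \<omega> + D *v simple_integral M (G' k) \<omega> =
        simple_integral M (\<lambda>s. C ** F' k s + D ** G' k s) \<omega>" for k
      using simple_integral_linear[OF M F'(1)[of k] G'(1)[of k], of C D] by eventually_elim simp
  qed (auto intro!: borel_measurable_simple_integral[OF M] is_simple_linear F' G')
  show ?thesis
    unfolding has_isrm_integral_def
  proof (intro conjI exI[of _ "\<lambda>k s. C ** F k s + D ** G k s"] allI ballI)
    show "(\<lambda>s. C ** f s + D ** g s) \<in> borel_measurable borel" by measurable
    show "is_simple (\<lambda>s. C ** F k s + D ** G k s)" for k by (intro is_simple_linear F G)
    show "AE s in lborel. (\<lambda>k. C ** F k s + D ** G k s) \<longlonglongrightarrow> C ** f s + D ** g s"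
      using F(2) G(2) by eventually_elim (intro tendsto_add matrix_mult.tendsto tendsto_const)
    show "tendsto_prob P (\<lambda>k. simple_integral M (\<lambda>s. C ** F k s + D ** G k s)) (\<lambda>\<omega>. C *v X \<omega> + D *v Y \<omega>)"
      by (intro lin F G)
    fix A :: "(real^'d) set" assume A: "A \<in> sets borel"
    obtain X' Y' where "tendsto_prob P (\<lambda>k. simple_integral M (\<lambda>s. indicat_real A s *\<^sub>R F k s)) X'"
      "tendsto_prob P (\<lambda>k. simple_integral M (\<lambda>s. indicat_real A s *\<^sub>R G k s)) Y'"
      using F(3)[OF A] G(3)[OF A] by blast
    then have "tendsto_prob P (\<lambda>k. simple_integral M (\<lambda>s. C ** (indicat_real A s *\<^sub>R F k s) + D ** (indicat_real A s *\<^sub>R G k s)))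
        (\<lambda>\<omega>. C *v X' \<omega> + D *v Y' \<omega>)"
      by (intro lin is_simple_indicator F G A)
    then show "\<exists>Y. tendsto_prob P (\<lambda>k. simple_integral M (\<lambda>s. indicat_real A s *\<^sub>R (C ** F k s + D ** G k s))) Y"
      by (auto simp: scaleR_add_right matrix_mult.scaleR_right)
  qed
qed

text \<open>The integral is a limit along some sequence of simple functions about which only almost everywhere convergence
  and convergence of all \<open>\<integral>\<^sub>A F\<^sub>k dM\<close> are known. The latter says that, for every \<open>A\<close>, the
  exponentials of the integrals of the nonpositive functions \<open>int_exponent F\<^sub>k\<close> over \<open>A\<close> converge, which is enough to
  pass to the limit.\<close>

lemma char_isrm_integral:
  fixes f :: "real^'d \<Rightarrow> real^'m^'m"
  assumes \<sigma>: "spectral_measure \<sigma>" and B: "exponent_between l c B" and M: "mos_ISRM P B \<sigma> M"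
    and f: "modular_integrable l c f" and X: "has_isrm_integral P M f X"
  shows "(CLINT \<omega>|P. iexp (v \<bullet> X \<omega>)) = exp (complex_of_real (LINT s|lborel. int_exponent \<sigma> B f v s))"
proof -
  interpret prob_space P by (rule mos_ISRM_prob_space[OF M])
  obtain F where F: "\<And>k. is_simple (F k)" "AE s in lborel. (\<lambda>k. F k s) \<longlonglongrightarrow> f s"
    "\<And>A. A \<in> sets borel \<Longrightarrow> \<exists>Y. tendsto_prob P (\<lambda>k. simple_integral M (\<lambda>s. indicat_real A s *\<^sub>R F k s)) Y"
    "tendsto_prob P (\<lambda>k. simple_integral M (F k)) X"
    using X unfolding has_isrm_integral_def by blast
  have "(\<lambda>k. LINT s|lborel. - int_exponent \<sigma> B (F k) v s) \<longlonglongrightarrow> (LINT s|lborel. - int_exponent \<sigma> B f v s)"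
  proof (rule setwise_convergence_imp_integral_convergence)
    show "integrable lborel (\<lambda>s. - int_exponent \<sigma> B (F k) v s)" for k
      using integrable_int_exponent_simple[OF \<sigma> B F(1)] by simp
    show "integrable lborel (\<lambda>s. - int_exponent \<sigma> B f v s)"
      using integrable_int_exponent[OF \<sigma> B f] by simp
    show "AE s in lborel. (\<lambda>k. - int_exponent \<sigma> B (F k) v s) \<longlonglongrightarrow> - int_exponent \<sigma> B f v s"
      using F(2) by eventually_elim (intro tendsto_minus int_exponent_tendsto[OF \<sigma> B])
    fix A :: "(real^'d) set" assume A: "A \<in> sets borel"
    let ?I = "\<lambda>k. LINT s|lborel. indicat_real A s * int_exponent \<sigma> B (F k) v s"
    obtain Y where Y: "tendsto_prob P (\<lambda>k. simple_integral M (\<lambda>s. indicat_real A s *\<^sub>R F k s)) Y"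
      using F(3)[OF A] by blast
    have "(\<lambda>k. exp (complex_of_real (?I k))) \<longlonglongrightarrow> (CLINT \<omega>|P. iexp (v \<bullet> Y \<omega>))"
      using tendsto_prob_imp_char_tendsto[OF Y, of v]
      unfolding char_simple_integral[OF \<sigma> B M is_simple_indicator[OF F(1) A]] int_exponent_indicator .
    from tendsto_Re[OF this] have "convergent (\<lambda>k. exp (?I k))"
      by (auto simp: convergent_def Re_exp)
    then show "convergent (\<lambda>k. exp (- (LINT s|lborel. indicat_real A s * - int_exponent \<sigma> B (F k) v s)))"
      by simp
  qed (use int_exponent_nonpos[OF \<sigma>] in auto)
  then have "(\<lambda>k. LINT s|lborel. int_exponent \<sigma> B (F k) v s) \<longlonglongrightarrow> (LINT s|lborel. int_exponent \<sigma> B f v s)"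
    by (simp add: tendsto_minus_cancel_left)
  then have "(\<lambda>k. exp (complex_of_real (LINT s|lborel. int_exponent \<sigma> B (F k) v s))) \<longlonglongrightarrow>
      exp (complex_of_real (LINT s|lborel. int_exponent \<sigma> B f v s))"
    by (intro tendsto_intros)
  moreover have "(\<lambda>k. exp (complex_of_real (LINT s|lborel. int_exponent \<sigma> B (F k) v s))) \<longlonglongrightarrow> (CLINT \<omega>|P. iexp (v \<bullet> X \<omega>))"
    using tendsto_prob_imp_char_tendsto[OF F(4), of v] unfolding char_simple_integral[OF \<sigma> B M F(1)] .
  ultimately show ?thesis by (rule LIMSEQ_unique[symmetric])
qed

text \<open>Cutting off outside of balls gives the approximations supports of finite measure.\<close>

lemma simple_approximation:
  fixes f :: "real^'d \<Rightarrow> real^'m^'m"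
  assumes f: "f \<in> borel_measurable borel"
  obtains F where "\<And>k. is_simple (F k)" "\<And>s. (\<lambda>k. F k s) \<longlonglongrightarrow> f s" "\<And>k s. norm (F k s) \<le> 2 * norm (f s)"
proof -
  obtain G where G: "\<And>i. simple_function borel (G i)" "\<And>x. (\<lambda>i. G i x) \<longlonglongrightarrow> f x" "\<And>i x. dist (G i x) 0 \<le> 2 * dist (f x) 0"
    using borel_measurable_implies_sequence_metric[OF f, of 0] by auto
  define F where "F k s = indicat_real (cball 0 (real k)) s *\<^sub>R G k s" for k s
  have "is_simple (F k)" for k
    unfolding is_simple_iff
  proof (intro conjI)
    have [measurable]: "G k \<in> borel_measurable borel" using G(1) borel_measurable_simple_function by blast
    show m: "F k \<in> borel_measurable borel"
      unfolding F_def[abs_def] by (intro borel_measurable_scaleR borel_measurable_indicator) auto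
    have "finite (range (G k))" using simple_functionD(1)[OF G(1)[of k]] by simp
    moreover have "range (F k) \<subseteq> insert 0 (range (G k))" by (auto simp: F_def indicator_def)
    ultimately show "finite (range (F k))" by (meson finite_insert finite_subset)
    show "{s. F k s \<noteq> 0} \<in> finite_borel_sets"
    proof (rule finite_borel_sets_subset)
      show "cball 0 (real k) \<in> finite_borel_sets"
        using emeasure_bounded_finite[of "cball 0 (real k)"] by (simp add: finite_borel_sets_def)
      show "{s. F k s \<noteq> 0} \<in> sets borel" using m by measurable
    qed (auto simp: F_def indicator_def split: if_splits)
  qed
  moreover have "(\<lambda>k. F k s) \<longlonglongrightarrow> f s" for s
  proof -
    obtain N where N: "norm s \<le> real N" using real_arch_simple by blast
    have "\<forall>\<^sub>F k in sequentially. G k s = F k s"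
      using N by (intro eventually_sequentiallyI[of N]) (auto simp: F_def)
    from Lim_transform_eventually[OF G(2) this] show ?thesis .
  qed
  moreover have "norm (F k s) \<le> 2 * norm (f s)" for k s
    using G(3)[of k s] by (auto simp: F_def split: split_indicator)
  ultimately show ?thesis using that by blast
qed

lemma simple_integral_diff:
  assumes M: "mos_ISRM P B \<sigma> M" and f: "is_simple f" and g: "is_simple g"
  shows "is_simple (\<lambda>s. f s - g s)"
    and "AE \<omega> in P. simple_integral M (\<lambda>s. f s - g s) \<omega> = simple_integral M f \<omega> - simple_integral M g \<omega>"
  using is_simple_linear[OF f g, of "mat 1" "- mat 1"] simple_integral_linear[OF M f g, of "mat 1" "- mat 1"]
  by (simp_all add: matrix_mult.minus_left matrix_vector_mult.minus_left)

text \<open>For a dominated approximation \<open>F\<^sub>k\<close> the exponents of \<open>1\<^sub>A (F\<^sub>k - F\<^sub>l)\<close> tend to \<open>0\<close> in \<open>L\<^sup>1\<close>, so the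
  characteristic functions of the differences tend to \<open>1\<close> and the integrals over \<open>A\<close> are Cauchy in probability.\<close>

lemma isrm_integral_exists:
  fixes f :: "real^'d \<Rightarrow> real^'m^'m"
  assumes \<sigma>: "spectral_measure \<sigma>" and B: "exponent_between l c B" and M: "mos_ISRM P B \<sigma> M"
    and f: "modular_integrable l c f"
  shows "\<exists>X. has_isrm_integral P M f X"
proof -
  interpret prob_space P by (rule mos_ISRM_prob_space[OF M])
  have l: "0 < l" "0 < c" using B by (auto simp: exponent_between_def)
  have fm: "f \<in> borel_measurable borel" using f by (simp add: modular_integrable_def)
  obtain F where F: "\<And>k. is_simple (F k)" "\<And>s. (\<lambda>k. F k s) \<longlonglongrightarrow> f s" "\<And>k s. norm (F k s) \<le> 2 * norm (f s)"
    using simple_approximation[OF fm] by blast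
  have conv: "\<exists>Y. tendsto_prob P (\<lambda>k. simple_integral M (\<lambda>s. indicat_real A s *\<^sub>R F k s)) Y"
    if A: "A \<in> sets borel" for A
  proof (rule Cauchy_imp_tendsto_prob)
    let ?X = "\<lambda>k. simple_integral M (\<lambda>s. indicat_real A s *\<^sub>R F k s)"
    have simple: "is_simple (\<lambda>s. indicat_real A s *\<^sub>R F k s)" for k by (rule is_simple_indicator[OF F(1) A])
    show X: "?X k \<in> borel_measurable P" for k
      by (rule borel_measurable_simple_integral[OF M simple])
    fix e :: real assume "0 < e"
    show "\<exists>N. \<forall>k\<ge>N. \<forall>l\<ge>N. prob_dist P (?X k) (?X l) < e"
    proof (rule ccontr)
      assume "\<not> ?thesis"
      then have "\<forall>N. \<exists>p. N \<le> fst p \<and> N \<le> snd p \<and> e \<le> prob_dist P (?X (fst p)) (?X (snd p))"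
        by (force simp: not_less)
      from choice[OF this] obtain p where p: "\<And>N. N \<le> fst (p N) \<and> N \<le> snd (p N) \<and> e \<le> prob_dist P (?X (fst (p N))) (?X (snd (p N)))"
        by blast
      define k j where "k N = fst (p N)" and "j N = snd (p N)" for N
      have kj: "N \<le> k N" "N \<le> j N" "e \<le> prob_dist P (?X (k N)) (?X (j N))" for N
        using p[of N] by (simp_all add: k_def j_def)
      have lim: "filterlim k at_top sequentially" "filterlim j at_top sequentially"
        using kj(1,2) by (auto intro: filterlim_at_top_mono[OF filterlim_ident])
      define H where "H N s = indicat_real A s *\<^sub>R F (k N) s - indicat_real A s *\<^sub>R F (j N) s" for N s
      have H: "is_simple (H N)" and Hdiff: "AE \<omega> in P. simple_integral M (H N) \<omega> = ?X (k N) \<omega> - ?X (j N) \<omega>" for N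
        unfolding H_def using simple_integral_diff[OF M simple simple] by auto
      have H0: "(\<lambda>N. H N s) \<longlonglongrightarrow> 0" for s
      proof -
        have "(\<lambda>N. H N s) \<longlonglongrightarrow> indicat_real A s *\<^sub>R f s - indicat_real A s *\<^sub>R f s"
          unfolding H_def using filterlim_compose[OF F(2) lim(1)] filterlim_compose[OF F(2) lim(2)]
          by (intro tendsto_intros)
        then show ?thesis by simp
      qed
      have Hle: "norm (H N s) \<le> 4 * norm (f s)" for N s
        using norm_triangle_ineq4[of "F (k N) s" "F (j N) s"] F(3)[of "k N" s] F(3)[of "j N" s]
        by (auto simp: H_def split: split_indicator)
      have "(\<lambda>N. CLINT \<omega>|P. iexp (v \<bullet> simple_integral M (H N) \<omega>)) \<longlonglongrightarrow> 1" for v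
      proof -
        obtain C where C: "0 \<le> C" "\<And>f s. \<bar>int_exponent \<sigma> B f v s\<bar> \<le> C * modular l c (norm (f s))"
          using int_exponent_bound[OF \<sigma> B, of v] by blast
        have "(\<lambda>N. LINT s|lborel. int_exponent \<sigma> B (H N) v s) \<longlonglongrightarrow> (LINT s|lborel. int_exponent \<sigma> B (\<lambda>_. 0) v (s::real^'d))"
        proof (rule integral_dominated_convergence[where w="\<lambda>s. C * (modular l c 4 * modular l c (norm (f s)))"])
          show "int_exponent \<sigma> B (\<lambda>_. 0) v \<in> borel_measurable lborel"
            using borel_measurable_int_exponent[OF \<sigma> B, of "\<lambda>_. 0"] by simp
          show "int_exponent \<sigma> B (H N) v \<in> borel_measurable lborel" for N
            using borel_measurable_int_exponent[OF \<sigma> B, of "H N"] H[of N] by (simp add: is_simple_iff)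
          show "integrable lborel (\<lambda>s. C * (modular l c 4 * modular l c (norm (f s))))"
            using f by (simp add: modular_integrable_def)
          show "AE s in lborel. (\<lambda>N. int_exponent \<sigma> B (H N) v s) \<longlonglongrightarrow> int_exponent \<sigma> B (\<lambda>_. 0) v s"
            by (intro AE_I2 int_exponent_tendsto[OF \<sigma> B] H0)
          show "AE s in lborel. norm (int_exponent \<sigma> B (H N) v s) \<le> C * (modular l c 4 * modular l c (norm (f s)))" for N
          proof (intro AE_I2)
            fix s
            have "norm (int_exponent \<sigma> B (H N) v s) \<le> C * modular l c (norm (H N s))"
              using C(2) by simp
            also have "\<dots> \<le> C * modular l c (4 * norm (f s))"
              using C(1) l Hle by (intro mult_left_mono modular_mono) auto
            also have "\<dots> \<le> C * (modular l c 4 * modular l c (norm (f s)))"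
              using C(1) by (intro mult_left_mono modular_scale) auto
            finally show "norm (int_exponent \<sigma> B (H N) v s) \<le> C * (modular l c 4 * modular l c (norm (f s)))" .
          qed
        qed
        moreover have "int_exponent \<sigma> B (\<lambda>_. 0) v s = 0" for s
          using int_exponent_indicator[of \<sigma> B "{}" "\<lambda>_. 0" v s] by simp
        ultimately have "(\<lambda>N. exp (complex_of_real (LINT s|lborel. int_exponent \<sigma> B (H N) v s))) \<longlonglongrightarrow> exp (complex_of_real 0)"
          by (intro tendsto_intros) simp
        then show ?thesis by (simp add: char_simple_integral[OF \<sigma> B M H])
      qed
      then have "(\<lambda>N. LINT \<omega>|P. min 1 (norm (simple_integral M (H N) \<omega>))) \<longlonglongrightarrow> 0"
        by (intro char_tendsto_1_imp_prob_dist borel_measurable_simple_integral[OF M H])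
      moreover have "e \<le> (LINT \<omega>|P. min 1 (norm (simple_integral M (H N) \<omega>)))" for N
      proof -
        have "prob_dist P (?X (k N)) (?X (j N)) = (LINT \<omega>|P. min 1 (norm (simple_integral M (H N) \<omega>)))"
          unfolding prob_dist_def dist_norm
        proof (rule integral_cong_AE)
          show "AE \<omega> in P. min 1 (norm (?X (k N) \<omega> - ?X (j N) \<omega>)) = min 1 (norm (simple_integral M (H N) \<omega>))"
            using Hdiff[of N] by eventually_elim simp
        qed (use X borel_measurable_simple_integral[OF M H[of N]] in measurable)
        then show ?thesis using kj(3)[of N] by simp
      qed
      ultimately have "e \<le> 0" by (intro LIMSEQ_le_const[of _ 0]) auto
      then show False using \<open>0 < e\<close> by simp
    qed
  qed
  obtain X where "tendsto_prob P (\<lambda>k. simple_integral M (F k)) X"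
    using conv[of UNIV] by auto
  then show ?thesis
    unfolding has_isrm_integral_def using F fm conv by (intro exI[of _ X] conjI exI[of _ F]) auto
qed

lemma has_isrm_integral_isrm_integral:
  assumes "spectral_measure \<sigma>" "exponent_between l c B" "mos_ISRM P B \<sigma> M" "modular_integrable l c f"
  shows "has_isrm_integral P M f (isrm_integral P M f)"
  unfolding isrm_integral_def using isrm_integral_exists[OF assms] by (rule someI_ex)

text \<open>The constant sequence is an approximating sequence, since the intersections with \<open>A\<close> again have finite measure.\<close>

lemma has_isrm_integral_indicator:
  fixes M :: "(real^'d) set \<Rightarrow> 'w \<Rightarrow> real^'m"
  assumes M: "mos_ISRM P B \<sigma> M" and A: "A \<in> finite_borel_sets"
  shows "has_isrm_integral P M (\<lambda>s. indicat_real A s *\<^sub>R (mat 1 :: real^'m^'m)) (M A)"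
proof -
  interpret prob_space P by (rule mos_ISRM_prob_space[OF M])
  have conv: "tendsto_prob P (\<lambda>k. simple_integral M (\<lambda>s. indicat_real A' s *\<^sub>R (mat 1 :: real^'m^'m))) (M A')"
    if A': "A' \<in> finite_borel_sets" for A'
  proof (rule tendsto_prob_AE_cong)
    show "tendsto_prob P (\<lambda>k. M A') (M A')"
      using mos_ISRM_measurable[OF M A'] by (simp add: tendsto_prob_def)
    show "AE \<omega> in P. M A' \<omega> = simple_integral M (\<lambda>s. indicat_real A' s *\<^sub>R (mat 1 :: real^'m^'m)) \<omega>"
      using simple_integral_indicator_mat_1[OF M A'] by eventually_elim simp
  qed (auto intro: borel_measurable_simple_integral[OF M] is_simple_indicator_const mos_ISRM_measurable[OF M] A')
  have Int: "A' \<inter> A \<in> finite_borel_sets" if "A' \<in> sets borel" for A'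
    using A that by (intro finite_borel_sets_subset[OF A]) auto
  show ?thesis
    unfolding has_isrm_integral_def
  proof (intro conjI exI[of _ "\<lambda>k s. indicat_real A s *\<^sub>R mat 1"] allI ballI)
    show "(\<lambda>s. indicat_real A s *\<^sub>R (mat 1 :: real^'m^'m)) \<in> borel_measurable borel"
      using A by (intro borel_measurable_scaleR borel_measurable_indicator) auto
    show "is_simple (\<lambda>s. indicat_real A s *\<^sub>R (mat 1 :: real^'m^'m))" by (rule is_simple_indicator_const[OF A])
    show "tendsto_prob P (\<lambda>k. simple_integral M (\<lambda>s. indicat_real A s *\<^sub>R (mat 1 :: real^'m^'m))) (M A)" by (rule conv[OF A])
    show "\<exists>Y. tendsto_prob P (\<lambda>k. simple_integral M (\<lambda>s. indicat_real A' s *\<^sub>R indicat_real A s *\<^sub>R (mat 1 :: real^'m^'m))) Y"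
      if "A' \<in> sets borel" for A'
      using conv[OF Int[OF that]] by (auto simp: indicator_inter_arith)
  qed simp
qed

section \<open>Joint characteristic functions and scaling\<close>

lemma has_isrm_integral_sum:
  fixes f :: "'i \<Rightarrow> real^'d \<Rightarrow> real^'m^'m"
  assumes M: "mos_ISRM P B \<sigma> M" and "finite I" "I \<noteq> {}" "\<And>j. j \<in> I \<Longrightarrow> has_isrm_integral P M (f j) (X j)"
  shows "has_isrm_integral P M (\<lambda>s. \<Sum>j\<in>I. C j ** f j s) (\<lambda>\<omega>. \<Sum>j\<in>I. C j *v X j \<omega>)"
  using assms(2-)
proof (induction I rule: finite_ne_induct)
  case (singleton j)
  then show ?case using has_isrm_integral_linear[OF M, of "f j" "X j" "f j" "X j" "C j" 0] by simp
next
  case (insert j I)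
  then show ?case
    using has_isrm_integral_linear[OF M, of "f j" "X j" "\<lambda>s. \<Sum>j\<in>I. C j ** f j s" "\<lambda>\<omega>. \<Sum>j\<in>I. C j *v X j \<omega>" "C j" "mat 1"]
    by simp
qed

lemma modular_integrable_sum:
  fixes f :: "'i \<Rightarrow> real^'d \<Rightarrow> real^'m^'m"
  assumes l: "0 < l" "0 < c" and "finite I" "I \<noteq> {}" "\<And>j. j \<in> I \<Longrightarrow> modular_integrable l c (f j)"
  shows "modular_integrable l c (\<lambda>s. \<Sum>j\<in>I. C j ** f j s)"
  using assms(3-)
proof (induction I rule: finite_ne_induct)
  case (singleton j)
  then show ?case using modular_integrable_linear[OF l, of "f j" "f j" "C j" 0] by simp
next
  case (insert j I)
  then show ?case
    using modular_integrable_linear[OF l, of "f j" "\<lambda>s. \<Sum>j\<in>I. C j ** f j s" "C j" "mat 1"] by simp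
qed

text \<open>Matrix coefficients turn a finite family of integrals into a single one: with \<open>C\<^sub>j\<close> the matrix
  whose only nonzero row is \<open>w\<^sub>j\<close>, one component of \<open>\<Sum>\<^sub>j C\<^sub>j X\<^sub>j\<close> is \<open>\<Sum>\<^sub>j w\<^sub>j \<bullet> X\<^sub>j\<close>. The index \<^term>\<open>undefined\<close> stands for an arbitrary
  fixed row.\<close>

definition row_matrix :: "real^'m \<Rightarrow> real^'m^'m" where
  "row_matrix y = (\<chi> a b. if a = undefined then y $ b else 0)"

definition row_axis :: "real^'m" where
  "row_axis = axis undefined 1"

lemma transpose_row_matrix_axis: "transpose (row_matrix y) *v row_axis = y"
  by (simp add: row_axis_def row_matrix_def matrix_vector_mult_basis column_def transpose_def)

definition combine :: "real^'m^'n \<Rightarrow> ('n \<Rightarrow> real^'d \<Rightarrow> real^'m^'m) \<Rightarrow> real^'d \<Rightarrow> real^'m^'m" where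
  "combine w f s = (\<Sum>j\<in>UNIV. row_matrix (w $ j) ** f j s)"

lemma transpose_combine:
  "transpose (combine w f s) *v row_axis = (\<Sum>j\<in>UNIV. transpose (f j s) *v (w $ j))"
proof -
  have lin: "linear (transpose :: real^'a^'a \<Rightarrow> real^'a^'a)"
    by (auto intro!: linearI simp: transpose_def vec_eq_iff)
  have "transpose (combine w f s) *v row_axis
      = (\<Sum>j\<in>UNIV. (transpose (f j s) ** transpose (row_matrix (w $ j))) *v row_axis)"
    unfolding combine_def
    by (simp add: linear_sum[OF lin] matrix_transpose_mul matrix_vector_mult.sum_left)
  then show ?thesis by (simp add: transpose_row_matrix_axis del: transpose_matrix_vector flip: matrix_vector_mul_assoc)
qed

lemma has_isrm_integral_combine:
  assumes M: "mos_ISRM P B \<sigma> M" and X: "\<And>j. has_isrm_integral P M (f j) (X j)"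
  shows "has_isrm_integral P M (combine w f) (\<lambda>\<omega>. \<Sum>j\<in>UNIV. row_matrix (w $ j) *v X j \<omega>)"
  unfolding combine_def[abs_def]
  by (rule has_isrm_integral_sum[OF M]) (auto intro: X)

lemma modular_integrable_combine:
  assumes "0 < l" "0 < c" "\<And>j. modular_integrable l c (f j)"
  shows "modular_integrable l c (combine w f)"
  unfolding combine_def[abs_def]
  using assms by (intro modular_integrable_sum) auto

lemma char_joint_isrm_integral:
  fixes X :: "'n::finite \<Rightarrow> 'w \<Rightarrow> real^'m" and f :: "'n \<Rightarrow> real^'d \<Rightarrow> real^'m^'m"
  assumes \<sigma>: "spectral_measure \<sigma>" and B: "exponent_between l c B" and M: "mos_ISRM P B \<sigma> M"
    and f: "\<And>j. modular_integrable l c (f j)" and X: "\<And>j. has_isrm_integral P M (f j) (X j)"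
  shows "(CLINT \<omega>|P. iexp (w \<bullet> (\<chi> j. X j \<omega>))) =
    exp (complex_of_real (LINT s|lborel. psi \<sigma> (B s) (\<Sum>j\<in>UNIV. transpose (f j s) *v (w $ j))))"
proof -
  have l: "0 < l" "0 < c" using B by (auto simp: exponent_between_def)
  have "row_axis \<bullet> (\<Sum>j\<in>UNIV. row_matrix (w $ j) *v X j \<omega>) = w \<bullet> (\<chi> j. X j \<omega>)" for \<omega>
    using transpose_row_matrix_axis[of "w $ _"]
    by (simp add: inner_sum_right inner_vec_def[of w] flip: dot_lmul_matrix)
  then have "(CLINT \<omega>|P. iexp (w \<bullet> (\<chi> j. X j \<omega>))) =
      (CLINT \<omega>|P. iexp (row_axis \<bullet> (\<Sum>j\<in>UNIV. row_matrix (w $ j) *v X j \<omega>)))"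
    by simp
  also have "\<dots> = exp (complex_of_real (LINT s|lborel. int_exponent \<sigma> B (combine w f) row_axis s))"
    by (rule char_isrm_integral[OF \<sigma> B M modular_integrable_combine[OF l f] has_isrm_integral_combine[OF M X]])
  finally show ?thesis by (simp add: int_exponent_def transpose_combine del: transpose_matrix_vector)
qed

lemma lborel_integral_affine:
  fixes h :: "real^'d \<Rightarrow> real"
  assumes [measurable]: "h \<in> borel_measurable borel" and r: "0 < r"
  shows "integral\<^sup>L lborel h = r ^ CARD('d) * (LINT x|lborel. h (u + r *\<^sub>R x))"
    and "integrable lborel h \<longleftrightarrow> integrable lborel (\<lambda>x. h (u + r *\<^sub>R x))"
proof -
  have eq: "(lborel :: (real^'d) measure) = density (distr lborel borel (\<lambda>x. u + r *\<^sub>R x)) (\<lambda>_. ennreal (r ^ CARD('d)))"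
    using lborel_affine[of r u] r by simp
  show "integral\<^sup>L lborel h = r ^ CARD('d) * (LINT x|lborel. h (u + r *\<^sub>R x))"
    by (subst eq) (use r in \<open>simp add: integral_density integral_distr\<close>)
  show "integrable lborel h \<longleftrightarrow> integrable lborel (\<lambda>x. h (u + r *\<^sub>R x))"
    by (subst eq) (use r in \<open>simp add: integrable_density integrable_distr_eq\<close>)
qed

lemma scaling_affine: "r \<noteq> 0 \<Longrightarrow> scaling u r (u + r *\<^sub>R x) = x"
  by (simp add: scaling_def)

lemma borel_measurable_scaling: "f \<in> borel_measurable borel \<Longrightarrow> (\<lambda>s. f (scaling u r s)) \<in> borel_measurable borel"
  unfolding scaling_def by (rule measurable_compose[of _ borel borel]) measurable

lemma modular_integrable_scaling:
  assumes r: "0 < r" and f: "modular_integrable l c f"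
  shows "modular_integrable l c (\<lambda>s. f (scaling u r s))"
proof -
  have [measurable]: "(\<lambda>s. f (scaling u r s)) \<in> borel_measurable borel"
    using f by (intro borel_measurable_scaling) (simp add: modular_integrable_def)
  have "integrable lborel (\<lambda>s. modular l c (norm (f (scaling u r s))))"
    using f r by (subst lborel_integral_affine(2)[OF _ r, of _ u]) (auto simp: modular_integrable_def scaling_affine)
  then show ?thesis by (simp add: modular_integrable_def)
qed

text \<open>The substitution \<open>s = u + r x\<close> contributes the factor \<open>r\<^sup>d\<close>, which the operator scaling of the
  exponent moves into the argument, where it meets \<open>r\<^bsup>-dB(u)\<^esup>\<close>. This is where the integrands have to
  commute with the exponents.\<close>

lemma scaled_exponent:
  fixes f :: "'n::finite \<Rightarrow> real^'d \<Rightarrow> real^'m^'m"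
  assumes \<sigma>: "spectral_measure \<sigma>" and B: "exponent_between l c B" and r: "0 < r"
    and f: "\<And>j. f j \<in> borel_measurable borel"
    and comm: "\<And>j s. f j s ** B u = B u ** f j s"
  shows "(LINT s|lborel. psi \<sigma> (B s) (\<Sum>j\<in>UNIV. transpose (f j (scaling u r s)) *v (mat_powr r (- (real CARD('d) *\<^sub>R B u)) *v (w $ j)))) =
    (LINT x|lborel. psi \<sigma> (B (u + r *\<^sub>R x)) ((mat_powr r (real CARD('d) *\<^sub>R B (u + r *\<^sub>R x)) ** mat_powr r (- (real CARD('d) *\<^sub>R B u))) *v
        (\<Sum>j\<in>UNIV. transpose (f j x) *v (w $ j))))"
    (is "?lhs = ?rhs")
proof -
  let ?R = "mat_powr r (- (real CARD('d) *\<^sub>R B u))"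
  have sym: "transpose (B s) = B s" for s using B by (simp add: exponent_between_def form_between_def)
  have meas: "(\<lambda>s. psi \<sigma> (B s) (\<Sum>j\<in>UNIV. transpose (f j (scaling u r s)) *v (?R *v (w $ j)))) \<in> borel_measurable borel"
  proof (rule borel_measurable_psi[OF \<sigma>])
    show "B \<in> borel_measurable borel" using B by (simp add: exponent_between_def)
    have [measurable]: "(\<lambda>s. f j (scaling u r s)) \<in> borel_measurable borel" for j
      by (rule borel_measurable_scaling[OF f])
    show "(\<lambda>s. \<Sum>j\<in>UNIV. transpose (f j (scaling u r s)) *v (?R *v (w $ j))) \<in> borel_measurable borel"
      by measurable
  qed
  have pt: "r ^ CARD('d) * psi \<sigma> (B s) (\<Sum>j\<in>UNIV. transpose (f j x) *v (?R *v (w $ j))) =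
      psi \<sigma> (B s) ((mat_powr r (real CARD('d) *\<^sub>R B s) ** ?R) *v (\<Sum>j\<in>UNIV. transpose (f j x) *v (w $ j)))" for s x
  proof -
    have "transpose (f j x) ** B u = B u ** transpose (f j x)" for j
      using arg_cong[OF comm[of j x], of transpose] by (simp add: matrix_transpose_mul sym)
    then have "transpose (f j x) ** ?R = ?R ** transpose (f j x)" for j
      by (intro commute_mat_powr)
        (simp add: matrix_mult.minus_left matrix_mult.minus_right
          matrix_mult.scaleR_left matrix_mult.scaleR_right)
    then have "(\<Sum>j\<in>UNIV. transpose (f j x) *v (?R *v (w $ j))) = ?R *v (\<Sum>j\<in>UNIV. transpose (f j x) *v (w $ j))"
      by (simp add: matrix_vector_mul_assoc matrix_vector_mult.sum_right
          del: transpose_matrix_vector)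
    then have "r ^ CARD('d) * psi \<sigma> (B s) (\<Sum>j\<in>UNIV. transpose (f j x) *v (?R *v (w $ j))) =
      psi \<sigma> (B s) (mat_powr (r ^ CARD('d)) (B s) *v (?R *v (\<Sum>j\<in>UNIV. transpose (f j x) *v (w $ j))))"
      using psi_mat_powr[OF \<sigma> sym, of "r ^ CARD('d)"] r by simp
    also have "mat_powr (r ^ CARD('d)) (B s) = mat_powr r (real CARD('d) *\<^sub>R B s)"
      using r by (simp add: mat_powr_scaleR powr_realpow)
    finally show ?thesis by (simp add: matrix_vector_mul_assoc)
  qed
  have "?lhs = r ^ CARD('d) * (LINT x|lborel. psi \<sigma> (B (u + r *\<^sub>R x))
      (\<Sum>j\<in>UNIV. transpose (f j x) *v (?R *v (w $ j))))"
    using r by (subst lborel_integral_affine(1)[OF meas r, of u]) (simp add: scaling_affine)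
  also have "\<dots> = ?rhs"
    by (subst integral_mult_right_zero[symmetric]) (simp only: pt)
  finally show ?thesis .
qed

text \<open>On the compact support the matrices \<open>r\<^bsup>dB(u+rx)\<^esup> r\<^bsup>-dB(u)\<^esup>\<close> are uniformly bounded for small \<open>r\<close>, so
  a multiple of \<open>modular |f|\<close> dominates; pointwise the arguments converge and \<open>psi\<close> is continuous.\<close>

lemma scaled_exponent_tendsto:
  fixes f :: "'n::finite \<Rightarrow> real^'d \<Rightarrow> real^'m^'m" and r :: "nat \<Rightarrow> real"
  assumes \<sigma>: "spectral_measure \<sigma>" and B: "exponent_between l c B"
    and cont: "isCont B u"
    and unif: "\<And>K. compact K \<Longrightarrow>
      uniform_limit K
        (\<lambda>r s. mat_powr r (real CARD('d) *\<^sub>R B (u + r *\<^sub>R s))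
                ** mat_powr r (- (real CARD('d) *\<^sub>R B u)))
        (\<lambda>_. mat 1) (at_right 0)"
    and f: "\<And>j. modular_integrable l c (f j)" and supp: "\<And>j. compact (closure {s. f j s \<noteq> 0})"
    and r: "\<And>n. 0 < r n" "r \<longlonglongrightarrow> 0"
  shows "(\<lambda>n. LINT x|lborel. psi \<sigma> (B (u + r n *\<^sub>R x))
        ((mat_powr (r n) (real CARD('d) *\<^sub>R B (u + r n *\<^sub>R x)) ** mat_powr (r n) (- (real CARD('d) *\<^sub>R B u))) *v
        (\<Sum>j\<in>UNIV. transpose (f j x) *v (w $ j))))
     \<longlonglongrightarrow> (LINT x|lborel. psi \<sigma> (B u) (\<Sum>j\<in>UNIV. transpose (f j x) *v (w $ j)))"
proof -
  define G where "G n x = mat_powr (r n) (real CARD('d) *\<^sub>R B (u + r n *\<^sub>R x)) ** mat_powr (r n) (- (real CARD('d) *\<^sub>R B u))" for n x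
  define z where "z x = (\<Sum>j\<in>UNIV. transpose (f j x) *v (w $ j))" for x
  have l: "1 / 2 < l" "1 / 2 < c" and form: "\<And>s. form_between l c (B s)" and Bm: "B \<in> borel_measurable borel"
    using B by (simp_all add: exponent_between_def)
  have r0: "filterlim r (at_right 0) sequentially"
    using r(2) less_imp_neq[OF r(1)] r(1) by (auto simp: filterlim_at intro!: always_eventually)
  have G_lim: "uniform_limit K G (\<lambda>_. mat 1) sequentially" if "compact K" for K
    unfolding G_def by (rule filterlim_compose[OF unif[OF that] r0])
  define K where "K = (\<Union>j. closure {s. f j s \<noteq> 0})"
  have K: "compact K" unfolding K_def using supp by (intro compact_UN) auto
  have z0: "z x = 0" if "x \<notin> K" for x
  proof -
    have "f j x = 0" for j using that closure_subset[of "{s. f j s \<noteq> 0}"] by (auto simp: K_def)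
    moreover have "transpose (0 :: real^'m^'m) = 0" by (simp add: transpose_def vec_eq_iff)
    ultimately show ?thesis by (simp add: z_def)
  qed
  have fm[measurable]: "f j \<in> borel_measurable borel" for j using f by (simp add: modular_integrable_def)
  have zm[measurable]: "z \<in> borel_measurable borel" unfolding z_def[abs_def] by measurable
  have "\<forall>\<^sub>F n in sequentially. \<forall>x\<in>K. dist (G n x) (mat 1) < 1"
    using G_lim[OF K] by (auto dest!: uniform_limitD[where e=1])
  then obtain N where N: "\<And>n x. N \<le> n \<Longrightarrow> x \<in> K \<Longrightarrow> dist (G n x) (mat 1) < 1"
    by (auto simp: eventually_sequentially)
  define g where "g = norm (mat 1 :: real^'m^'m) + 1"
  have G_le: "norm (G n x) \<le> g" if "N \<le> n" "x \<in> K" for n x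
    using N[OF that] norm_triangle_ineq2[of "G n x" "mat 1"] by (simp add: g_def dist_norm)
  obtain K1 where K1: "0 \<le> K1" "\<And>(A :: real^'m^'m) v. norm (A *v v) \<le> norm A * norm v * K1"
    using matrix_vector_mult.nonneg_bounded by blast
  obtain K2 where K2: "0 \<le> K2" "\<And>(A :: real^'m^'m) v. norm (transpose A *v v) \<le> K2 * norm A * norm v"
    using norm_transpose_mult_bound by blast
  define h where "h = combine w f"
  have h: "modular_integrable l c h"
    unfolding h_def using l f by (intro modular_integrable_combine) auto
  define L where "L = g * K1 * (K2 * norm (row_axis :: real^'m))"
  have L: "0 \<le> L" using K1(1) K2(1) by (simp add: L_def g_def)
  have Gz_le: "norm (G n x *v z x) \<le> L * norm (h x)" if "N \<le> n" for n x
  proof (cases "x \<in> K")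
    case True
    have "norm (z x) \<le> K2 * norm (h x) * norm (row_axis :: real^'m)"
      using K2(2)[of "h x" row_axis] by (simp add: h_def transpose_combine z_def del: transpose_matrix_vector)
    then have "norm (G n x) * norm (z x) * K1 \<le> g * (K2 * norm (h x) * norm (row_axis :: real^'m)) * K1"
      using G_le[OF that True] K1(1) by (intro mult_right_mono mult_mono) (auto simp: g_def)
    then show ?thesis using K1(2)[of "G n x" "z x"] by (simp add: L_def mult_ac)
  next
    case False
    then show ?thesis using z0 L by simp
  qed
  have "(\<lambda>n. LINT x|lborel. psi \<sigma> (B (u + r (n + N) *\<^sub>R x)) (G (n + N) x *v z x)) \<longlonglongrightarrow> (LINT x|lborel. psi \<sigma> (B u) (z x))"
  proof (rule integral_dominated_convergence[where w="\<lambda>x. psi_const \<sigma> l c * (modular l c L * modular l c (norm (h x)))"])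
    show "(\<lambda>x. psi \<sigma> (B u) (z x)) \<in> borel_measurable lborel"
      using borel_measurable_psi[OF \<sigma>, of "\<lambda>_. B u" lborel z] by simp
    show "(\<lambda>x. psi \<sigma> (B (u + r (n + N) *\<^sub>R x)) (G (n + N) x *v z x)) \<in> borel_measurable lborel" for n
    proof (rule borel_measurable_psi[OF \<sigma>])
      show Bu: "(\<lambda>x. B (u + r (n + N) *\<^sub>R x)) \<in> borel_measurable lborel"
        by (rule measurable_compose[OF _ Bm]) measurable
      have "(\<lambda>x. mat_powr (r (n + N)) (real CARD('d) *\<^sub>R B (u + r (n + N) *\<^sub>R x))) \<in> borel_measurable lborel"
        unfolding mat_powr_def using Bu by measurable
      moreover have "G (n + N) x *v z x = mat_powr (r (n + N)) (real CARD('d) *\<^sub>R B (u + r (n + N) *\<^sub>R x)) *v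
          (mat_powr (r (n + N)) (- (real CARD('d) *\<^sub>R B u)) *v z x)" for x
        by (simp add: G_def matrix_vector_mul_assoc)
      ultimately show "(\<lambda>x. G (n + N) x *v z x) \<in> borel_measurable lborel"
        by (simp only:) (intro borel_measurable_matrix_vector_mult, auto)
    qed
    show "integrable lborel (\<lambda>x. psi_const \<sigma> l c * (modular l c L * modular l c (norm (h x))))"
      using h by (simp add: modular_integrable_def)
    show "AE x in lborel. (\<lambda>n. psi \<sigma> (B (u + r (n + N) *\<^sub>R x)) (G (n + N) x *v z x)) \<longlonglongrightarrow> psi \<sigma> (B u) (z x)"
    proof (intro AE_I2 LIMSEQ_ignore_initial_segment[where k=N])
      fix x
      show "(\<lambda>n. psi \<sigma> (B (u + r n *\<^sub>R x)) (G n x *v z x)) \<longlonglongrightarrow> psi \<sigma> (B u) (z x)"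
      proof (rule tendsto_psi[OF \<sigma> form l])
        have "(\<lambda>n. u + r n *\<^sub>R x) \<longlonglongrightarrow> u + 0 *\<^sub>R x" by (intro tendsto_intros r)
        then show "(\<lambda>n. B (u + r n *\<^sub>R x)) \<longlonglongrightarrow> B u" using isCont_tendsto_compose[OF cont] by simp
        have "(\<lambda>n. G n x) \<longlonglongrightarrow> mat 1"
          using tendsto_uniform_limitI[OF G_lim[of "{x}"]] by simp
        then have "(\<lambda>n. G n x *v z x) \<longlonglongrightarrow> mat 1 *v z x"
          by (intro matrix_vector_mult.tendsto tendsto_const)
        then show "(\<lambda>n. G n x *v z x) \<longlonglongrightarrow> z x" by simp
      qed
    qed
    show "AE x in lborel. norm (psi \<sigma> (B (u + r (n + N) *\<^sub>R x)) (G (n + N) x *v z x)) \<le>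
        psi_const \<sigma> l c * (modular l c L * modular l c (norm (h x)))" for n
    proof (intro AE_I2)
      fix x
      have "norm (psi \<sigma> (B (u + r (n + N) *\<^sub>R x)) (G (n + N) x *v z x)) \<le> psi_const \<sigma> l c * modular l c (norm (G (n + N) x *v z x))"
        using psi_bound[OF \<sigma> form l, of "u + r (n + N) *\<^sub>R x" "G (n + N) x *v z x"] psi_nonpos[OF \<sigma>, of "B (u + r (n + N) *\<^sub>R x)" "G (n + N) x *v z x"]
        by (simp add: modular_def)
      also have "\<dots> \<le> psi_const \<sigma> l c * modular l c (L * norm (h x))"
        using l Gz_le[of "n + N" x] by (intro mult_left_mono modular_mono psi_const_nonneg) auto
      also have "\<dots> \<le> psi_const \<sigma> l c * (modular l c L * modular l c (norm (h x)))"
        using l L by (intro mult_left_mono modular_scale psi_const_nonneg) auto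
      finally show "norm (psi \<sigma> (B (u + r (n + N) *\<^sub>R x)) (G (n + N) x *v z x)) \<le> psi_const \<sigma> l c * (modular l c L * modular l c (norm (h x)))" .
    qed
  qed
  then show ?thesis unfolding G_def z_def by (rule LIMSEQ_offset)
qed

lemma borel_measurable_vec_lambda:
  fixes V :: "'n::finite \<Rightarrow> 'a \<Rightarrow> 'b::euclidean_space"
  assumes "\<And>j. V j \<in> borel_measurable S"
  shows "(\<lambda>x. \<chi> j. V j x) \<in> borel_measurable S"
proof (subst borel_measurable_euclidean_space, rule ballI)
  fix e :: "'b^'n" assume "e \<in> Basis"
  then obtain j b where "e = axis j b" by (auto simp: Basis_vec_def)
  then have "(\<lambda>x. (\<chi> j. V j x) \<bullet> e) = (\<lambda>x. V j x \<bullet> b)"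
    by (simp add: inner_axis)
  then show "(\<lambda>x. (\<chi> j. V j x) \<bullet> e) \<in> borel_measurable S"
    using assms[of j] by simp
qed

text \<open>Stated for arbitrary versions \<open>X\<close> and \<open>Y\<close> of the integrals, so that it covers both the versions chosen by
  \<^const>\<open>isrm_integral\<close> and the values of the random measures on sets.\<close>

theorem scaled_integrals_conv_in_distr:
  fixes f :: "'n::finite \<Rightarrow> real^'d \<Rightarrow> real^'m^'m" and X :: "real \<Rightarrow> 'n \<Rightarrow> 'w \<Rightarrow> real^'m"
    and Y :: "'n \<Rightarrow> 'v \<Rightarrow> real^'m"
  assumes \<sigma>: "spectral_measure \<sigma>" and B: "exponent_between l c B" 
    and M: "mos_ISRM P B \<sigma> M" and Mu: "mos_ISRM Q (\<lambda>_. B u) \<sigma> M\<^sub>u"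
    and cont: "isCont B u"
    and unif: "\<And>K. compact K \<Longrightarrow>
      uniform_limit K
        (\<lambda>r s. mat_powr r (real CARD('d) *\<^sub>R B (u + r *\<^sub>R s))
                ** mat_powr r (- (real CARD('d) *\<^sub>R B u)))
        (\<lambda>_. mat 1) (at_right 0)"
    and f: "\<And>j. modular_integrable l c (f j)" and supp: "\<And>j. compact (closure {s. f j s \<noteq> 0})"
    and comm: "\<And>j s. f j s ** B u = B u ** f j s"
    and X: "\<And>r j. 0 < r \<Longrightarrow> has_isrm_integral P M (\<lambda>s. f j (scaling u r s)) (X r j)"
    and Y: "\<And>j. has_isrm_integral Q M\<^sub>u (f j) (Y j)"
  shows "conv_in_distr P (\<lambda>r \<omega>. (\<chi> j. mat_powr r (- (real CARD('d) *\<^sub>R B u)) *v X r j \<omega>))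
        Q (\<lambda>\<omega>. (\<chi> j. Y j \<omega>)) (at_right 0)"
proof -
  let ?R = "\<lambda>r. mat_powr r (- (real CARD('d) *\<^sub>R B u))"
  let ?Z = "\<lambda>r \<omega>. (\<chi> j. ?R r *v X r j \<omega>)"
  have Bu: "exponent_between l c (\<lambda>_. B u)" using B by (simp add: exponent_between_def)
  have sym: "transpose (B s) = B s" for s using B by (simp add: exponent_between_def form_between_def)
  have Xm: "X r j \<in> borel_measurable P" if "0 < r" for r j
    using X[OF that, of j] by (auto simp: has_isrm_integral_def tendsto_prob_def)
  have Zm: "?Z r \<in> borel_measurable P" if "0 < r" for r
    using Xm[OF that] by (intro borel_measurable_vec_lambda borel_measurable_matrix_vector_mult) auto
  have Ym: "Y j \<in> borel_measurable Q" for j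
    using Y[of j] by (auto simp: has_isrm_integral_def tendsto_prob_def)
  have cfX: "(CLINT \<omega>|P. iexp (w \<bullet> ?Z r \<omega>)) = exp (complex_of_real
      (LINT x|lborel. psi \<sigma> (B (u + r *\<^sub>R x)) ((mat_powr r (real CARD('d) *\<^sub>R B (u + r *\<^sub>R x)) ** ?R r) *v
        (\<Sum>j\<in>UNIV. transpose (f j x) *v (w $ j)))))" if r: "0 < r" for r w
  proof -
    have "transpose (- (real CARD('d) *\<^sub>R B u)) = - (real CARD('d) *\<^sub>R transpose (B u))"
      by (simp add: transpose_def vec_eq_iff)
    then have "transpose (?R r) = ?R r" by (simp add: transpose_mat_powr sym)
    then have "w \<bullet> ?Z r \<omega> = (\<chi> j. ?R r *v (w $ j)) \<bullet> (\<chi> j. X r j \<omega>)" for \<omega>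
      by (simp add: inner_vec_def[of w] inner_vec_def[of "\<chi> j. ?R r *v (w $ j)"] symmetric_inner_commute)
    then have "(CLINT \<omega>|P. iexp (w \<bullet> ?Z r \<omega>)) = (CLINT \<omega>|P. iexp ((\<chi> j. ?R r *v (w $ j)) \<bullet> (\<chi> j. X r j \<omega>)))"
      by simp
    also have "\<dots> = exp (complex_of_real (LINT s|lborel. psi \<sigma> (B s)
        (\<Sum>j\<in>UNIV. transpose (f j (scaling u r s)) *v ((\<chi> j. ?R r *v (w $ j)) $ j))))"
      by (rule char_joint_isrm_integral[OF \<sigma> B M modular_integrable_scaling[OF r f] X[OF r]])
    also have "(LINT s|lborel. psi \<sigma> (B s) (\<Sum>j\<in>UNIV. transpose (f j (scaling u r s)) *v ((\<chi> j. ?R r *v (w $ j)) $ j))) =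
        (LINT s|lborel. psi \<sigma> (B s) (\<Sum>j\<in>UNIV. transpose (f j (scaling u r s)) *v (?R r *v (w $ j))))"
      by simp
    also have "\<dots> = (LINT x|lborel. psi \<sigma> (B (u + r *\<^sub>R x)) ((mat_powr r (real CARD('d) *\<^sub>R B (u + r *\<^sub>R x)) ** ?R r) *v
        (\<Sum>j\<in>UNIV. transpose (f j x) *v (w $ j))))"
      by (rule scaled_exponent[OF \<sigma> B r _ comm]) (use f in \<open>simp add: modular_integrable_def\<close>)
    finally show ?thesis .
  qed
  show ?thesis
    unfolding conv_in_distr_def
  proof (intro conjI allI impI)
    show "\<forall>\<^sub>F r in at_right 0. ?Z r \<in> borel_measurable P"
      using Zm by (auto simp: eventually_at_right_field intro!: exI[of _ 1])
    show Yv: "(\<lambda>\<omega>. \<chi> j. Y j \<omega>) \<in> borel_measurable Q"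
      using Ym by (rule borel_measurable_vec_lambda)
    fix g :: "real^'m^'n \<Rightarrow> real" assume g: "continuous_on UNIV g \<and> bounded (range g)"
    show "((\<lambda>r. LINT \<omega>|P. g (?Z r \<omega>)) \<longlongrightarrow> (LINT \<omega>|Q. g (\<chi> j. Y j \<omega>))) (at_right 0)"
      unfolding tendsto_at_iff_sequentially o_def
    proof (intro allI impI)
      fix r :: "nat \<Rightarrow> real" assume "\<forall>n. r n \<in> {0<..} - {0}" and lim: "r \<longlonglongrightarrow> 0"
      then have r: "0 < r n" for n by auto
      show "(\<lambda>n. LINT \<omega>|P. g (?Z (r n) \<omega>)) \<longlonglongrightarrow> (LINT \<omega>|Q. g (\<chi> j. Y j \<omega>))"
      proof (rule levy_continuity_euclidean[where X="\<lambda>n. ?Z (r n)" and Y="\<lambda>\<omega>. \<chi> j. Y j \<omega>" and g=g])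
        show "(\<lambda>n. CLINT \<omega>|P. iexp (w \<bullet> ?Z (r n) \<omega>)) \<longlonglongrightarrow> (CLINT \<omega>|Q. iexp (w \<bullet> (\<chi> j. Y j \<omega>)))" for w
          unfolding cfX[OF r] char_joint_isrm_integral[OF \<sigma> Bu Mu f Y]
          by (intro tendsto_exp tendsto_of_real scaled_exponent_tendsto[OF \<sigma> B cont unif f supp r lim])
      qed (use g Zm[OF r] Yv mos_ISRM_prob_space[OF M] mos_ISRM_prob_space[OF Mu] in auto)
    qed
  qed
qed

section \<open>The hypotheses on the exponent function\<close>

text \<open>The indices are reciprocals of the extreme eigenvalues, so \<open>1 / index_high B\<close> and \<open>1 / index_low B\<close> bound
  all quadratic forms. The assumption that the infimum exceeds \<open>1/2\<close> gives both conditions on the bounds.\<close>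

lemma exponent_function_between:
  fixes B :: "real^'d \<Rightarrow> real^'m^'m"
  assumes "exponent_function B"
  shows "exponent_between (1 / index_high B) (1 / index_low B) B" "0 < index_low B" "0 < index_high B"
proof -
  have Bm: "B \<in> borel_measurable borel" and sym: "\<And>s. transpose (B s) = B s"
    and pos: "\<And>s. 0 < eig_min (B s)" and inf: "1/2 < (INF s. eig_min (B s))"
    and bdd: "bdd_above (range (\<lambda>s. eig_max (B s)))"
    using assms by (auto simp: exponent_function_def Q_matrices_def)
  define m where "m = (INF s. eig_min (B s))"
  obtain K where K: "\<And>s. eig_max (B s) \<le> K" using bdd by (auto simp: bdd_above_def)
  have m: "m \<le> eig_min (B s)" "1/2 < m" for s
  proof -
    have "bdd_below (range (\<lambda>s. eig_min (B s)))" using pos by (intro bdd_belowI[of _ 0]) (auto intro: less_imp_le)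
    then show "m \<le> eig_min (B s)" unfolding m_def by (rule cINF_lower) simp
    show "1/2 < m" unfolding m_def by (rule inf)
  qed
  have mm: "eig_min (B s) \<le> eig_max (B s)" for s by (rule eig_min_le_eig_max[OF sym])
  have max_pos: "0 < eig_max (B s)" for s using pos[of s] mm[of s] by linarith
  have K0: "0 < K" using m(1)[of undefined] m(2) mm[of undefined] K[of undefined] by linarith
  have low_le: "index_low B \<le> inverse (eig_max (B s))" for s
    unfolding index_low_def
  proof (rule cINF_lower)
    show "bdd_below (range (\<lambda>s. inverse (eig_max (B s))))"
      using max_pos by (intro bdd_belowI[of _ 0]) (auto intro: less_imp_le)
  qed simp
  have low_ge: "inverse K \<le> index_low B"
    unfolding index_low_def using K max_pos
    by (intro cINF_greatest le_imp_inverse_le) auto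
  have high_ge: "inverse (eig_min (B s)) \<le> index_high B" for s
    unfolding index_high_def
  proof (rule cSUP_upper)
    show "bdd_above (range (\<lambda>s. inverse (eig_min (B s))))"
      using m by (intro bdd_aboveI[of _ "inverse m"]) (auto intro!: le_imp_inverse_le)
  qed simp
  have high_le: "index_high B \<le> inverse m"
    unfolding index_high_def using m by (intro cSUP_least le_imp_inverse_le) auto
  show low: "0 < index_low B" using low_ge K0 by (meson less_le_trans positive_imp_inverse_positive)
  show high: "0 < index_high B" using high_ge pos by (meson less_le_trans positive_imp_inverse_positive)
  have l_le: "1 / index_high B \<le> eig_min (B s)" for s
    using le_imp_inverse_le[OF high_ge[of s]] pos[of s] by (simp add: inverse_eq_divide)
  have c_ge: "eig_max (B s) \<le> 1 / index_low B" for s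
    using le_imp_inverse_le[OF low_le[of s] low] by (simp add: inverse_eq_divide)
  have l: "1 / 2 < 1 / index_high B"
    using le_imp_inverse_le[OF high_le high] m(2) by (simp add: inverse_eq_divide)
  moreover have "1 / 2 < 1 / index_low B"
    using l l_le[of undefined] mm[of undefined] c_ge[of undefined] by linarith
  moreover have "form_between (1 / index_high B) (1 / index_low B) (B s)" for s
    unfolding form_between_def
  proof (intro conjI allI)
    fix x
    show "1 / index_high B * (norm x)\<^sup>2 \<le> x \<bullet> (B s *v x)"
      using mult_right_mono[OF l_le[of s], of "(norm x)\<^sup>2"] symmetric_form_ge_eig_min[OF sym[of s], of x] by simp
    show "x \<bullet> (B s *v x) \<le> 1 / index_low B * (norm x)\<^sup>2"
      using mult_right_mono[OF c_ge[of s], of "(norm x)\<^sup>2"] symmetric_form_le_eig_max[OF sym[of s], of x] by simp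
  qed (rule sym)
  ultimately show "exponent_between (1 / index_high B) (1 / index_low B) B"
    using Bm by (simp add: exponent_between_def)
qed

lemma norm_le_op_norm:
  fixes A :: "real^'m^'m"
  shows "norm A \<le> real (CARD('m) * CARD('m)) * op_norm A"
proof -
  have "norm A \<le> (\<Sum>i\<in>UNIV. norm (A $ i))" by (simp add: norm_vec_def L2_set_le_sum)
  also have "\<dots> \<le> (\<Sum>i\<in>(UNIV::'m set). \<Sum>j\<in>(UNIV::'m set). \<bar>A $ i $ j\<bar>)"
    by (intro sum_mono norm_le_l1_cart)
  also have "\<dots> \<le> (\<Sum>i\<in>(UNIV::'m set). \<Sum>j\<in>(UNIV::'m set). op_norm A)"
    unfolding op_norm_def by (intro sum_mono matrix_component_le_onorm)
  finally show ?thesis by simp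
qed

lemma F_class_modular_integrable:
  fixes f :: "real^'d \<Rightarrow> real^'m^'m"
  assumes ab: "0 < a" "0 < b" and f: "f \<in> F_class a b"
  shows "modular_integrable (1 / b) (1 / a) f"
proof -
  have fm[measurable]: "f \<in> borel_measurable borel"
    and fin: "(\<integral>\<^sup>+s. ennreal (op_norm (f s) powr a + op_norm (f s) powr b) \<partial>lborel) < \<infinity>"
    using f by (auto simp: F_class_def)
  let ?n = "real (CARD('m) * CARD('m))"
  let ?C = "modular (1 / b) (1 / a) ?n"
  have "modular (1 / b) (1 / a) (norm (f s)) \<le> ?C * (op_norm (f s) powr a + op_norm (f s) powr b)" for s
  proof -
    have op: "0 \<le> op_norm (f s)" unfolding op_norm_def by (rule onorm_pos_le) (simp add: linear_linear)
    have "modular (1 / b) (1 / a) (norm (f s)) \<le> modular (1 / b) (1 / a) (?n * op_norm (f s))"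
      using ab norm_le_op_norm[of "f s"] by (intro modular_mono) auto
    also have "\<dots> \<le> ?C * modular (1 / b) (1 / a) (op_norm (f s))"
      using op by (intro modular_scale) auto
    finally show ?thesis by (simp add: modular_def add.commute)
  qed
  moreover have C: "0 < ?C" by (simp add: modular_def add_pos_pos)
  ultimately have "(\<integral>\<^sup>+s. ennreal (modular (1 / b) (1 / a) (norm (f s)) / ?C) \<partial>lborel) \<le>
      (\<integral>\<^sup>+s. ennreal (op_norm (f s) powr a + op_norm (f s) powr b) \<partial>lborel)"
    by (intro nn_integral_mono ennreal_leI) (simp add: pos_divide_le_eq mult.commute)
  then have "integrable lborel (\<lambda>s. modular (1 / b) (1 / a) (norm (f s)) / ?C)"
    using fin C by (intro integrableI_bounded) (auto simp: modular_nonneg intro: le_less_trans)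
  then have "integrable lborel (\<lambda>s. ?C * (modular (1 / b) (1 / a) (norm (f s)) / ?C))"
    by (rule integrable_mult_right)
  then show ?thesis using fm C by (simp add: modular_integrable_def)
qed

section \<open>The rescaled random measure\<close>

lemma bounded_in_finite_borel_sets: "A \<in> sets borel \<Longrightarrow> bounded A \<Longrightarrow> A \<in> finite_borel_sets"
  using emeasure_bounded_finite[of A] by (simp add: finite_borel_sets_def)

lemma modular_integrable_indicator:
  fixes A :: "(real^'d) set"
  assumes "A \<in> finite_borel_sets"
  shows "modular_integrable l c (\<lambda>s. indicat_real A s *\<^sub>R (mat 1 :: real^'m^'m))"
proof -
  have "integrable lborel (\<lambda>s. indicat_real A s * modular l c (norm (mat 1 :: real^'m^'m)))"
    using assms finite_borel_sets_finite[OF assms]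
    by (intro integrable_mult_left integrable_real_indicator) auto
  moreover have "modular l c (norm (indicat_real A s *\<^sub>R (mat 1 :: real^'m^'m))) =
      indicat_real A s * modular l c (norm (mat 1 :: real^'m^'m))" for s
    by (simp split: split_indicator)
  ultimately show ?thesis
    using assms by (auto simp: modular_integrable_def)
qed

lemma scaling_in_iff:
  assumes r: "0 < r"
  shows "scaling u r s \<in> A \<longleftrightarrow> s \<in> (\<lambda>x. u + r *\<^sub>R x) ` A"
proof
  assume "scaling u r s \<in> A"
  moreover have "s = u + r *\<^sub>R scaling u r s" using r by (simp add: scaling_def)
  ultimately show "s \<in> (\<lambda>x. u + r *\<^sub>R x) ` A" by blast
qed (use r in \<open>auto simp: scaling_affine\<close>)

lemma indicator_scaling:
  "0 < r \<Longrightarrow> indicat_real A (scaling u r s) = indicat_real ((\<lambda>x. u + r *\<^sub>R x) ` A) s"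
  by (simp add: indicator_def scaling_in_iff)

lemma affine_image_in_finite_borel_sets:
  fixes A :: "(real^'d) set"
  assumes r: "0 < r" and A: "A \<in> sets borel" "bounded A"
  shows "(\<lambda>x. u + r *\<^sub>R x) ` A \<in> finite_borel_sets"
proof (rule bounded_in_finite_borel_sets)
  have "(\<lambda>x. u + r *\<^sub>R x) ` A = scaling u r -` A"
    using scaling_in_iff[OF r, of u _ A] by auto
  moreover have "scaling u r \<in> borel_measurable borel" unfolding scaling_def[abs_def] by measurable
  ultimately show "(\<lambda>x. u + r *\<^sub>R x) ` A \<in> sets borel"
    using measurable_sets[of "scaling u r" borel borel A] A by simp
  have "bounded ((+) u ` ((*\<^sub>R) r ` A))"
    using A by (intro bounded_translation bounded_scaling)
  then show "bounded ((\<lambda>x. u + r *\<^sub>R x) ` A)" by (simp add: image_image)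
qed

theorem theorem2p13:
  fixes P :: "'w measure" and Q :: "'v measure"
    and B :: "real^'d \<Rightarrow> real^'m^'m" and \<sigma> :: "(real^'m) measure"
    and M :: "(real^'d) set \<Rightarrow> 'w \<Rightarrow> real^'m"
    and M\<^sub>u :: "(real^'d) set \<Rightarrow> 'v \<Rightarrow> real^'m"
    and u :: "real^'d"
  assumes "exponent_function B"
    and "spectral_measure \<sigma>"
    and "mos_ISRM P B \<sigma> M"
    and "mos_ISRM Q (\<lambda>_. B u) \<sigma> M\<^sub>u"
    and "isCont B u"
    and "\<And>K. compact K \<Longrightarrow>
      uniform_limit K
        (\<lambda>r s. mat_powr r (real CARD('d) *\<^sub>R B (u + r *\<^sub>R s))
                ** mat_powr r (- (real CARD('d) *\<^sub>R B u)))
        (\<lambda>_. mat 1) (at_right 0)"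
  shows "(\<forall>f :: 'n::finite \<Rightarrow> real^'d \<Rightarrow> real^'m^'m.
      (\<forall>j. f j \<in> F_class (index_low B) (index_high B)) \<and>
      (\<forall>j. compact_support (f j)) \<and>
      (\<forall>j s1 s2. f j s1 ** B s2 = B s2 ** f j s1) \<longrightarrow>
      conv_in_distr
        P (\<lambda>r \<omega>. (\<chi> j. mat_powr r (- (real CARD('d) *\<^sub>R B u)) *v scaled_integral P u r M (f j) \<omega>))
        Q (\<lambda>\<omega>. (\<chi> j. isrm_integral Q M\<^sub>u (f j) \<omega>))
        (at_right 0))
    \<and> (\<forall>A :: 'n \<Rightarrow> (real^'d) set.
      (\<forall>j. A j \<in> sets borel \<and> bounded (A j)) \<longrightarrow>
      conv_in_distr
        P (\<lambda>r \<omega>. (\<chi> j. mat_powr r (- (real CARD('d) *\<^sub>R B u)) *v M ((\<lambda>s. u + r *\<^sub>R s) ` A j) \<omega>))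
        Q (\<lambda>\<omega>. (\<chi> j. M\<^sub>u (A j) \<omega>))
        (at_right 0))"
proof (intro conjI allI impI)
  define l c where "l = 1 / index_high B" and "c = 1 / index_low B"
  note between = exponent_function_between[OF assms(1)]
  have B: "exponent_between l c B" using between(1) by (simp add: l_def c_def)
  have Bu: "exponent_between l c (\<lambda>_. B u)" using B by (simp add: exponent_between_def)
  note conv = scaled_integrals_conv_in_distr[OF assms(2) B assms(3-6)]
  {
    fix f :: "'n \<Rightarrow> real^'d \<Rightarrow> real^'m^'m"
    assume f: "(\<forall>j. f j \<in> F_class (index_low B) (index_high B)) \<and>
      (\<forall>j. compact_support (f j)) \<and>
      (\<forall>j s1 s2. f j s1 ** B s2 = B s2 ** f j s1)"
    have mod: "modular_integrable l c (f j)" for j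
      unfolding l_def c_def using between f by (intro F_class_modular_integrable) auto
    show "conv_in_distr
        P (\<lambda>r \<omega>. (\<chi> j. mat_powr r (- (real CARD('d) *\<^sub>R B u)) *v scaled_integral P u r M (f j) \<omega>))
        Q (\<lambda>\<omega>. (\<chi> j. isrm_integral Q M\<^sub>u (f j) \<omega>))
        (at_right 0)"
    proof (rule conv[OF _ mod])
      show "has_isrm_integral P M (\<lambda>s. f j (scaling u r s)) (scaled_integral P u r M (f j))" if "0 < r" for r j
        unfolding scaled_integral_def
        by (rule has_isrm_integral_isrm_integral[OF assms(2) B assms(3) modular_integrable_scaling[OF that mod]])
      show "has_isrm_integral Q M\<^sub>u (f j) (isrm_integral Q M\<^sub>u (f j))" for j
        by (rule has_isrm_integral_isrm_integral[OF assms(2) Bu assms(4) mod])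
    qed (use f in \<open>auto simp: compact_support_def\<close>)
  next
    fix A :: "'n \<Rightarrow> (real^'d) set"
    assume A: "\<forall>j. A j \<in> sets borel \<and> bounded (A j)"
    then have fin: "A j \<in> finite_borel_sets" for j by (simp add: bounded_in_finite_borel_sets)
    define f :: "'n \<Rightarrow> real^'d \<Rightarrow> real^'m^'m" where "f j s = indicat_real (A j) s *\<^sub>R mat 1" for j s
    show "conv_in_distr
        P (\<lambda>r \<omega>. (\<chi> j. mat_powr r (- (real CARD('d) *\<^sub>R B u)) *v M ((\<lambda>s. u + r *\<^sub>R s) ` A j) \<omega>))
        Q (\<lambda>\<omega>. (\<chi> j. M\<^sub>u (A j) \<omega>))
        (at_right 0)"
    proof (rule conv[where f=f])
      show "modular_integrable l c (f j)" for j
        unfolding f_def[abs_def] by (rule modular_integrable_indicator[OF fin])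
      show "has_isrm_integral P M (\<lambda>s. f j (scaling u r s)) (M ((\<lambda>s. u + r *\<^sub>R s) ` A j))" if "0 < r" for r j
        unfolding f_def indicator_scaling[OF that]
        using A that by (intro has_isrm_integral_indicator[OF assms(3)] affine_image_in_finite_borel_sets) auto
      show "has_isrm_integral Q M\<^sub>u (f j) (M\<^sub>u (A j))" for j
        unfolding f_def[abs_def] by (rule has_isrm_integral_indicator[OF assms(4) fin])
      show "compact (closure {s. f j s \<noteq> 0})" for j
      proof -
        have "{s. f j s \<noteq> 0} \<subseteq> A j" by (auto simp: f_def indicator_def split: if_splits)
        then have "bounded {s. f j s \<noteq> 0}" using A bounded_subset by blast
        then show ?thesis by (simp add: compact_closure)
      qed
      show "f j s ** B u = B u ** f j s" for j s
        by (simp add: f_def matrix_mult.scaleR_left matrix_mult.scaleR_right)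
    qed
  }
qed

end
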